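(* Let $Y$ be a closed 3-manifold and $\Gamma=\pi_1(Y)$. Let $M$ and $N$ be homology cobordant closed 3-manifolds with $\pi=\pi_1(M)$ and $G=\pi_1(N)$, and let $\kappa$ be an ordinal. Then the following hold. (1) There is an isomorphism $\phi\colon \widehat G/\widehat G_\kappa\to\widehat\pi/\widehat\pi_\kappa$. Consequently $\theta_\kappa(N)$ is defined if and only if $\theta_\kappa(M)$ is defined. (2) The isomorphism $\phi$ in (1) can be taken (it depends on a choice of homology cobordism) so that, if $f\colon\widehat\pi/\widehat\pi_\kappa\to\widehat\Gamma/\widehat\Gamma_\kappa$ is an isomorphism, then $\theta_\kappa(M,f)=\theta_\kappa(N,f\circ\phi)$ in $H_3(\widehat\Gamma/\widehat\Gamma_\kappa)$. (3) If $\theta_\kappa(M)$ and $\theta_\kappa(N)$ are defined using arbitrary isomorphisms $\widehat\pi/\widehat\pi_\kappa\to\widehat\Gamma/\widehat\Gamma_\kappa$ and $\widehat G/\widehat G_\kappa\to\widehat\Gamma/\widehat\Gamma_\kappa$, then $\theta_\kappa(M)=\theta_\kappa(N)$ in the orbit set $H_3(\widehat\Gamma/\widehat\Gamma_\kappa)/\mathrm{Aut}(\widehat\Gamma/\widehat\Gamma_\kappa)$.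
   Context: All manifolds are compact and oriented, closed 3-manifolds are connected, and $H_*$ is integral homology. Two closed 3-manifolds $M,N$ are homology cobordant if there is a 4-manifold $W$ with $\partial W=M\sqcup -N$ such that the inclusions induce isomorphisms $H_*(M)\cong H_*(W)\cong H_*(N)$; such $W$ is a homology cobordism. Ordinals indexing lower central series are $\ge 1$; a discrete ordinal is a successor ordinal. For a group $G$: $G_1=G$, $G_\kappa=[G,G_{\kappa-1}]$ if $\kappa>1$ is discrete, and $G_\kappa=\bigcap_{\lambda<\kappa}G_\lambda$ if $\kappa$ is a limit ordinal. A group homomorphism is 2-connected if it induces an isomorphism on $H_1(-;\mathbb Z)$ and an epimorphism on $H_2(-;\mathbb Z)$. A group $L$ is local if for every 2-connected homomorphism $\alpha\colon A\to B$ between finitely presented groups and every homomorphism $f\colon A\to L$ there is a unique homomorphism $g\colon B\to L$ with $g\circ\alpha=f$. The homology localization of $G$ is the (functorial, essentially unique, always existing) homomorphism $G\to\widehat G$ with $\widehat G$ local such that every homomorphism from $G$ to a local group factors uniquely through $G\to\widehat G$. Write $\widehat G_\kappa=(\widehat G)_\kappa$. For a closed 3-manifold $M$ with $\pi=\pi_1(M)$ and an isomorphism $f\colon\widehat\pi/\widehat\pi_\kappa\to\widehat\Gamma/\widehat\Gamma_\kappa$, the class $\theta_\kappa(M,f)\in H_3(\widehat\Gamma/\widehat\Gamma_\kappa)$ is the image of the fundamental class $[M]$ under $H_3(M)\to H_3(\pi)\to H_3(\widehat\pi)\to H_3(\widehat\pi/\widehat\pi_\kappa)\xrightarrow{f_*}H_3(\widehat\Gamma/\widehat\Gamma_\kappa)$.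 One writes $\theta_\kappa(M)$ when $f$ is understood, and says $\theta_\kappa(M)$ is defined if some isomorphism $f$ exists. *)

theory Defs
  imports "HOL-Analysis.Analysis" "HOL-Homology.Homology" "HOL-Algebra.Group_Action"
begin

section \<open>Transfinite lower central series\<close>

text \<open>Ordinals \<open>\<ge> 1\<close> are represented by elements of the field of a well-order \<open>r\<close>: the least
  element stands for the ordinal 1, so \<open>k\<close> stands for \<open>1 + \<alpha>\<close>, where \<open>\<alpha>\<close> is the order type of
  \<open>underS r k\<close>. Successors and limits in \<open>r\<close> correspond to successor and limit ordinals \<open>> 1\<close>.\<close>

definition immediate_pred :: "'k rel \<Rightarrow> 'k \<Rightarrow> 'k \<Rightarrow> bool" where
  "immediate_pred r j k \<longleftrightarrow> j \<in> underS r k \<and> (\<forall>i\<in>underS r k. (i, j) \<in> r)"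

definition commutator_subgroup :: "('a, 'b) monoid_scheme \<Rightarrow> 'a set \<Rightarrow> 'a set \<Rightarrow> 'a set" where
  "commutator_subgroup G A B =
     generate G {a \<otimes>\<^bsub>G\<^esub> b \<otimes>\<^bsub>G\<^esub> inv\<^bsub>G\<^esub> a \<otimes>\<^bsub>G\<^esub> inv\<^bsub>G\<^esub> b | a b. a \<in> A \<and> b \<in> B}"

definition lower_central :: "('a, 'b) monoid_scheme \<Rightarrow> 'k rel \<Rightarrow> 'k \<Rightarrow> 'a set" where
  "lower_central G r = wfrec (r - Id) (\<lambda>F k.
     if \<exists>j. immediate_pred r j k
     then commutator_subgroup G (carrier G) (F (THE j. immediate_pred r j k))
     else carrier G \<inter> (\<Inter>j\<in>underS r k. F j))"

lemma immediate_pred_unique: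
  assumes "Well_order r" "immediate_pred r j k" "immediate_pred r j' k"
  shows "j = j'"
  using assms unfolding immediate_pred_def well_order_on_def linear_order_on_def
    partial_order_on_def by (blast dest: antisymD)

lemma lower_central_rec:
  assumes "Well_order r"
  shows "lower_central G r k =
    (if \<exists>j. immediate_pred r j k
     then commutator_subgroup G (carrier G) (lower_central G r (THE j. immediate_pred r j k))
     else carrier G \<inter> (\<Inter>j\<in>underS r k. lower_central G r j))"
proof -
  have wf: "wf (r - Id)" using assms by (simp add: well_order_on_def)
  have the: "(THE j. immediate_pred r j k) \<in> underS r k" if ex: "\<exists>j. immediate_pred r j k"
  proof -
    obtain j where j: "immediate_pred r j k" using ex by blast
    then have "(THE j. immediate_pred r j k) = j"
      using immediate_pred_unique[OF assms] by blast
    with j show ?thesis by (simp add: immediate_pred_def)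
  qed
  have under: "j \<in> underS r k \<longleftrightarrow> (j, k) \<in> r - Id" for j
    by (auto simp: underS_def)
  show ?thesis
    unfolding lower_central_def
    by (subst wfrec[OF wf]) (use the under in \<open>auto simp: cut_apply\<close>)
qed

lemma lower_central_one:
  assumes "Well_order r" "underS r k = {}"
  shows "lower_central G r k = carrier G"
  using assms by (subst lower_central_rec) (auto simp: immediate_pred_def)

lemma lower_central_successor:
  assumes "Well_order r" "immediate_pred r j k"
  shows "lower_central G r k = commutator_subgroup G (carrier G) (lower_central G r j)"
proof -
  have "(THE i. immediate_pred r i k) = j"
    using immediate_pred_unique[OF assms(1)] assms(2) by blast
  then show ?thesis
    using assms by (subst lower_central_rec) auto
qed

lemma lower_central_limit:
  assumes "Well_order r" "underS r k \<noteq> {}" "\<nexists>j. immediate_pred r j k"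
  shows "lower_central G r k = carrier G \<inter> (\<Inter>j\<in>underS r k. lower_central G r j)"
  using assms by (subst lower_central_rec) auto

abbreviation lower_central_quotient :: "('a, 'b) monoid_scheme \<Rightarrow> 'k rel \<Rightarrow> 'k \<Rightarrow> 'a set monoid"
  where "lower_central_quotient G r k \<equiv> G Mod lower_central G r k"


section \<open>Integral homology of groups\<close>

text \<open>The (inhomogeneous) bar complex with trivial coefficients \<open>\<int>\<close>; the list
  \<open>[g1, \<dots>, gn]\<close> is the bar generator \<open>[g1|\<dots>|gn]\<close>.\<close>

definition bar_chain_group :: "nat \<Rightarrow> ('a, 'b) monoid_scheme \<Rightarrow> ('a list \<Rightarrow>\<^sub>0 int) monoid" where
  "bar_chain_group n G = free_Abelian_group {xs. length xs = n \<and> set xs \<subseteq> carrier G}"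

definition bar_face :: "('a, 'b) monoid_scheme \<Rightarrow> nat \<Rightarrow> 'a list \<Rightarrow> 'a list" where
  "bar_face G i xs =
     (if i = 0 then tl xs
      else if i = length xs then butlast xs
      else take (i - 1) xs @ [xs ! (i - 1) \<otimes>\<^bsub>G\<^esub> xs ! i] @ drop (Suc i) xs)"

definition bar_boundary :: "('a, 'b) monoid_scheme \<Rightarrow> ('a list \<Rightarrow>\<^sub>0 int) \<Rightarrow> 'a list \<Rightarrow>\<^sub>0 int" where
  "bar_boundary G = frag_extend (\<lambda>xs.
     if xs = [] then 0
     else \<Sum>i\<le>length xs. frag_cmul ((- 1) ^ i) (frag_of (bar_face G i xs)))"

definition bar_cycles :: "nat \<Rightarrow> ('a, 'b) monoid_scheme \<Rightarrow> ('a list \<Rightarrow>\<^sub>0 int) set" where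
  "bar_cycles n G = {c \<in> carrier (bar_chain_group n G). bar_boundary G c = 0}"

definition bar_boundaries :: "nat \<Rightarrow> ('a, 'b) monoid_scheme \<Rightarrow> ('a list \<Rightarrow>\<^sub>0 int) set" where
  "bar_boundaries n G = bar_boundary G ` carrier (bar_chain_group (Suc n) G)"

definition group_homology :: "nat \<Rightarrow> ('a, 'b) monoid_scheme \<Rightarrow> ('a list \<Rightarrow>\<^sub>0 int) set monoid" where
  "group_homology n G =
     subgroup_generated (bar_chain_group n G) (bar_cycles n G) Mod bar_boundaries n G"

text \<open>The map \<open>H_n(G) \<rightarrow> H_n(K)\<close> induced by a homomorphism \<open>h : G \<rightarrow> K\<close>. Homology classes are
  cosets; the cosets united on the right-hand side all coincide.\<close>

definition group_homology_map ::
    "nat \<Rightarrow> ('b, 'c) monoid_scheme \<Rightarrow> ('a \<Rightarrow> 'b) \<Rightarrow> ('a list \<Rightarrow>\<^sub>0 int) set \<Rightarrow> ('b list \<Rightarrow>\<^sub>0 int) set" where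
  "group_homology_map n K h A =
     (\<Union>c\<in>A. bar_boundaries n K #>\<^bsub>bar_chain_group n K\<^esub> frag_extend (frag_of \<circ> map h) c)"

definition two_connected ::
    "('a, 'c) monoid_scheme \<Rightarrow> ('b, 'd) monoid_scheme \<Rightarrow> ('a \<Rightarrow> 'b) \<Rightarrow> bool" where
  "two_connected A B \<alpha> \<longleftrightarrow>
     \<alpha> \<in> hom A B \<and>
     group_homology_map 1 B \<alpha> \<in> iso (group_homology 1 A) (group_homology 1 B) \<and>
     group_homology_map 2 B \<alpha> \<in> epi (group_homology 2 A) (group_homology 2 B)"


section \<open>Finitely presented groups\<close>

text \<open>The letter \<open>(True, i)\<close> is the generator \<open>x_i\<close> and \<open>(False, i)\<close> is its inverse.\<close>

type_synonym gen_word = "(bool \<times> nat) list"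

definition gen_words :: "nat \<Rightarrow> gen_word set" where
  "gen_words n = lists (UNIV \<times> {..<n})"

inductive presentation_eq :: "gen_word set \<Rightarrow> gen_word \<Rightarrow> gen_word \<Rightarrow> bool" for R where
  refl: "presentation_eq R u u"
| sym: "presentation_eq R u v \<Longrightarrow> presentation_eq R v u"
| trans: "presentation_eq R u v \<Longrightarrow> presentation_eq R v w \<Longrightarrow> presentation_eq R u w"
| cancel: "presentation_eq R (u @ [(b, i), (\<not> b, i)] @ v) (u @ v)"
| relator: "s \<in> R \<Longrightarrow> presentation_eq R (u @ s @ v) (u @ v)"

definition presentation_class :: "nat \<Rightarrow> gen_word set \<Rightarrow> gen_word \<Rightarrow> gen_word set" where
  "presentation_class n R u = {v \<in> gen_words n. presentation_eq R u v}"

definition presented_group :: "nat \<Rightarrow> gen_word set \<Rightarrow> gen_word set monoid" where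
  "presented_group n R =
     \<lparr>carrier = presentation_class n R ` gen_words n,
      monoid.mult = \<lambda>A B. \<Union>u\<in>A. \<Union>v\<in>B. presentation_class n R (u @ v),
      one = presentation_class n R []\<rparr>"

definition finitely_presented :: "('a, 'b) monoid_scheme \<Rightarrow> bool" where
  "finitely_presented G \<longleftrightarrow>
     group G \<and> (\<exists>n R. finite R \<and> R \<subseteq> gen_words n \<and> G \<cong> presented_group n R)"


section \<open>Local groups and homology localization\<close>

text \<open>Finitely presented groups are countable, so it is no restriction to take \<open>A\<close> and \<open>B\<close> with
  carriers of natural numbers.\<close>

definition local_group :: "('a, 'b) monoid_scheme \<Rightarrow> bool" where
  "local_group L \<longleftrightarrow> group L \<and>
     (\<forall>(A :: nat monoid) (B :: nat monoid) \<alpha> f.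
        finitely_presented A \<and> finitely_presented B \<and> two_connected A B \<alpha> \<and> f \<in> hom A L \<longrightarrow>
        (\<exists>!g. g \<in> hom B L \<inter> extensional (carrier B) \<and> (\<forall>a\<in>carrier A. g (\<alpha> a) = f a)))"

text \<open>\<open>l : G \<rightarrow> E\<close> is the homology localization of \<open>G\<close>. A definition cannot quantify over groups
  on all types, so the universal property is required for local groups on the type
  \<open>'e + 'a + nat\<close>. This implies it for all local groups: the localization of \<open>G\<close> is obtained in
  \<open>\<omega>\<close> steps, each adjoining or identifying elements for the countably many two-connected maps
  \<open>A \<rightarrow> B\<close> of finitely presented groups and all homomorphisms from \<open>A\<close>, hence has cardinality
  at most \<open>max |G| \<aleph>\<^sub>0\<close>. So both it and \<open>E\<close> have copies on \<open>'e + 'a + nat\<close>, and comparing the two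
  universal properties identifies them.\<close>

definition homology_localization ::
    "('a, 'b) monoid_scheme \<Rightarrow> 'e monoid \<Rightarrow> ('a \<Rightarrow> 'e) \<Rightarrow> bool" where
  "homology_localization G E l \<longleftrightarrow>
     local_group E \<and> l \<in> hom G E \<and>
     (\<forall>(L :: ('e + 'a + nat) monoid) f.
        local_group L \<and> f \<in> hom G L \<longrightarrow>
        (\<exists>!g. g \<in> hom E L \<inter> extensional (carrier E) \<and> (\<forall>x\<in>carrier G. g (l x) = f x)))"


section \<open>Fundamental group and the map from singular homology to group homology\<close>

text \<open>The library's path operations and \<open>homotopic_paths\<close> are restricted to topological type
  classes; these are the versions for abstract topologies.\<close>

definition path_join :: "(real \<Rightarrow> 'a) \<Rightarrow> (real \<Rightarrow> 'a) \<Rightarrow> real \<Rightarrow> 'a" where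
  "path_join p q = (\<lambda>t. if t \<le> 1/2 then p (2 * t) else q (2 * t - 1))"

definition path_reverse :: "(real \<Rightarrow> 'a) \<Rightarrow> real \<Rightarrow> 'a" where
  "path_reverse p = (\<lambda>t. p (1 - t))"

definition loop_class :: "'a topology \<Rightarrow> 'a \<Rightarrow> (real \<Rightarrow> 'a) \<Rightarrow> (real \<Rightarrow> 'a) set" where
  "loop_class X x0 p =
     {q. homotopic_with (\<lambda>h. h 0 = x0 \<and> h 1 = x0) (top_of_set {0..1}) X p q}"

definition fundamental_group :: "'a topology \<Rightarrow> 'a \<Rightarrow> (real \<Rightarrow> 'a) set monoid" where
  "fundamental_group X x0 =
     \<lparr>carrier = loop_class X x0 ` {p. pathin X p \<and> p 0 = x0 \<and> p 1 = x0},
      monoid.mult = \<lambda>A B. \<Union>p\<in>A. \<Union>q\<in>B. loop_class X x0 (path_join p q),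
      one = loop_class X x0 (\<lambda>t. x0)\<rparr>"

text \<open>For a path connected space \<open>X\<close>, the map \<open>H_n(X) \<rightarrow> H_n(\<pi>\<^sub>1(X, x0))\<close> induced by a classifying
  map \<open>X \<rightarrow> K(\<pi>\<^sub>1(X, x0), 1)\<close>. Fix a path from \<open>x0\<close> to each point of \<open>X\<close>. A singular simplex with
  vertices \<open>v_0, \<dots>, v_n\<close> is sent to the bar generator \<open>[g1|\<dots>|gn]\<close>, where \<open>g_i\<close> is the class of
  the edge from \<open>v_(i-1)\<close> to \<open>v_i\<close>, closed up to a loop by the chosen paths. This is a chain map,
  and another choice of paths gives a chain homotopic one.\<close>

definition base_path :: "'a topology \<Rightarrow> 'a \<Rightarrow> 'a \<Rightarrow> real \<Rightarrow> 'a" where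
  "base_path X x0 x = (SOME p. pathin X p \<and> p 0 = x0 \<and> p 1 = x)"

definition simplex_edge :: "((nat \<Rightarrow> real) \<Rightarrow> 'a) \<Rightarrow> nat \<Rightarrow> real \<Rightarrow> 'a" where
  "simplex_edge \<sigma> i = (\<lambda>t. \<sigma> (\<lambda>j. if j = i then 1 - t else if j = Suc i then t else 0))"

definition edge_class :: "'a topology \<Rightarrow> 'a \<Rightarrow> ((nat \<Rightarrow> real) \<Rightarrow> 'a) \<Rightarrow> nat \<Rightarrow> (real \<Rightarrow> 'a) set" where
  "edge_class X x0 \<sigma> i =
     loop_class X x0
       (path_join (path_join (base_path X x0 (simplex_edge \<sigma> i 0)) (simplex_edge \<sigma> i))
                  (path_reverse (base_path X x0 (simplex_edge \<sigma> i 1))))"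

definition classifying_chain_map ::
    "nat \<Rightarrow> 'a topology \<Rightarrow> 'a \<Rightarrow> 'a chain \<Rightarrow> (real \<Rightarrow> 'a) set list \<Rightarrow>\<^sub>0 int" where
  "classifying_chain_map n X x0 =
     frag_extend (\<lambda>\<sigma>. frag_of (map (edge_class X x0 \<sigma>) [0..<n]))"

definition classifying_homology_map ::
    "nat \<Rightarrow> 'a topology \<Rightarrow> 'a \<Rightarrow> 'a chain set \<Rightarrow> ((real \<Rightarrow> 'a) set list \<Rightarrow>\<^sub>0 int) set" where
  "classifying_homology_map n X x0 A =
     (let \<pi> = fundamental_group X x0
      in \<Union>c\<in>A. bar_boundaries n \<pi> #>\<^bsub>bar_chain_group n \<pi>\<^esub> classifying_chain_map n X x0 c)"


section \<open>Oriented manifolds and homology cobordism\<close>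

definition half_space :: "nat \<Rightarrow> (nat \<Rightarrow> real) topology" where
  "half_space n = subtopology (Euclidean_space n) {x. 0 \<le> x 0}"

text \<open>Topological manifolds of dimension \<open>n \<ge> 1\<close>, with boundary allowed.\<close>

definition manifold_with_boundary :: "nat \<Rightarrow> 'a topology \<Rightarrow> bool" where
  "manifold_with_boundary n X \<longleftrightarrow>
     Hausdorff_space X \<and> second_countable X \<and>
     (\<forall>x\<in>topspace X. \<exists>U V. openin X U \<and> x \<in> U \<and> openin (half_space n) V \<and>
        subtopology X U homeomorphic_space subtopology (half_space n) V)"

definition manifold_interior :: "nat \<Rightarrow> 'a topology \<Rightarrow> 'a set" where
  "manifold_interior n X =
     {x \<in> topspace X. \<exists>U V. openin X U \<and> x \<in> U \<and> openin (Euclidean_space n) V \<and>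
        subtopology X U homeomorphic_space subtopology (Euclidean_space n) V}"

definition manifold_boundary :: "nat \<Rightarrow> 'a topology \<Rightarrow> 'a set" where
  "manifold_boundary n X = topspace X - manifold_interior n X"

text \<open>An orientation of a compact \<open>n\<close>-manifold \<open>X\<close> is given by its fundamental class: a class in
  \<open>H_n(X, \<partial>X)\<close> that restricts to a generator of \<open>H_n(X, X - {x}) \<cong> \<int>\<close> for each interior
  point \<open>x\<close>.\<close>

definition fundamental_class :: "nat \<Rightarrow> 'a topology \<Rightarrow> 'a chain set \<Rightarrow> bool" where
  "fundamental_class n X c \<longleftrightarrow>
     c \<in> carrier (relative_homology_group (int n) X (manifold_boundary n X)) \<and>
     (\<forall>x\<in>manifold_interior n X.
        generate (relative_homology_group (int n) X (topspace X - {x}))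
          {hom_induced (int n) X (manifold_boundary n X) X (topspace X - {x}) id c}
        = carrier (relative_homology_group (int n) X (topspace X - {x})))"

definition compact_oriented_manifold :: "nat \<Rightarrow> 'a topology \<Rightarrow> 'a chain set \<Rightarrow> bool" where
  "compact_oriented_manifold n X c \<longleftrightarrow>
     manifold_with_boundary n X \<and> compact_space X \<and> fundamental_class n X c"

definition closed_3_manifold :: "'a topology \<Rightarrow> 'a chain set \<Rightarrow> bool" where
  "closed_3_manifold X c \<longleftrightarrow>
     compact_oriented_manifold 3 X c \<and> manifold_boundary 3 X = {} \<and>
     connected_space X \<and> topspace X \<noteq> {}"

text \<open>\<open>W\<close> is a homology cobordism between \<open>M\<close> and \<open>N\<close>, which are identified with the two parts of
  \<open>\<partial>W\<close> by the embeddings \<open>i\<close> and \<open>j\<close>. The boundary orientation of \<open>\<partial>W\<close> is the image of the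
  fundamental class of \<open>W\<close> under \<open>H_4(W, \<partial>W) \<rightarrow> H_3(\<partial>W)\<close>; the last condition of \<open>bounds_difference\<close>
  says that \<open>\<partial>W = M \<squnion> -N\<close> as oriented manifolds.\<close>

definition bounds_difference ::
    "'w topology \<Rightarrow> 'w chain set \<Rightarrow> 'm topology \<Rightarrow> 'm chain set \<Rightarrow> ('m \<Rightarrow> 'w) \<Rightarrow>
     'n topology \<Rightarrow> 'n chain set \<Rightarrow> ('n \<Rightarrow> 'w) \<Rightarrow> bool" where
  "bounds_difference W cW M cM i N cN j \<longleftrightarrow>
     (let B = manifold_boundary 4 W; dW = subtopology W B in
      embedding_map M W i \<and> embedding_map N W j \<and>
      i ` topspace M \<inter> j ` topspace N = {} \<and> i ` topspace M \<union> j ` topspace N = B \<and>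
      hom_boundary 4 W B cW =
        hom_induced 3 M {} dW {} i cM
          \<otimes>\<^bsub>homology_group 3 dW\<^esub> inv\<^bsub>homology_group 3 dW\<^esub> hom_induced 3 N {} dW {} j cN)"

definition homology_cobordism ::
    "'w topology \<Rightarrow> 'w chain set \<Rightarrow> 'm topology \<Rightarrow> 'm chain set \<Rightarrow> ('m \<Rightarrow> 'w) \<Rightarrow>
     'n topology \<Rightarrow> 'n chain set \<Rightarrow> ('n \<Rightarrow> 'w) \<Rightarrow> bool" where
  "homology_cobordism W cW M cM i N cN j \<longleftrightarrow>
     compact_oriented_manifold 4 W cW \<and> bounds_difference W cW M cM i N cN j \<and>
     (\<forall>p. hom_induced p M {} W {} i \<in> iso (homology_group p M) (homology_group p W)) \<and>
     (\<forall>p. hom_induced p N {} W {} j \<in> iso (homology_group p N) (homology_group p W))"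


section \<open>The invariant\<close>

text \<open>\<open>theta\<close> takes a closed 3-manifold \<open>M\<close> with base point \<open>m0\<close> and fundamental class \<open>c\<close>, the
  localization \<open>l : \<pi>\<^sub>1(M, m0) \<rightarrow> E\<close>, the localization \<open>D\<close> of \<open>\<pi>\<^sub>1(Y)\<close>, and the isomorphism
  \<open>f : E / E_k \<rightarrow> D / D_k\<close>.\<close>

definition theta ::
    "'k rel \<Rightarrow> 'k \<Rightarrow> 'm topology \<Rightarrow> 'm \<Rightarrow> 'm chain set \<Rightarrow>
     'e monoid \<Rightarrow> ((real \<Rightarrow> 'm) set \<Rightarrow> 'e) \<Rightarrow> 'd monoid \<Rightarrow> ('e set \<Rightarrow> 'd set) \<Rightarrow>
     ('d set list \<Rightarrow>\<^sub>0 int) set" where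
  "theta r k M m0 c E l D f =
     group_homology_map 3 (lower_central_quotient D r k) f
       (group_homology_map 3 (lower_central_quotient E r k) (\<lambda>x. lower_central E r k #>\<^bsub>E\<^esub> x)
         (group_homology_map 3 E l
           (classifying_homology_map 3 M m0 c)))"

definition theta_defined :: "'k rel \<Rightarrow> 'k \<Rightarrow> 'e monoid \<Rightarrow> 'd monoid \<Rightarrow> bool" where
  "theta_defined r k E D \<longleftrightarrow>
     (\<exists>f. f \<in> iso (lower_central_quotient E r k) (lower_central_quotient D r k))"

text \<open>The element of \<open>H_3(Q) / Aut(Q)\<close> represented by a class in \<open>H_3(Q)\<close>.\<close>

definition aut_orbit :: "'q monoid \<Rightarrow> ('q list \<Rightarrow>\<^sub>0 int) set \<Rightarrow> ('q list \<Rightarrow>\<^sub>0 int) set set" where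
  "aut_orbit Q x = orbit (AutoGroup Q) (group_homology_map 3 Q) x"

end

(* A homology cobordism W makes both fundamental groups map to pi_1(W) by two-connected homomorphisms:
   H_1 of a space is H_1 of its fundamental group and H_2 surjects, which is seen on chains by filling
   loops and triangles. Fundamental groups of compact manifolds are finitely presented, because the
   Cech cocycle of a cover by simply connected sets exhibits them as retracts of finitely presented
   groups. Hence the localizations of pi_1(M), pi_1(W), pi_1(N) share one universal property and are
   isomorphic, compatibly with the maps to the localization of pi_1(W). To compare localizations on
   different types one needs them countable: closing the image of a countable group under the countably
   many extension problems gives a countable local subgroup, which the universal property forces to be
   everything. The two fundamental classes agree in H_3(W), since their difference is the boundary of
   the class of W; naturality of the map to group homology then gives (2), and (3) follows from (2). *)

theory Submission
  imports Defs "HOL-Algebra.Weak_Morphisms"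
begin

section \<open>Homotopy of paths in abstract topologies\<close>

text \<open>Every comparison passes through functors from the fundamental groupoid to a group
  (\<open>path_functor\<close>). Such a functor labels the edges of singular simplices and so gives
  a chain map to bar chains; changing base points or connecting paths conjugates it by a frame,
  which is invisible in homology. This is why one base point of \<open>W\<close> serves both ends
  and why no classifying space is constructed. No localization of \<pi>_1(W) is constructed either:
  finite presentability makes \<pi>_1(M) \<rightarrow> \<pi>_1(W) one of the maps against which
  locality is tested, so \<pi>_1(M) \<rightarrow> \<open>\<pi>h\<close> extends over \<pi>_1(W)
  directly. The price is finite presentability for compact topological manifolds, obtained from
  charts with convex images, Lebesgue numbers and parallel transport instead of triangulations or
  van Kampen. The transfinite index costs little: an isomorphism of the localizations carries each
  term of the lower central series onto the corresponding one, so no argument of Stallings type is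
  repeated at each ordinal.\<close>

definition path_homotopic :: "'a topology \<Rightarrow> (real \<Rightarrow> 'a) \<Rightarrow> (real \<Rightarrow> 'a) \<Rightarrow> bool" where
  "path_homotopic X p q \<longleftrightarrow>
     homotopic_with (\<lambda>h. h 0 = p 0 \<and> h 1 = p 1) (top_of_set {0..1}) X p q"

text \<open>The first coordinate of \<open>H\<close> is the homotopy parameter and the second the
  path parameter; every square below keeps this order.\<close>

lemma path_homotopic_iff:
  "path_homotopic X p q \<longleftrightarrow>
     (\<exists>H :: real \<times> real \<Rightarrow> 'a. continuous_map (top_of_set ({0..1} \<times> {0..1})) X H \<and>
        (\<forall>t\<in>{0..1}. H (0, t) = p t) \<and> (\<forall>t\<in>{0..1}. H (1, t) = q t) \<and>
        (\<forall>s\<in>{0..1}. H (s, 0) = p 0 \<and> H (s, 1) = p 1))"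
proof -
  have "prod_topology (top_of_set {0..1::real}) (top_of_set {0..1::real}) =
      top_of_set ({0..1} \<times> {0..1})"
    by simp
  then show ?thesis
    unfolding path_homotopic_def by (subst homotopic_with) (simp_all del: continuous_map_subtopology_eu)
qed

lemma path_homotopic_imp_pathin:
  assumes "path_homotopic X p q"
  shows "pathin X p" "pathin X q"
  using assms homotopic_with_imp_continuous_maps
  unfolding path_homotopic_def pathin_def by blast+

lemma path_homotopic_ends:
  assumes "path_homotopic X p q"
  shows "q 0 = p 0" "q 1 = p 1"
  using homotopic_with_imp_property[OF assms[unfolded path_homotopic_def]] by auto

lemma path_homotopic_refl [simp]: "path_homotopic X p p \<longleftrightarrow> pathin X p"
  by (simp add: path_homotopic_def pathin_def)

lemma path_homotopic_sym: "path_homotopic X p q \<Longrightarrow> path_homotopic X q p"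
  using path_homotopic_ends[of X p q] unfolding path_homotopic_def
  by (simp add: homotopic_with_sym)

lemma path_homotopic_trans [trans]:
  "path_homotopic X p q \<Longrightarrow> path_homotopic X q r \<Longrightarrow> path_homotopic X p r"
  using path_homotopic_ends[of X p q] unfolding path_homotopic_def
  by (simp add: homotopic_with_trans)

lemma path_homotopic_eq:
  assumes "pathin X p" "\<And>t. t \<in> {0..1} \<Longrightarrow> p t = q t"
  shows "path_homotopic X p q"
  unfolding path_homotopic_def
  by (rule homotopic_with_equal) (use assms in \<open>auto simp: pathin_def\<close>)

lemma path_homotopic_compose:
  assumes "path_homotopic X p q" "continuous_map X Y h"
  shows "path_homotopic Y (h \<circ> p) (h \<circ> q)"
  using assms(1) unfolding path_homotopic_def
  by (rule homotopic_with_compose_continuous_map_left) (use assms in auto)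

lemma path_homotopic_convex:
  fixes S :: "'a::real_normed_vector set"
  assumes "convex S" "pathin (top_of_set S) p" "pathin (top_of_set S) q" "p 0 = q 0" "p 1 = q 1"
  shows "path_homotopic (top_of_set S) p q"
proof (subst path_homotopic_iff, intro exI conjI ballI)
  let ?H = "\<lambda>(s::real, t::real). (1 - s) *\<^sub>R p t + s *\<^sub>R q t"
  have p: "continuous_on {0..1} p" "p \<in> {0..1} \<rightarrow> S" and q: "continuous_on {0..1} q" "q \<in> {0..1} \<rightarrow> S"
    using assms by (auto simp: pathin_canon_iff path_def)
  have "continuous_on ({0..1} \<times> {0..1}) ?H"
    unfolding case_prod_unfold
    by (intro continuous_intros continuous_on_compose2[OF p(1)] continuous_on_compose2[OF q(1)]) auto
  moreover have "?H \<in> ({0..1} \<times> {0..1}) \<rightarrow> S"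
  proof clarify
    fix s t :: real assume "s \<in> {0..1}" "t \<in> {0..1}"
    then show "(1 - s) *\<^sub>R p t + s *\<^sub>R q t \<in> S"
      using p q by (intro convexD[OF assms(1)]) auto
  qed
  ultimately show "continuous_map (top_of_set ({0..1} \<times> {0..1})) (top_of_set S) ?H"
    by (simp add: image_subset_iff_funcset)
qed (use assms in \<open>auto simp flip: scaleR_add_left\<close>)

text \<open>Segments are written by coordinates because points of simplices and of Euclidean charts
  are functions \<open>nat \<Rightarrow> real\<close>, topologised as a product.\<close>

lemma path_homotopic_pointwise_convex:
  fixes S :: "(nat \<Rightarrow> real) set"
  assumes S: "\<And>x y s. x \<in> S \<Longrightarrow> y \<in> S \<Longrightarrow> 0 \<le> s \<Longrightarrow> s \<le> 1 \<Longrightarrow> (\<lambda>i. (1 - s) * x i + s * y i) \<in> S"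
    and "pathin (subtopology (powertop_real UNIV) S) p" "pathin (subtopology (powertop_real UNIV) S) q"
      "p 0 = q 0" "p 1 = q 1"
  shows "path_homotopic (subtopology (powertop_real UNIV) S) p q"
proof (subst path_homotopic_iff, intro exI conjI ballI)
  let ?H = "\<lambda>(s::real, t::real). (\<lambda>i. (1 - s) * p t i + s * q t i)"
  have p: "\<And>i. continuous_on {0..1} (\<lambda>t. p t i)" "p \<in> {0..1} \<rightarrow> S"
    and q: "\<And>i. continuous_on {0..1} (\<lambda>t. q t i)" "q \<in> {0..1} \<rightarrow> S"
    using assms by (auto simp: pathin_def continuous_map_in_subtopology continuous_map_componentwise_UNIV)
  have "continuous_on ({0..1} \<times> {0..1}) (\<lambda>x. ?H x i)" for i
    unfolding case_prod_unfold
    by (intro continuous_intros continuous_on_compose2[OF p(1)] continuous_on_compose2[OF q(1)]) auto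
  then show "continuous_map (top_of_set ({0..1} \<times> {0..1})) (subtopology (powertop_real UNIV) S) ?H"
    using p q by (auto simp: continuous_map_in_subtopology continuous_map_componentwise_UNIV intro!: S)
qed (use assms in \<open>auto simp: algebra_simps\<close>)

text \<open>Since [0, 1] is convex, two of its self-maps with the same ends are homotopic relative
  to the ends, and \<open>p\<close> carries the homotopy over. Associativity, units and inverses of
  paths all reduce to this.\<close>

lemma path_homotopic_through_interval:
  assumes "pathin X p" "continuous_on {0..1} u" "continuous_on {0..1} v"
    "u ` {0..1} \<subseteq> {0..1}" "v ` {0..1} \<subseteq> {0..1}" "u 0 = v 0" "u 1 = v 1"
  shows "path_homotopic X (p \<circ> u) (p \<circ> v)"
proof (rule path_homotopic_compose)
  show "path_homotopic (top_of_set {0..1}) u v"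
    using assms by (intro path_homotopic_convex) (auto simp: pathin_canon_iff path_def)
qed (use assms in \<open>auto simp: pathin_def\<close>)

lemma pathin_through_interval:
  assumes "pathin X p" "continuous_on {0..1} u" "u ` {0..1} \<subseteq> {0..1}"
  shows "pathin X (p \<circ> u)"
  using path_homotopic_through_interval[of X p u u] assms by simp

section \<open>Joining and reversing paths up to homotopy\<close>

lemma path_join_ends [simp]: "path_join p q 0 = p 0" "path_join p q 1 = q 1"
  by (simp_all add: path_join_def)

lemma path_reverse_ends [simp]: "path_reverse p 0 = p 1" "path_reverse p 1 = p 0"
  by (simp_all add: path_reverse_def)

lemma path_join_compose: "g \<circ> path_join p q = path_join (g \<circ> p) (g \<circ> q)"
  by (auto simp: path_join_def)

lemma path_homotopic_join:
  assumes "path_homotopic X p p'" "path_homotopic X q q'" "p 1 = q 0"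
  shows "path_homotopic X (path_join p q) (path_join p' q')"
proof -
  let ?I = "{0..1} \<times> {0..1} :: (real \<times> real) set"
  obtain H where H: "continuous_map (top_of_set ?I) X H"
        "\<forall>t\<in>{0..1}. H (0, t) = p t" "\<forall>t\<in>{0..1}. H (1, t) = p' t"
        "\<forall>s\<in>{0..1}. H (s, 0) = p 0 \<and> H (s, 1) = p 1"
    using assms(1) unfolding path_homotopic_iff by blast
  obtain K where K: "continuous_map (top_of_set ?I) X K"
        "\<forall>t\<in>{0..1}. K (0, t) = q t" "\<forall>t\<in>{0..1}. K (1, t) = q' t"
        "\<forall>s\<in>{0..1}. K (s, 0) = q 0 \<and> K (s, 1) = q 1"
    using assms(2) unfolding path_homotopic_iff by blast
  let ?F = "\<lambda>z. if snd z \<le> 1/2 then H (fst z, 2 * snd z) else K (fst z, 2 * snd z - 1)"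
  have cf: "continuous_map (top_of_set (?I \<inter> {z. snd z \<le> 1/2})) (top_of_set ?I) (\<lambda>z. (fst z, 2 * snd z))"
    by (auto intro!: continuous_intros)
  have cg: "continuous_map (top_of_set (?I \<inter> {z. snd z \<ge> 1/2})) (top_of_set ?I) (\<lambda>z. (fst z, 2 * snd z - 1))"
    by (auto intro!: continuous_intros)
  have "continuous_map (top_of_set ?I) X ?F"
  proof (rule continuous_map_cases_le)
    show "continuous_map (subtopology (top_of_set ?I) {x \<in> topspace (top_of_set ?I). snd x \<le> 1/2}) X
        (\<lambda>z. H (fst z, 2 * snd z))"
      using continuous_map_compose[OF cf H(1)] by (simp add: subtopology_subtopology o_def Int_def)
    show "continuous_map (subtopology (top_of_set ?I) {x \<in> topspace (top_of_set ?I). 1/2 \<le> snd x}) X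
        (\<lambda>z. K (fst z, 2 * snd z - 1))"
      using continuous_map_compose[OF cg K(1)] by (simp add: subtopology_subtopology o_def Int_def)
  next
    fix x assume x: "x \<in> topspace (top_of_set ?I)" "snd x = 1/2"
    then have "2 * snd x = 1" by simp
    then show "H (fst x, 2 * snd x) = K (fst x, 2 * snd x - 1)"
      unfolding \<open>2 * snd x = 1\<close> using x H(4) K(4) assms(3) by (auto simp: mem_Times_iff)
  qed (auto intro!: continuous_intros)
  then show ?thesis
    unfolding path_homotopic_iff using H K by (intro exI[of _ ?F]) (auto simp: path_join_def)
qed

lemma pathin_join:
  assumes "pathin X p" "pathin X q" "p 1 = q 0"
  shows "pathin X (path_join p q)"
  using path_homotopic_join[of X p p q q] assms by simp

lemma pathin_reverse: "pathin X p \<Longrightarrow> pathin X (path_reverse p)"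
  using pathin_through_interval[of X p "\<lambda>t. 1 - t"]
  by (force simp: path_reverse_def o_def intro: continuous_intros)

lemma path_homotopic_reparam:
  assumes "pathin X p" "continuous_on {0..1} u" "u ` {0..1} \<subseteq> {0..1}" "u 0 = 0" "u 1 = 1"
  shows "path_homotopic X (p \<circ> u) p"
  using path_homotopic_through_interval[of X p u "\<lambda>t. t"] assms by (simp add: o_def continuous_on_id)

lemma path_homotopic_assoc:
  assumes "pathin X p" "pathin X q" "pathin X r" "p 1 = q 0" "q 1 = r 0"
  shows "path_homotopic X (path_join p (path_join q r)) (path_join (path_join p q) r)"
proof -
  \<comment> \<open>\<open>?u\<close> carries the breakpoints 1/2 and 3/4 to 1/4 and 1/2; being
    convex and piecewise linear, it is the maximum of its three linear pieces.\<close>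
  let ?u = "\<lambda>t::real. max (t/2) (max (t - 1/4) (2 * t - 1))"
  have "path_homotopic X (path_join (path_join p q) r \<circ> ?u) (path_join (path_join p q) r)"
    by (rule path_homotopic_reparam) (use assms in \<open>auto intro!: pathin_join continuous_intros simp: le_max_iff_disj\<close>)
  moreover have "path_join (path_join p q) r \<circ> ?u = path_join p (path_join q r)"
  proof
    fix t :: real
    consider "t \<le> 1/2" | "1/2 < t" "t \<le> 3/4" | "3/4 < t" by linarith
    then show "(path_join (path_join p q) r \<circ> ?u) t = path_join p (path_join q r) t"
      by cases (auto simp: path_join_def max_def field_simps intro!: arg_cong[of _ _ p] arg_cong[of _ _ q])
  qed
  ultimately show ?thesis by simp
qed

lemma path_homotopic_const_join:
  assumes "pathin X p"
  shows "path_homotopic X (path_join (\<lambda>t. p 0) p) p"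
proof -
  have "path_homotopic X (p \<circ> (\<lambda>t. max 0 (2 * t - 1))) p"
    by (rule path_homotopic_reparam) (use assms in \<open>auto intro!: continuous_intros\<close>)
  moreover have "p \<circ> (\<lambda>t. max 0 (2 * t - 1)) = path_join (\<lambda>t. p 0) p"
    by (auto simp: path_join_def max_def fun_eq_iff intro!: arg_cong[of _ _ p])
  ultimately show ?thesis by simp
qed

lemma path_homotopic_join_const:
  assumes "pathin X p"
  shows "path_homotopic X (path_join p (\<lambda>t. p 1)) p"
proof -
  have "path_homotopic X (p \<circ> (\<lambda>t. min 1 (2 * t))) p"
    by (rule path_homotopic_reparam) (use assms in \<open>auto intro!: continuous_intros\<close>)
  moreover have "p \<circ> (\<lambda>t. min 1 (2 * t)) = path_join p (\<lambda>t. p 1)"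
    by (auto simp: path_join_def min_def fun_eq_iff intro!: arg_cong[of _ _ p])
  ultimately show ?thesis by simp
qed

lemma path_homotopic_join_reverse:
  assumes "pathin X p"
  shows "path_homotopic X (path_join p (path_reverse p)) (\<lambda>t. p 0)"
proof -
  \<comment> \<open>\<open>min (2 * t) (2 - 2 * t)\<close> runs to 1 and back, so it is a loop in
    the interval and contracts to its starting point 0.\<close>
  have "path_homotopic X (p \<circ> (\<lambda>t. min (2 * t) (2 - 2 * t))) (p \<circ> (\<lambda>t. 0))"
    by (rule path_homotopic_through_interval) (use assms in \<open>auto intro!: continuous_intros\<close>)
  moreover have "p \<circ> (\<lambda>t. min (2 * t) (2 - 2 * t)) = path_join p (path_reverse p)"
    by (auto simp: path_join_def path_reverse_def min_def algebra_simps)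
  ultimately show ?thesis by (simp add: o_def)
qed

lemma path_homotopic_reverse_join:
  assumes "pathin X p"
  shows "path_homotopic X (path_join (path_reverse p) p) (\<lambda>t. p 1)"
proof -
  have "path_reverse (path_reverse p) = p" by (auto simp: path_reverse_def)
  then show ?thesis
    using path_homotopic_join_reverse[OF pathin_reverse[OF assms]] by simp
qed

section \<open>The fundamental group and functors on the fundamental groupoid\<close>

lemma loop_class_eq:
  assumes "p 0 = x0" "p 1 = x0"
  shows "loop_class X x0 p = Collect (path_homotopic X p)"
  unfolding loop_class_def path_homotopic_def assms ..

lemma loop_class_self: "pathin X p \<Longrightarrow> p 0 = x0 \<Longrightarrow> p 1 = x0 \<Longrightarrow> p \<in> loop_class X x0 p"
  by (simp add: loop_class_eq)

lemma loop_class_cong: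
  assumes "path_homotopic X p q" "p 0 = x0" "p 1 = x0"
  shows "loop_class X x0 p = loop_class X x0 q"
  using assms path_homotopic_ends[OF assms(1)]
  by (auto simp: loop_class_eq intro: path_homotopic_trans path_homotopic_sym)

lemma mem_loop_class:
  assumes "q \<in> loop_class X x0 p" "p 0 = x0" "p 1 = x0"
  shows "pathin X q" "q 0 = x0" "q 1 = x0" "path_homotopic X p q" "loop_class X x0 q = loop_class X x0 p"
proof -
  show h: "path_homotopic X p q" using assms by (simp add: loop_class_eq)
  show "pathin X q" "q 0 = x0" "q 1 = x0"
    using path_homotopic_imp_pathin[OF h] path_homotopic_ends[OF h] assms by auto
  show "loop_class X x0 q = loop_class X x0 p"
    using loop_class_cong[OF h] assms by simp
qed

lemma carrier_fundamental_group:
  "carrier (fundamental_group X x0) = loop_class X x0 ` {p. pathin X p \<and> p 0 = x0 \<and> p 1 = x0}"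
  by (simp add: fundamental_group_def)

lemma fundamental_groupE:
  assumes "A \<in> carrier (fundamental_group X x0)"
  obtains p where "pathin X p" "p 0 = x0" "p 1 = x0" "A = loop_class X x0 p"
  using assms by (auto simp: carrier_fundamental_group)

lemma loop_class_in_carrier [intro]:
  "pathin X p \<Longrightarrow> p 0 = x0 \<Longrightarrow> p 1 = x0 \<Longrightarrow> loop_class X x0 p \<in> carrier (fundamental_group X x0)"
  by (auto simp: carrier_fundamental_group)

lemma one_fundamental_group: "\<one>\<^bsub>fundamental_group X x0\<^esub> = loop_class X x0 (\<lambda>t. x0)"
  by (simp add: fundamental_group_def)

lemma mult_fundamental_group:
  assumes p: "pathin X p" "p 0 = x0" "p 1 = x0" and q: "pathin X q" "q 0 = x0" "q 1 = x0"
  shows "loop_class X x0 p \<otimes>\<^bsub>fundamental_group X x0\<^esub> loop_class X x0 q = loop_class X x0 (path_join p q)"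
proof -
  have "loop_class X x0 (path_join p' q') = loop_class X x0 (path_join p q)"
    if "p' \<in> loop_class X x0 p" "q' \<in> loop_class X x0 q" for p' q'
    using mem_loop_class[OF that(1)] mem_loop_class[OF that(2)] p q
    by (intro loop_class_cong path_homotopic_join) (auto intro: path_homotopic_sym)
  moreover have "loop_class X x0 p \<noteq> {}" "loop_class X x0 q \<noteq> {}"
    using loop_class_self p q by fastforce+
  ultimately have "(\<Union>p'\<in>loop_class X x0 p. \<Union>q'\<in>loop_class X x0 q. loop_class X x0 (path_join p' q'))
      = loop_class X x0 (path_join p q)"
    by auto
  then show ?thesis by (simp add: fundamental_group_def)
qed

lemma group_fundamental_group:
  assumes "x0 \<in> topspace X"
  shows "group (fundamental_group X x0)"
proof (rule groupI)
  fix A B C assume "A \<in> carrier (fundamental_group X x0)" "B \<in> carrier (fundamental_group X x0)"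
    "C \<in> carrier (fundamental_group X x0)"
  then obtain p q r where p: "pathin X p" "p 0 = x0" "p 1 = x0" "A = loop_class X x0 p"
    and q: "pathin X q" "q 0 = x0" "q 1 = x0" "B = loop_class X x0 q"
    and r: "pathin X r" "r 0 = x0" "r 1 = x0" "C = loop_class X x0 r"
    by (metis fundamental_groupE)
  show "A \<otimes>\<^bsub>fundamental_group X x0\<^esub> B \<otimes>\<^bsub>fundamental_group X x0\<^esub> C
     = A \<otimes>\<^bsub>fundamental_group X x0\<^esub> (B \<otimes>\<^bsub>fundamental_group X x0\<^esub> C)"
    using p q r path_homotopic_assoc[of X p q r]
    by (simp add: mult_fundamental_group pathin_join loop_class_cong[OF path_homotopic_sym])
next
  fix A B assume "A \<in> carrier (fundamental_group X x0)" "B \<in> carrier (fundamental_group X x0)"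
  then show "A \<otimes>\<^bsub>fundamental_group X x0\<^esub> B \<in> carrier (fundamental_group X x0)"
    by (elim fundamental_groupE) (auto simp: mult_fundamental_group pathin_join)
next
  show "\<one>\<^bsub>fundamental_group X x0\<^esub> \<in> carrier (fundamental_group X x0)"
    using assms by (auto simp: one_fundamental_group)
next
  fix A assume "A \<in> carrier (fundamental_group X x0)"
  then obtain p where p: "pathin X p" "p 0 = x0" "p 1 = x0" "A = loop_class X x0 p"
    by (elim fundamental_groupE)
  then show "\<one>\<^bsub>fundamental_group X x0\<^esub> \<otimes>\<^bsub>fundamental_group X x0\<^esub> A = A"
    using assms path_homotopic_const_join[OF p(1)]
    by (simp add: one_fundamental_group mult_fundamental_group loop_class_cong)
  have "loop_class X x0 (path_reverse p) \<otimes>\<^bsub>fundamental_group X x0\<^esub> A = \<one>\<^bsub>fundamental_group X x0\<^esub>"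
    using p path_homotopic_reverse_join[OF p(1)]
    by (simp add: one_fundamental_group mult_fundamental_group pathin_reverse loop_class_cong)
  then show "\<exists>B\<in>carrier (fundamental_group X x0). B \<otimes>\<^bsub>fundamental_group X x0\<^esub> A = \<one>\<^bsub>fundamental_group X x0\<^esub>"
    using p by (intro bexI[of _ "loop_class X x0 (path_reverse p)"]) (auto simp: pathin_reverse)
qed

text \<open>Functors from the fundamental groupoid of \<open>X\<close> to the group \<open>Q\<close>, given on paths. Through them
  base points, choices of connecting paths and induced homomorphisms are all handled uniformly.\<close>

definition path_functor :: "'a topology \<Rightarrow> ('q, 'r) monoid_scheme \<Rightarrow> ((real \<Rightarrow> 'a) \<Rightarrow> 'q) \<Rightarrow> bool" where
  "path_functor X Q w \<longleftrightarrow>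
     (\<forall>p. pathin X p \<longrightarrow> w p \<in> carrier Q) \<and>
     (\<forall>p q. path_homotopic X p q \<longrightarrow> w p = w q) \<and>
     (\<forall>p q. pathin X p \<longrightarrow> pathin X q \<longrightarrow> p 1 = q 0 \<longrightarrow> w (path_join p q) = w p \<otimes>\<^bsub>Q\<^esub> w q)"

lemma path_functorD:
  assumes "path_functor X Q w"
  shows "pathin X p \<Longrightarrow> w p \<in> carrier Q"
    and "path_homotopic X p q \<Longrightarrow> w p = w q"
    and "pathin X p \<Longrightarrow> pathin X q \<Longrightarrow> p 1 = q 0 \<Longrightarrow> w (path_join p q) = w p \<otimes>\<^bsub>Q\<^esub> w q"
  using assms by (auto simp: path_functor_def)

text \<open>A constant path joined with itself is unchanged, so its value is an idempotent of the
  group.\<close>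

lemma path_functor_const:
  assumes "path_functor X Q w" "group Q" "x \<in> topspace X"
  shows "w (\<lambda>t. x) = \<one>\<^bsub>Q\<^esub>"
proof -
  have "path_join (\<lambda>t. x) (\<lambda>t. x) = (\<lambda>t. x)" by (auto simp: path_join_def)
  then have "w (\<lambda>t. x) \<otimes>\<^bsub>Q\<^esub> w (\<lambda>t. x) = w (\<lambda>t. x)"
    using path_functorD(3)[OF assms(1), of "\<lambda>t. x" "\<lambda>t. x"] assms(3) by simp
  then show ?thesis
    using assms path_functorD(1)[OF assms(1), of "\<lambda>t. x"] by (simp add: group.l_cancel_one)
qed

lemma path_functor_reverse:
  assumes "path_functor X Q w" "group Q" "pathin X p"
  shows "w (path_reverse p) = inv\<^bsub>Q\<^esub> w p"
proof -
  have "w (path_reverse p) \<otimes>\<^bsub>Q\<^esub> w p = w (path_join (path_reverse p) p)"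
    using path_functorD(3)[OF assms(1) pathin_reverse[OF assms(3)] assms(3)] by simp
  also have "\<dots> = w (\<lambda>t. p 1)"
    by (rule path_functorD(2)[OF assms(1) path_homotopic_reverse_join[OF assms(3)]])
  also have "\<dots> = \<one>\<^bsub>Q\<^esub>"
    using assms by (intro path_functor_const) (auto intro: path_finish_in_topspace)
  finally show ?thesis
    using assms path_functorD(1)[OF assms(1)] pathin_reverse[OF assms(3)]
    by (simp add: group.inv_equality)
qed

lemma path_functor_compose:
  assumes w: "path_functor Y Q w" and h: "h \<in> hom Q R" and i: "continuous_map X Y i"
  shows "path_functor X R (\<lambda>p. h (w (i \<circ> p)))"
  unfolding path_functor_def
proof (intro conjI allI impI)
  have path: "pathin Y (i \<circ> p)" if "pathin X p" for p
    using that i pathin_compose by blast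
  show "h (w (i \<circ> p)) \<in> carrier R" if "pathin X p" for p
    using path_functorD(1)[OF w path[OF that]] h by (auto simp: hom_def)
  show "h (w (i \<circ> p)) = h (w (i \<circ> q))" if "path_homotopic X p q" for p q
    using path_functorD(2)[OF w path_homotopic_compose[OF that i]] by simp
  show "h (w (i \<circ> path_join p q)) = h (w (i \<circ> p)) \<otimes>\<^bsub>R\<^esub> h (w (i \<circ> q))"
    if "pathin X p" "pathin X q" "p 1 = q 0" for p q
    using path_functorD[OF w] path that h by (auto simp: path_join_compose hom_mult)
qed

lemma path_functor_hom:
  "path_functor X Q w \<Longrightarrow> h \<in> hom Q R \<Longrightarrow> path_functor X R (\<lambda>p. h (w p))"
  using path_functor_compose[of X Q w h R X id] by simp

lemma path_functor_map:
  assumes "path_functor Y Q w" "continuous_map X Y i"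
  shows "path_functor X Q (\<lambda>p. w (i \<circ> p))"
proof -
  have "(\<lambda>x. x) \<in> hom Q Q" by (simp add: hom_def)
  from path_functor_compose[OF assms(1) this assms(2)] show ?thesis .
qed

text \<open>The closing-up formula of \<open>edge_class\<close> for an arbitrary path. The chosen
  path at \<open>x0\<close> need not be constant, so on a loop this is a conjugate of its
  \<open>loop_class\<close>, not that class itself.\<close>

definition path_class :: "'a topology \<Rightarrow> 'a \<Rightarrow> (real \<Rightarrow> 'a) \<Rightarrow> (real \<Rightarrow> 'a) set" where
  "path_class X x0 p = loop_class X x0
     (path_join (path_join (base_path X x0 (p 0)) p) (path_reverse (base_path X x0 (p 1))))"

lemma base_path:
  assumes "path_connected_space X" "x0 \<in> topspace X" "x \<in> topspace X"
  shows "pathin X (base_path X x0 x)" "base_path X x0 x 0 = x0" "base_path X x0 x 1 = x"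
proof -
  have "\<exists>p. pathin X p \<and> p 0 = x0 \<and> p 1 = x"
    using assms by (simp add: path_connected_space_def)
  from someI_ex[OF this] show "pathin X (base_path X x0 x)" "base_path X x0 x 0 = x0" "base_path X x0 x 1 = x"
    by (auto simp: base_path_def)
qed

text \<open>When two closed-up paths are multiplied, the way back to \<open>x0\<close> from their
  common point is followed by the same way out, and the two cancel.\<close>

lemma path_functor_path_class:
  assumes X: "path_connected_space X" "x0 \<in> topspace X"
  shows "path_functor X (fundamental_group X x0) (path_class X x0)"
  unfolding path_functor_def
proof (intro conjI allI impI)
  note bp = base_path[OF X]
  have loop: "pathin X (path_join (path_join (base_path X x0 (p 0)) p) (path_reverse (base_path X x0 (p 1))))"
    if "pathin X p" for p
    using that bp path_start_in_topspace[OF that] path_finish_in_topspace[OF that]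
    by (intro pathin_join pathin_reverse) auto
  have ends: "base_path X x0 (p 0) 0 = x0" "base_path X x0 (p 1) 0 = x0" if "pathin X p" for p
    using bp path_start_in_topspace[OF that] path_finish_in_topspace[OF that] by auto
  show "path_class X x0 p \<in> carrier (fundamental_group X x0)" if "pathin X p" for p
    unfolding path_class_def using loop[OF that] ends[OF that] by auto
  show "path_class X x0 p = path_class X x0 q" if h: "path_homotopic X p q" for p q
  proof -
    have p: "pathin X p" and q: "q 0 = p 0" "q 1 = p 1"
      using path_homotopic_imp_pathin[OF h] path_homotopic_ends[OF h] by auto
    show ?thesis
      unfolding path_class_def q
      using h bp path_start_in_topspace[OF p] path_finish_in_topspace[OF p]
      by (intro loop_class_cong path_homotopic_join) (auto simp: pathin_reverse)
  qed
  show "path_class X x0 (path_join p q) = path_class X x0 p \<otimes>\<^bsub>fundamental_group X x0\<^esub> path_class X x0 q"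
    if p: "pathin X p" and q: "pathin X q" and pq: "p 1 = q 0" for p q
  proof -
    note tp = path_start_in_topspace[OF p] path_finish_in_topspace[OF p] path_finish_in_topspace[OF q]
    let ?a = "base_path X x0 (p 0)" and ?b = "base_path X x0 (p 1)" and ?c = "base_path X x0 (q 1)"
    have a: "pathin X ?a" "?a 0 = x0" "?a 1 = p 0" and b: "pathin X ?b" "?b 0 = x0" "?b 1 = p 1"
      and c: "pathin X ?c" "?c 0 = x0" "?c 1 = q 1" using bp tp by auto
    note [simp] = a b c p q pq pathin_join pathin_reverse
    \<comment> \<open>Brackets are moved until \<open>path_reverse ?b\<close> stands next to
      \<open>?b\<close>; the constant path that replaces the pair is then absorbed.\<close>
    have "path_homotopic X (path_join (path_join (path_join ?a p) (path_reverse ?b)) (path_join (path_join ?b q) (path_reverse ?c)))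
       (path_join (path_join (path_join (path_join ?a p) (path_reverse ?b)) (path_join ?b q)) (path_reverse ?c))"
      by (intro path_homotopic_assoc) (auto simp flip: pq)
    also have "path_homotopic X \<dots> (path_join (path_join (path_join (path_join (path_join ?a p) (path_reverse ?b)) ?b) q) (path_reverse ?c))"
      by (intro path_homotopic_join path_homotopic_assoc) (auto simp flip: pq)
    also have "path_homotopic X \<dots> (path_join (path_join (path_join (path_join ?a p) (path_join (path_reverse ?b) ?b)) q) (path_reverse ?c))"
      by (intro path_homotopic_join path_homotopic_sym[OF path_homotopic_assoc]) (auto simp flip: pq)
    also have "path_homotopic X \<dots> (path_join (path_join (path_join (path_join ?a p) (\<lambda>t. p 1)) q) (path_reverse ?c))"
      using path_homotopic_reverse_join[of X ?b]
      by (intro path_homotopic_join) (auto simp flip: pq)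
    also have "path_homotopic X \<dots> (path_join (path_join (path_join ?a p) q) (path_reverse ?c))"
      using path_homotopic_join_const[of X "path_join ?a p"]
      by (intro path_homotopic_join[OF path_homotopic_join]) (auto simp flip: pq)
    also have "path_homotopic X \<dots> (path_join (path_join ?a (path_join p q)) (path_reverse ?c))"
      by (intro path_homotopic_join path_homotopic_sym[OF path_homotopic_assoc]) (auto simp flip: pq)
    finally have h: "path_homotopic X (path_join (path_join (path_join ?a p) (path_reverse ?b)) (path_join (path_join ?b q) (path_reverse ?c)))
       (path_join (path_join ?a (path_join p q)) (path_reverse ?c))" .
    show ?thesis
      unfolding path_class_def
      by (subst mult_fundamental_group)
         (use loop[OF p] loop[OF q] loop_class_cong[OF h] in \<open>auto simp flip: pq\<close>)
  qed
qed

text \<open>Evaluation on an arbitrary representative; homotopy invariance of a functor makes the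
  choice immaterial.\<close>

definition functor_hom :: "((real \<Rightarrow> 'a) \<Rightarrow> 'q) \<Rightarrow> (real \<Rightarrow> 'a) set \<Rightarrow> 'q" where
  "functor_hom w A = w (SOME p. p \<in> A)"

lemma functor_hom_loop_class:
  assumes "path_functor X Q w" "pathin X p" "p 0 = x0" "p 1 = x0"
  shows "functor_hom w (loop_class X x0 p) = w p"
proof -
  have "(SOME q. q \<in> loop_class X x0 p) \<in> loop_class X x0 p"
    using someI[of "\<lambda>q. q \<in> loop_class X x0 p", OF loop_class_self[OF assms(2-4)]] .
  from mem_loop_class(4)[OF this assms(3,4)] show ?thesis
    using path_functorD(2)[OF assms(1)] unfolding functor_hom_def by metis
qed

lemma functor_hom_hom:
  assumes "path_functor X Q w"
  shows "functor_hom w \<in> hom (fundamental_group X x0) Q"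
proof (rule homI)
  fix A assume "A \<in> carrier (fundamental_group X x0)"
  then show "functor_hom w A \<in> carrier Q"
    by (elim fundamental_groupE) (auto simp: functor_hom_loop_class[OF assms] path_functorD(1)[OF assms])
next
  fix A B assume "A \<in> carrier (fundamental_group X x0)" "B \<in> carrier (fundamental_group X x0)"
  then show "functor_hom w (A \<otimes>\<^bsub>fundamental_group X x0\<^esub> B) = functor_hom w A \<otimes>\<^bsub>Q\<^esub> functor_hom w B"
    by (elim fundamental_groupE)
       (auto simp: mult_fundamental_group functor_hom_loop_class[OF assms] path_functorD(3)[OF assms] pathin_join)
qed

text \<open>Passing through the fundamental group changes a functor only by the frame
  \<open>w (base_path X x0 x)\<close> at the two ends, which is the kind of change that homology
  does not see.\<close>

lemma functor_hom_path_class: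
  assumes X: "path_connected_space X" "x0 \<in> topspace X" and w: "path_functor X Q w" and Q: "group Q"
    and p: "pathin X p"
  shows "functor_hom w (path_class X x0 p) =
    w (base_path X x0 (p 0)) \<otimes>\<^bsub>Q\<^esub> w p \<otimes>\<^bsub>Q\<^esub> inv\<^bsub>Q\<^esub> w (base_path X x0 (p 1))"
proof -
  note a = base_path[OF X path_start_in_topspace[OF p]] and b = base_path[OF X path_finish_in_topspace[OF p]]
  show ?thesis
    unfolding path_class_def
    by (subst functor_hom_loop_class[OF w])
       (use a b p in \<open>auto simp: pathin_join pathin_reverse path_functorD(3)[OF w] path_functor_reverse[OF w Q]\<close>)
qed

section \<open>Group homology\<close>

lemma bar_chain_group_simps [simp]:
  "c \<in> carrier (bar_chain_group n G) \<longleftrightarrow> Poly_Mapping.keys c \<subseteq> {xs. length xs = n \<and> set xs \<subseteq> carrier G}"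
  "a \<otimes>\<^bsub>bar_chain_group n G\<^esub> b = a + b"
  "\<one>\<^bsub>bar_chain_group n G\<^esub> = 0"
  by (simp_all add: bar_chain_group_def)

lemma group_bar_chain_group [simp]: "group (bar_chain_group n G)"
  by (simp add: bar_chain_group_def)

lemma bar_boundary_simps [simp]:
  "bar_boundary G 0 = 0"
  "bar_boundary G (a + b) = bar_boundary G a + bar_boundary G b"
  "bar_boundary G (a - b) = bar_boundary G a - bar_boundary G b"
  "bar_boundary G (- a) = - bar_boundary G a"
  "bar_boundary G (frag_cmul k a) = frag_cmul k (bar_boundary G a)"
  by (simp_all add: bar_boundary_def frag_extend_add frag_extend_diff frag_extend_minus frag_extend_cmul)

lemma bar_boundary_of:
  "xs \<noteq> [] \<Longrightarrow> bar_boundary G (frag_of xs) =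
     (\<Sum>i\<le>length xs. frag_cmul ((- 1) ^ i) (frag_of (bar_face G i xs)))"
  by (simp add: bar_boundary_def)

lemma keys_diff_subset:
  assumes "Poly_Mapping.keys a \<subseteq> S" "Poly_Mapping.keys b \<subseteq> S"
  shows "Poly_Mapping.keys (a - b) \<subseteq> S" "Poly_Mapping.keys (a + b) \<subseteq> S"
  using assms keys_diff[of a b] keys_add[of a b] by auto

lemma bar_boundaries_diff:
  assumes "a \<in> bar_boundaries n G" "b \<in> bar_boundaries n G"
  shows "a - b \<in> bar_boundaries n G"
proof -
  obtain d e where d: "d \<in> carrier (bar_chain_group (Suc n) G)" "a = bar_boundary G d"
    and e: "e \<in> carrier (bar_chain_group (Suc n) G)" "b = bar_boundary G e"
    using assms by (auto simp: bar_boundaries_def)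
  then have "a - b = bar_boundary G (d - e)" "d - e \<in> carrier (bar_chain_group (Suc n) G)"
    by (simp_all add: keys_diff_subset)
  then show ?thesis unfolding bar_boundaries_def by blast
qed

lemma bar_boundaries_0: "0 \<in> bar_boundaries n G"
  unfolding bar_boundaries_def by (rule image_eqI[of _ _ 0]) auto

lemma bar_boundaries_add:
  assumes "a \<in> bar_boundaries n G" "b \<in> bar_boundaries n G"
  shows "a + b \<in> bar_boundaries n G"
  using bar_boundaries_diff[OF assms(1) bar_boundaries_diff[OF bar_boundaries_0 assms(2)]] by simp

lemma bar_cycles_diff:
  "a \<in> bar_cycles n G \<Longrightarrow> b \<in> bar_cycles n G \<Longrightarrow> a - b \<in> bar_cycles n G"
  by (simp add: bar_cycles_def keys_diff_subset)

lemma bar_cycles_0: "0 \<in> bar_cycles n G"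
  by (auto simp: bar_cycles_def)

definition bar_class :: "nat \<Rightarrow> ('a, 'b) monoid_scheme \<Rightarrow> ('a list \<Rightarrow>\<^sub>0 int) \<Rightarrow> ('a list \<Rightarrow>\<^sub>0 int) set" where
  "bar_class n G c = bar_boundaries n G #>\<^bsub>bar_chain_group n G\<^esub> c"

lemma mem_bar_class: "c' \<in> bar_class n G c \<longleftrightarrow> c' - c \<in> bar_boundaries n G"
  by (force simp: bar_class_def r_coset_def)

lemma bar_class_eq_iff: "bar_class n G c = bar_class n G c' \<longleftrightarrow> c - c' \<in> bar_boundaries n G"
proof
  assume "bar_class n G c = bar_class n G c'"
  then show "c - c' \<in> bar_boundaries n G"
    using mem_bar_class[of c n G c] mem_bar_class[of c n G c'] by (simp add: bar_boundaries_0)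
next
  assume h: "c - c' \<in> bar_boundaries n G"
  have "d - c \<in> bar_boundaries n G \<longleftrightarrow> d - c' \<in> bar_boundaries n G" for d
    using bar_boundaries_add[OF h, of "d - c"] bar_boundaries_diff[OF _ h, of "d - c'"] by auto
  then show "bar_class n G c = bar_class n G c'" by (auto simp: mem_bar_class)
qed

text \<open>\<open>subgroup_generated\<close> adds nothing here: the cycles are already a subgroup
  of the chains, so the classes are exactly the cosets of cycles.\<close>

lemma carrier_group_homology: "carrier (group_homology n G) = bar_class n G ` bar_cycles n G"
proof -
  have "subgroup (bar_cycles n G) (bar_chain_group n G)"
  proof (rule group.subgroupI)
    show "bar_cycles n G \<noteq> {}" using bar_cycles_0 by blast
  next
    fix a assume a: "a \<in> bar_cycles n G"
    then have "inv\<^bsub>bar_chain_group n G\<^esub> a = 0 - a"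
      by (simp add: bar_chain_group_def bar_cycles_def)
    then show "inv\<^bsub>bar_chain_group n G\<^esub> a \<in> bar_cycles n G"
      using bar_cycles_diff[OF bar_cycles_0 a] by simp
  next
    fix a b assume "a \<in> bar_cycles n G" "b \<in> bar_cycles n G"
    then have "a - (0 - b) \<in> bar_cycles n G" by (intro bar_cycles_diff bar_cycles_0)
    then show "a \<otimes>\<^bsub>bar_chain_group n G\<^esub> b \<in> bar_cycles n G" by simp
  qed (auto simp: bar_cycles_def)
  then have "carrier (subgroup_generated (bar_chain_group n G) (bar_cycles n G)) = bar_cycles n G"
    by (rule subgroup.carrier_subgroup_generated_subgroup)
  then show ?thesis
    by (auto simp: group_homology_def FactGroup_def RCOSETS_def bar_class_def r_coset_def)
qed

lemma mult_group_homology: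
  "bar_class n G a \<otimes>\<^bsub>group_homology n G\<^esub> bar_class n G b = bar_class n G (a + b)"
proof -
  have "bar_class n G a \<otimes>\<^bsub>group_homology n G\<^esub> bar_class n G b =
      (\<Union>c\<in>bar_class n G a. \<Union>d\<in>bar_class n G b. {c + d})"
    by (simp add: group_homology_def FactGroup_def set_mult_def)
  also have "\<dots> = bar_class n G (a + b)"
  proof (intro equalityI subsetI)
    fix x assume "x \<in> (\<Union>c\<in>bar_class n G a. \<Union>d\<in>bar_class n G b. {c + d})"
    then obtain c d where "c - a \<in> bar_boundaries n G" "d - b \<in> bar_boundaries n G" "x = c + d"
      by (auto simp: mem_bar_class)
    then show "x \<in> bar_class n G (a + b)"
      using bar_boundaries_add[of "c - a" n G "d - b"] by (simp add: mem_bar_class algebra_simps)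
  next
    fix x assume "x \<in> bar_class n G (a + b)"
    then have "x - b \<in> bar_class n G a" "b \<in> bar_class n G b" "x = (x - b) + b"
      by (simp_all add: mem_bar_class algebra_simps bar_boundaries_0)
    then show "x \<in> (\<Union>c\<in>bar_class n G a. \<Union>d\<in>bar_class n G b. {c + d})" by blast
  qed
  finally show ?thesis .
qed

definition bar_map :: "('a \<Rightarrow> 'b) \<Rightarrow> ('a list \<Rightarrow>\<^sub>0 int) \<Rightarrow> 'b list \<Rightarrow>\<^sub>0 int" where
  "bar_map h = frag_extend (frag_of \<circ> map h)"

lemma bar_map_simps [simp]:
  "bar_map h 0 = 0"
  "bar_map h (frag_of xs) = frag_of (map h xs)"
  "bar_map h (a + b) = bar_map h a + bar_map h b"
  "bar_map h (a - b) = bar_map h a - bar_map h b"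
  "bar_map h (frag_cmul k a) = frag_cmul k (bar_map h a)"
  by (simp_all add: bar_map_def frag_extend_add frag_extend_diff frag_extend_cmul)

lemma bar_map_sum: "finite I \<Longrightarrow> bar_map h (\<Sum>i\<in>I. f i) = (\<Sum>i\<in>I. bar_map h (f i))"
  by (simp add: bar_map_def frag_extend_sum o_def)

lemma bar_map_carrier:
  assumes "h ` carrier G \<subseteq> carrier K" "c \<in> carrier (bar_chain_group n G)"
  shows "bar_map h c \<in> carrier (bar_chain_group n K)"
  using keys_frag_extend[of "frag_of \<circ> map h" c] assms by (fastforce simp: bar_map_def)

lemma bar_face_map:
  assumes h: "h \<in> hom G K" and xs: "set xs \<subseteq> carrier G" and i: "i \<le> length xs"
  shows "bar_face K i (map h xs) = map h (bar_face G i xs)"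
proof -
  consider "i = 0" | "i = length xs" "i \<noteq> 0" | "0 < i" "i < length xs" using i by linarith
  then show ?thesis
  proof cases
    case 3
    then have "xs ! (i - 1) \<in> carrier G" "xs ! i \<in> carrier G"
      using xs by (auto simp: subset_iff)
    then show ?thesis
      using 3 h by (simp add: bar_face_def hom_mult take_map drop_map)
  qed (auto simp: bar_face_def map_tl map_butlast)
qed

lemma bar_map_boundary:
  assumes h: "h \<in> hom G K" and c: "c \<in> carrier (bar_chain_group n G)"
  shows "bar_boundary K (bar_map h c) = bar_map h (bar_boundary G c)"
proof -
  have "Poly_Mapping.keys c \<subseteq> {xs. length xs = n \<and> set xs \<subseteq> carrier G}" using c by simp
  then show ?thesis
  proof (induction rule: frag_induction)
    case (one xs)
    then show ?case
      by (cases "xs = []")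
         (simp_all add: bar_boundary_of bar_map_sum bar_face_map[OF h] bar_boundary_def)
  qed simp_all
qed

lemma bar_map_boundaries:
  assumes "h \<in> hom G K" "b \<in> bar_boundaries n G"
  shows "bar_map h b \<in> bar_boundaries n K"
proof -
  obtain d where d: "d \<in> carrier (bar_chain_group (Suc n) G)" "b = bar_boundary G d"
    using assms(2) by (auto simp: bar_boundaries_def)
  then have "bar_map h b = bar_boundary K (bar_map h d)"
    by (simp only: bar_map_boundary[OF assms(1) d(1)])
  moreover have "bar_map h d \<in> carrier (bar_chain_group (Suc n) K)"
    using assms(1) d(1) by (intro bar_map_carrier) (auto simp: hom_def)
  ultimately show ?thesis unfolding bar_boundaries_def by blast
qed

lemma bar_map_cycles:
  assumes h: "h \<in> hom G K" and c: "c \<in> bar_cycles n G"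
  shows "bar_map h c \<in> bar_cycles n K"
proof -
  have "c \<in> carrier (bar_chain_group n G)" using c by (simp add: bar_cycles_def)
  with h have "bar_map h c \<in> carrier (bar_chain_group n K)"
    "bar_boundary K (bar_map h c) = bar_map h (bar_boundary G c)"
    by (intro bar_map_carrier bar_map_boundary; auto simp: hom_def)+
  then show ?thesis using c by (simp add: bar_cycles_def)
qed

lemma group_homology_map_bar_class:
  assumes "h \<in> hom G K"
  shows "group_homology_map n K h (bar_class n G c) = bar_class n K (bar_map h c)"
proof -
  have "bar_class n K (bar_map h d) = bar_class n K (bar_map h c)" if "d \<in> bar_class n G c" for d
    using bar_map_boundaries[OF assms, of "d - c"] that by (simp add: mem_bar_class bar_class_eq_iff)
  moreover have "c \<in> bar_class n G c" by (simp add: mem_bar_class bar_boundaries_0)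
  ultimately have "(\<Union>d\<in>bar_class n G c. bar_class n K (bar_map h d)) = bar_class n K (bar_map h c)"
    by (intro SUP_eq_const) blast+
  then show ?thesis by (simp add: group_homology_map_def bar_class_def bar_map_def)
qed

lemma group_homology_map_hom:
  assumes "h \<in> hom G K"
  shows "group_homology_map n K h \<in> hom (group_homology n G) (group_homology n K)"
  by (rule homI)
     (auto simp: carrier_group_homology group_homology_map_bar_class[OF assms] mult_group_homology
       intro: bar_map_cycles[OF assms])

lemma bar_map_compose: "bar_map g (bar_map h c) = bar_map (g \<circ> h) c"
  unfolding bar_map_def frag_extend_compose by (simp add: o_def)

lemma bar_map_cong:
  assumes "\<And>x. x \<in> carrier G \<Longrightarrow> g x = h x" "c \<in> carrier (bar_chain_group n G)"
  shows "bar_map g c = bar_map h c"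
  unfolding bar_map_def
proof (rule frag_extend_eq)
  fix xs assume "xs \<in> Poly_Mapping.keys c"
  then have "set xs \<subseteq> carrier G" using assms(2) by auto
  then have "map g xs = map h xs" using assms(1) by auto
  then show "(frag_of \<circ> map g) xs = (frag_of \<circ> map h) xs" by (simp only: o_apply)
qed

lemma group_homology_map_compose:
  assumes "h \<in> hom G K" "g \<in> hom K L" "x \<in> carrier (group_homology n G)"
  shows "group_homology_map n L g (group_homology_map n K h x) = group_homology_map n L (g \<circ> h) x"
  using assms
  by (auto simp: carrier_group_homology group_homology_map_bar_class hom_compose bar_map_compose)

lemma group_homology_map_cong:
  assumes "h \<in> hom G K" "g \<in> hom G K" "\<And>x. x \<in> carrier G \<Longrightarrow> h x = g x" "x \<in> carrier (group_homology n G)"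
  shows "group_homology_map n K h x = group_homology_map n K g x"
  using assms bar_map_cong[of G h g _ n]
  by (auto simp: carrier_group_homology group_homology_map_bar_class bar_cycles_def)

lemma group_homology_map_id:
  assumes "h \<in> hom G G" "\<And>x. x \<in> carrier G \<Longrightarrow> h x = x" "x \<in> carrier (group_homology n G)"
  shows "group_homology_map n G h x = x"
proof -
  have "bar_map (\<lambda>x. x) c = c" for c :: "'a list \<Rightarrow>\<^sub>0 int"
    unfolding bar_map_def by (simp add: o_def flip: frag_expansion)
  moreover have "(\<lambda>x. x) \<in> hom G G" by (simp add: hom_def)
  ultimately have "group_homology_map n G (\<lambda>x. x) x = x"
    using assms(3) by (auto simp: carrier_group_homology group_homology_map_bar_class)
  then show ?thesis
    using group_homology_map_cong[OF assms(1) \<open>(\<lambda>x. x) \<in> hom G G\<close> assms(2,3)] by simp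
qed

section \<open>From singular chains to bar chains\<close>

text \<open>Joins two arbitrary vertices; \<open>simplex_edge\<close> covers consecutive ones only,
  but a face that omits a vertex has an edge skipping it.\<close>

definition edge_path :: "nat \<Rightarrow> nat \<Rightarrow> real \<Rightarrow> nat \<Rightarrow> real" where
  "edge_path i k t = (\<lambda>j. if j = i then 1 - t else if j = k then t else 0)"

abbreviation simplex_space :: "nat \<Rightarrow> (nat \<Rightarrow> real) topology" where
  "simplex_space n \<equiv> subtopology (powertop_real UNIV) (standard_simplex n)"

lemma simplex_edge_eq: "simplex_edge \<sigma> i = \<sigma> \<circ> edge_path i (Suc i)"
  by (simp add: simplex_edge_def edge_path_def fun_eq_iff)

lemma edge_path_in_simplex:
  assumes "i \<le> n" "k \<le> n" "i \<noteq> k" "t \<in> {0..1}"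
  shows "edge_path i k t \<in> standard_simplex n"
proof -
  have "(\<Sum>j\<le>n. edge_path i k t j) = (\<Sum>j\<in>{i,k}. edge_path i k t j)"
    using assms by (intro sum.mono_neutral_right) (auto simp: edge_path_def)
  also have "\<dots> = 1" using assms by (simp add: edge_path_def)
  finally show ?thesis using assms by (auto simp: standard_simplex_def edge_path_def)
qed

lemma pathin_edge_path:
  assumes "i \<le> n" "k \<le> n" "i \<noteq> k"
  shows "pathin (simplex_space n) (edge_path i k)"
proof -
  have "continuous_map (top_of_set {0..1}) euclideanreal (\<lambda>t. edge_path i k t j)" for j
    unfolding edge_path_def by (cases "j = i"; cases "j = k") (auto intro!: continuous_intros)
  then have "continuous_map (top_of_set {0..1}) (powertop_real UNIV) (edge_path i k)"
    by (subst continuous_map_componentwise_UNIV) auto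
  then show ?thesis
    using edge_path_in_simplex[OF assms] by (auto simp: pathin_def continuous_map_in_subtopology)
qed

lemma edge_path_ends [simp]:
  "edge_path i k 0 = (\<lambda>j. if j = i then 1 else 0)"
  "i \<noteq> k \<Longrightarrow> edge_path i k 1 = (\<lambda>j. if j = k then 1 else 0)"
  by (auto simp: edge_path_def fun_eq_iff)

text \<open>Convexity of the simplex. This is where the product in the inner faces of the bar
  complex comes from.\<close>

lemma path_homotopic_edge_join:
  assumes "i \<le> n" "k \<le> n" "l \<le> n" "i \<noteq> k" "k \<noteq> l" "i \<noteq> l"
  shows "path_homotopic (simplex_space n) (edge_path i l) (path_join (edge_path i k) (edge_path k l))"
proof (rule path_homotopic_pointwise_convex)
  show "pathin (simplex_space n) (path_join (edge_path i k) (edge_path k l))"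
    using assms by (intro pathin_join pathin_edge_path) auto
qed (use assms in \<open>auto intro: convex_standard_simplex pathin_edge_path\<close>)

lemma pathin_simplex_edge:
  assumes "singular_simplex n X \<sigma>" "i < n"
  shows "pathin X (simplex_edge \<sigma> i)"
  unfolding simplex_edge_eq
  by (rule pathin_compose[OF pathin_edge_path[of _ n]]) (use assms in \<open>auto simp: singular_simplex_def\<close>)

lemma simplical_face_edge_path:
  "i \<noteq> l \<Longrightarrow> simplical_face k (edge_path i l t) =
     edge_path (if i < k then i else Suc i) (if l < k then l else Suc l) t"
  by (auto simp: simplical_face_def edge_path_def fun_eq_iff)

lemma simplex_edge_face:
  assumes "i < n" "t \<in> {0..1}"
  shows "simplex_edge (singular_face (Suc n) k \<sigma>) i t =
    (\<sigma> \<circ> edge_path (if i < k then i else Suc i) (if Suc i < k then Suc i else Suc (Suc i))) t"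
  using assms edge_path_in_simplex[of i n "Suc i" t]
  by (simp add: simplex_edge_eq singular_face_def simplical_face_edge_path)

definition edge_chain :: "((real \<Rightarrow> 'a) \<Rightarrow> 'q) \<Rightarrow> nat \<Rightarrow> 'a chain \<Rightarrow> 'q list \<Rightarrow>\<^sub>0 int" where
  "edge_chain w n = frag_extend (\<lambda>\<sigma>. frag_of (map (\<lambda>i. w (simplex_edge \<sigma> i)) [0..<n]))"

lemma edge_chain_simps [simp]:
  "edge_chain w n 0 = 0"
  "edge_chain w n (frag_of \<sigma>) = frag_of (map (\<lambda>i. w (simplex_edge \<sigma> i)) [0..<n])"
  "edge_chain w n (a + b) = edge_chain w n a + edge_chain w n b"
  "edge_chain w n (a - b) = edge_chain w n a - edge_chain w n b"
  "edge_chain w n (frag_cmul k a) = frag_cmul k (edge_chain w n a)"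
  by (simp_all add: edge_chain_def frag_extend_add frag_extend_diff frag_extend_cmul)

lemma edge_chain_sum: "finite I \<Longrightarrow> edge_chain w n (\<Sum>i\<in>I. f i) = (\<Sum>i\<in>I. edge_chain w n (f i))"
  by (simp add: edge_chain_def frag_extend_sum o_def)

lemma edge_chain_cong:
  assumes "\<And>p. pathin X p \<Longrightarrow> w p = w' p" "singular_chain n X c"
  shows "edge_chain w n c = edge_chain w' n c"
  unfolding edge_chain_def
proof (rule frag_extend_eq)
  fix \<sigma> assume "\<sigma> \<in> Poly_Mapping.keys c"
  then have "singular_simplex n X \<sigma>" using assms(2) by (auto simp: singular_chain_def)
  then have "map (\<lambda>i. w (simplex_edge \<sigma> i)) [0..<n] = map (\<lambda>i. w' (simplex_edge \<sigma> i)) [0..<n]"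
    using assms(1)[OF pathin_simplex_edge] by simp
  then show "frag_of (map (\<lambda>i. w (simplex_edge \<sigma> i)) [0..<n]) = frag_of (map (\<lambda>i. w' (simplex_edge \<sigma> i)) [0..<n])"
    by (simp only:)
qed

lemma bar_map_edge_chain: "bar_map h (edge_chain w n c) = edge_chain (\<lambda>p. h (w p)) n c"
  unfolding bar_map_def edge_chain_def
  using frag_extend_compose[of "frag_of \<circ> map h" "\<lambda>\<sigma>. map (\<lambda>i. w (simplex_edge \<sigma> i)) [0..<n]" c]
  by (simp add: o_def)

lemma edge_chain_carrier:
  assumes w: "path_functor X Q w" and c: "singular_chain n X c"
  shows "edge_chain w n c \<in> carrier (bar_chain_group n Q)"
proof -
  have "Poly_Mapping.keys (frag_of (map (\<lambda>i. w (simplex_edge \<sigma> i)) [0..<n])) \<subseteq> {xs. length xs = n \<and> set xs \<subseteq> carrier Q}"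
    if "\<sigma> \<in> Poly_Mapping.keys c" for \<sigma>
    using that c path_functorD(1)[OF w pathin_simplex_edge] by (auto simp: singular_chain_def)
  then show ?thesis
    using keys_frag_extend[of "\<lambda>\<sigma>. frag_of (map (\<lambda>i. w (simplex_edge \<sigma> i)) [0..<n])" c]
    unfolding edge_chain_def bar_chain_group_simps by blast
qed

text \<open>Outer faces delete the first or last edge. Face \<open>k\<close> in between omits vertex
  \<open>k\<close>, so edges \<open>k - 1\<close> and \<open>k\<close> are replaced by one,
  homotopic to their join across a triangle of the simplex.\<close>

lemma edge_list_face:
  assumes w: "path_functor X Q w" and \<sigma>: "singular_simplex (Suc n) X \<sigma>" and k: "k \<le> Suc n"
  shows "map (\<lambda>i. w (simplex_edge (singular_face (Suc n) k \<sigma>) i)) [0..<n] =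
    bar_face Q k (map (\<lambda>i. w (simplex_edge \<sigma> i)) [0..<Suc n])"
proof -
  have cont: "continuous_map (simplex_space (Suc n)) X \<sigma>"
    using \<sigma> by (simp add: singular_simplex_def)
  have face: "singular_simplex n X (singular_face (Suc n) k \<sigma>)"
    using singular_simplex_singular_face[OF \<sigma> _ k] by simp
  \<comment> \<open>Faces are restricted to the simplex, so the two paths agree only on [0, 1];
    hence the detour through \<open>path_homotopic_eq\<close>.\<close>
  have *: "w (simplex_edge (singular_face (Suc n) k \<sigma>) i) =
     w (\<sigma> \<circ> edge_path (if i < k then i else Suc i) (if Suc i < k then Suc i else Suc (Suc i)))" if "i < n" for i
    by (rule path_functorD(2)[OF w path_homotopic_eq[OF pathin_simplex_edge[OF face that]]])
       (use simplex_edge_face[OF that] in blast)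
  have merge: "w (\<sigma> \<circ> edge_path i (Suc (Suc i))) = w (simplex_edge \<sigma> i) \<otimes>\<^bsub>Q\<^esub> w (simplex_edge \<sigma> (Suc i))"
    if "i < n" for i
  proof -
    have "path_homotopic X (\<sigma> \<circ> edge_path i (Suc (Suc i)))
        (\<sigma> \<circ> path_join (edge_path i (Suc i)) (edge_path (Suc i) (Suc (Suc i))))"
      using that by (intro path_homotopic_compose[OF path_homotopic_edge_join cont]) auto
    then have "w (\<sigma> \<circ> edge_path i (Suc (Suc i))) =
        w (path_join (simplex_edge \<sigma> i) (simplex_edge \<sigma> (Suc i)))"
      using path_functorD(2)[OF w] by (simp add: path_join_compose simplex_edge_eq)
    also have "\<dots> = w (simplex_edge \<sigma> i) \<otimes>\<^bsub>Q\<^esub> w (simplex_edge \<sigma> (Suc i))"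
      using that pathin_simplex_edge[OF \<sigma>]
      by (intro path_functorD(3)[OF w]) (auto simp: simplex_edge_eq)
    finally show ?thesis .
  qed
  show ?thesis
  proof (rule nth_equalityI)
    fix i assume "i < length (map (\<lambda>i. w (simplex_edge (singular_face (Suc n) k \<sigma>) i)) [0..<n])"
    then have i: "i < n" by simp
    consider "k = 0" | "k = Suc n" | "0 < k" "k \<le> n" using k by linarith
    then show "map (\<lambda>i. w (simplex_edge (singular_face (Suc n) k \<sigma>) i)) [0..<n] ! i =
       bar_face Q k (map (\<lambda>i. w (simplex_edge \<sigma> i)) [0..<Suc n]) ! i"
    proof cases
      case 1
      then show ?thesis using i *[OF i] by (simp add: bar_face_def nth_tl simplex_edge_eq del: upt_Suc)
    next
      case 2
      then show ?thesis using i *[OF i] by (simp add: bar_face_def nth_butlast simplex_edge_eq del: upt_Suc)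
    next
      case 3
      consider "Suc i < k" | "Suc i = k" | "k \<le> i" by linarith
      then show ?thesis
        using 3 i merge[OF i] *[OF i]
        by cases (auto simp: bar_face_def nth_append simplex_edge_eq simp del: upt_Suc)
    qed
  qed (use k in \<open>auto simp: bar_face_def simp del: upt_Suc\<close>)
qed

lemma edge_chain_boundary:
  assumes w: "path_functor X Q w" and c: "singular_chain (Suc n) X c"
  shows "bar_boundary Q (edge_chain w (Suc n) c) = edge_chain w n (chain_boundary (Suc n) c)"
  using c unfolding singular_chain_def
proof (induction rule: frag_induction)
  case (one \<sigma>)
  then have \<sigma>: "singular_simplex (Suc n) X \<sigma>" by simp
  have "bar_boundary Q (edge_chain w (Suc n) (frag_of \<sigma>)) =
     (\<Sum>k\<le>Suc n. frag_cmul ((- 1) ^ k) (frag_of (bar_face Q k (map (\<lambda>i. w (simplex_edge \<sigma> i)) [0..<Suc n]))))"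
    unfolding edge_chain_simps by (subst bar_boundary_of) (auto simp del: upt_Suc)
  also have "\<dots> = (\<Sum>k\<le>Suc n. frag_cmul ((- 1) ^ k) (frag_of (map (\<lambda>i. w (simplex_edge (singular_face (Suc n) k \<sigma>) i)) [0..<n])))"
    using edge_list_face[OF w \<sigma>] by (intro sum.cong) auto
  also have "\<dots> = edge_chain w n (chain_boundary (Suc n) (frag_of \<sigma>))"
    by (simp add: chain_boundary_of edge_chain_sum del: sum.atMost_Suc)
  finally show ?case .
qed (simp_all add: chain_boundary_diff)

lemma edge_chain_map:
  assumes w: "path_functor Y Q w" and g: "continuous_map X Y g" and c: "singular_chain n X c"
  shows "edge_chain w n (chain_map n g c) = edge_chain (\<lambda>p. w (g \<circ> p)) n c"
  using c unfolding singular_chain_def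
proof (induction rule: frag_induction)
  case (one \<sigma>)
  then have \<sigma>: "singular_simplex n X \<sigma>" by simp
  have "w (simplex_edge (simplex_map n g \<sigma>) i) = w (g \<circ> simplex_edge \<sigma> i)" if "i < n" for i
  proof (rule path_functorD(2)[OF w path_homotopic_eq])
    show "pathin Y (simplex_edge (simplex_map n g \<sigma>) i)"
      using pathin_simplex_edge[OF singular_simplex_simplex_map[OF \<sigma> g] that] .
    show "simplex_edge (simplex_map n g \<sigma>) i t = (g \<circ> simplex_edge \<sigma> i) t" if "t \<in> {0..1}" for t
      using edge_path_in_simplex[of i n "Suc i" t] that \<open>i < n\<close> by (simp add: simplex_edge_eq simplex_map_def)
  qed
  then have "map (\<lambda>i. w (simplex_edge (simplex_map n g \<sigma>) i)) [0..<n] = map (\<lambda>i. w (g \<circ> simplex_edge \<sigma> i)) [0..<n]"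
    by simp
  then show ?case by (simp only: edge_chain_simps chain_map_of)
qed (simp_all add: chain_map_diff)

lemma edge_chain_cycle:
  assumes w: "path_functor X Q w" and c: "singular_relcycle n X {} c"
  shows "edge_chain w n c \<in> bar_cycles n Q"
proof -
  have c': "singular_chain n X c" "chain_boundary n c = 0" using c by (auto simp: singular_cycle)
  have "bar_boundary Q (edge_chain w n c) = 0"
  proof (cases n)
    case 0
    \<comment> \<open>A 0-simplex contributes no edges, so every generator goes to
      \<open>[]\<close>, on which \<open>bar_boundary\<close> is 0 by definition.\<close>
    have "Poly_Mapping.keys c \<subseteq> UNIV" by simp
    then show ?thesis unfolding 0
    proof (induction rule: frag_induction)
      case (one \<sigma>)
      then show ?case by (simp add: bar_boundary_def)
    qed simp_all
  next
    case (Suc m)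
    then show ?thesis using edge_chain_boundary[OF w, of m c] c' by simp
  qed
  then show ?thesis using edge_chain_carrier[OF w c'(1)] by (simp add: bar_cycles_def)
qed

lemma bar_class_edge_chain_eq:
  assumes w: "path_functor X Q w" and "homologous_rel n X {} c c'"
  shows "bar_class n Q (edge_chain w n c) = bar_class n Q (edge_chain w n c')"
proof -
  obtain d where d: "singular_chain (Suc n) X d" "chain_boundary (Suc n) d = c - c'"
    using assms(2) by (auto simp: homologous_rel_def singular_boundary)
  have "edge_chain w n c - edge_chain w n c' = bar_boundary Q (edge_chain w (Suc n) d)"
    using edge_chain_boundary[OF w d(1)] d(2) by simp
  then show ?thesis
    using edge_chain_carrier[OF w d(1)] unfolding bar_class_eq_iff bar_boundaries_def by blast
qed

text \<open>The two functors are the restrictions of one functor on \<open>X \<times> [0, 1]\<close> to the two ends.\<close>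

lemma bar_class_edge_chain_cohomologous:
  fixes Q (structure)
  assumes w: "path_functor X Q w" and Q: "group Q"
    and d: "\<And>x. x \<in> topspace X \<Longrightarrow> d x \<in> carrier Q"
    and w': "\<And>p. pathin X p \<Longrightarrow> w' p = inv\<^bsub>Q\<^esub> d (p 0) \<otimes>\<^bsub>Q\<^esub> w p \<otimes>\<^bsub>Q\<^esub> d (p 1)"
    and c: "singular_relcycle n X {} c"
  shows "bar_class n Q (edge_chain w n c) = bar_class n Q (edge_chain w' n c)"
proof -
  interpret group Q by (rule Q)
  define Z where "Z = prod_topology X (top_of_set {0..1::real})"
  \<comment> \<open>Only the values at the ends of a path enter \<open>W\<close>, so this frame on
    the cylinder may be discontinuous: trivial on the end 0 and \<open>d\<close> everywhere
    else.\<close>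
  define D where "D z = (if snd z = (0::real) then \<one>\<^bsub>Q\<^esub> else d (fst z))" for z
  define W where "W p = inv\<^bsub>Q\<^esub> D (p 0) \<otimes>\<^bsub>Q\<^esub> w (fst \<circ> p) \<otimes>\<^bsub>Q\<^esub> D (p 1)" for p :: "real \<Rightarrow> 'a \<times> real"
  have chain: "singular_chain n X c" using c by (simp add: singular_cycle)
  have fst: "continuous_map Z X fst" unfolding Z_def by (rule continuous_map_fst)
  have D: "D z \<in> carrier Q" if "z \<in> topspace Z" for z
    using that d by (auto simp: Z_def D_def)
  have W: "path_functor Z Q W"
    unfolding path_functor_def
  proof (intro conjI allI impI)
    fix p assume p: "pathin Z p"
    then show "W p \<in> carrier Q"
      using path_functorD(1)[OF w pathin_compose[OF p fst]] D path_start_in_topspace[OF p] path_finish_in_topspace[OF p]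
      by (auto simp: W_def)
  next
    fix p q assume h: "path_homotopic Z p q"
    then show "W p = W q"
      using path_functorD(2)[OF w path_homotopic_compose[OF h fst]] path_homotopic_ends[OF h] by (simp add: W_def)
  next
    fix p q assume p: "pathin Z p" and q: "pathin Z q" and pq: "p 1 = q 0"
    have "D (p 0) \<in> carrier Q" "D (q 0) \<in> carrier Q" "D (q 1) \<in> carrier Q"
      using D path_start_in_topspace[OF p] path_finish_in_topspace[OF q] path_start_in_topspace[OF q] by auto
    moreover have "w (fst \<circ> p) \<in> carrier Q" "w (fst \<circ> q) \<in> carrier Q"
      using path_functorD(1)[OF w pathin_compose[OF p fst]] path_functorD(1)[OF w pathin_compose[OF q fst]] by auto
    moreover have "w (path_join (fst \<circ> p) (fst \<circ> q)) = w (fst \<circ> p) \<otimes> w (fst \<circ> q)"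
      by (rule path_functorD(3)[OF w pathin_compose[OF p fst] pathin_compose[OF q fst]]) (simp add: pq)
    ultimately show "W (path_join p q) = W p \<otimes> W q"
      by (simp add: W_def path_join_compose pq m_assoc) (simp add: inv_solve_left' flip: m_assoc)
  qed
  let ?g = "\<lambda>t x. (x :: 'a, t :: real)"
  have cont: "continuous_map X Z (?g t)" if "t \<in> {0..1}" for t
    unfolding Z_def using that by (auto intro!: continuous_map_pairedI)
  \<comment> \<open>The inclusions of the two ends are homotopic and send \<open>c\<close> to
    homologous cycles, to which the one functor \<open>W\<close> on the cylinder gives the same
    class.\<close>
  have "homotopic_with (\<lambda>h. h \<in> {} \<rightarrow> {}) X Z (?g 0) (?g 1)"
    unfolding homotopic_with_def
    by (rule exI[of _ "\<lambda>(t, x). (x, t)"]) (auto simp: Z_def case_prod_unfold intro!: continuous_map_pairedI continuous_map_fst continuous_map_snd)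
  from homotopic_imp_homologous_rel_chain_maps[OF this c]
  have "bar_class n Q (edge_chain W n (chain_map n (?g 0) c)) = bar_class n Q (edge_chain W n (chain_map n (?g 1) c))"
    by (rule bar_class_edge_chain_eq[OF W])
  moreover have "edge_chain W n (chain_map n (?g 0) c) = edge_chain w n c"
    unfolding edge_chain_map[OF W cont[of 0, simplified] chain]
    by (rule edge_chain_cong[OF _ chain]) (use path_functorD(1)[OF w] in \<open>auto simp: W_def D_def o_def\<close>)
  moreover have "edge_chain W n (chain_map n (?g 1) c) = edge_chain w' n c"
    unfolding edge_chain_map[OF W cont[of 1, simplified] chain]
    by (rule edge_chain_cong[OF _ chain]) (use w' in \<open>auto simp: W_def D_def o_def\<close>)
  ultimately show ?thesis by simp
qed

lemma classifying_homology_map_eq: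
  assumes X: "path_connected_space X" "x0 \<in> topspace X" and c: "singular_relcycle n X {} c"
  shows "classifying_homology_map n X x0 (homologous_rel_set n X {} c) =
    bar_class n (fundamental_group X x0) (edge_chain (path_class X x0) n c)"
proof -
  let ?Q = "fundamental_group X x0"
  have eq: "classifying_chain_map n X x0 = edge_chain (path_class X x0) n"
    by (simp add: classifying_chain_map_def edge_chain_def edge_class_def path_class_def fun_eq_iff cong: map_cong)
  have "(\<Union>d\<in>homologous_rel_set n X {} c. bar_class n ?Q (edge_chain (path_class X x0) n d)) =
      bar_class n ?Q (edge_chain (path_class X x0) n c)"
  proof (rule SUP_eq_const)
    show "homologous_rel_set n X {} c \<noteq> {}" using homologous_rel_refl by blast
    show "bar_class n ?Q (edge_chain (path_class X x0) n d) = bar_class n ?Q (edge_chain (path_class X x0) n c)"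
      if "d \<in> homologous_rel_set n X {} c" for d
      using that by (intro bar_class_edge_chain_eq[OF path_functor_path_class[OF X]]) (simp add: homologous_rel_sym)
  qed
  then show ?thesis
    by (simp add: classifying_homology_map_def Let_def eq bar_class_def)
qed

text \<open>By \<open>functor_hom_path_class\<close> the functors differ by a frame, here
  \<open>d x = inv (w (base_path X x0 x))\<close>. Thus the chosen base paths leave no trace in
  homology, and maps out of the fundamental group can be computed from \<open>w\<close> on
  edges.\<close>

lemma group_homology_map_functor_hom:
  fixes Q (structure)
  assumes X: "path_connected_space X" "x0 \<in> topspace X" and w: "path_functor X Q w" and Q: "group Q"
    and c: "singular_relcycle n X {} c"
  shows "group_homology_map n Q (functor_hom w) (classifying_homology_map n X x0 (homologous_rel_set n X {} c)) =
    bar_class n Q (edge_chain w n c)"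
proof -
  interpret group Q by (rule Q)
  have b: "w (base_path X x0 x) \<in> carrier Q" if "x \<in> topspace X" for x
    using path_functorD(1)[OF w base_path(1)[OF X that]] .
  have "bar_class n Q (edge_chain w n c) = bar_class n Q (edge_chain (\<lambda>p. functor_hom w (path_class X x0 p)) n c)"
  proof (rule bar_class_edge_chain_cohomologous[OF w Q _ _ c])
    show "inv (w (base_path X x0 x)) \<in> carrier Q" if "x \<in> topspace X" for x
      using b[OF that] by simp
    show "functor_hom w (path_class X x0 p) = inv (inv (w (base_path X x0 (p 0)))) \<otimes> w p \<otimes> inv (w (base_path X x0 (p 1)))"
      if "pathin X p" for p
      using functor_hom_path_class[OF X w Q that] b path_start_in_topspace[OF that] by simp
  qed
  then show ?thesis
    unfolding classifying_homology_map_eq[OF X c] group_homology_map_bar_class[OF functor_hom_hom[OF w]]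
    by (simp add: bar_map_edge_chain)
qed

section \<open>Low-dimensional homology of the fundamental group\<close>

lemma path_homotopic_cancel_right:
  assumes "path_homotopic X (path_join p c) (path_join q c)" "pathin X p" "pathin X q" "pathin X c"
    "p 1 = c 0" "q 1 = c 0"
  shows "path_homotopic X p q"
proof -
  have *: "path_homotopic X p (path_join (path_join p c) (path_reverse c))"
    if p: "pathin X p" "p 1 = c 0" for p
  proof -
    have "path_homotopic X p (path_join p (\<lambda>t. p 1))"
      using path_homotopic_sym[OF path_homotopic_join_const[OF p(1)]] .
    also have "path_homotopic X \<dots> (path_join p (path_join c (path_reverse c)))"
      using path_homotopic_sym[OF path_homotopic_join_reverse[OF assms(4)]] p
      by (intro path_homotopic_join) auto
    also have "path_homotopic X \<dots> (path_join (path_join p c) (path_reverse c))"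
      using p assms(4) by (intro path_homotopic_assoc) (auto simp: pathin_reverse)
    finally show ?thesis .
  qed
  have "path_homotopic X p (path_join (path_join p c) (path_reverse c))" using * assms by blast
  also have "path_homotopic X \<dots> (path_join (path_join q c) (path_reverse c))"
    using assms by (intro path_homotopic_join[OF assms(1)]) (auto simp: pathin_reverse)
  also have "path_homotopic X \<dots> q" using * assms by (blast intro: path_homotopic_sym)
  finally show ?thesis .
qed

lemma path_homotopic_cancel_left:
  assumes "path_homotopic X (path_join c p) (path_join c q)" "pathin X p" "pathin X q" "pathin X c"
    "c 1 = p 0" "c 1 = q 0"
  shows "path_homotopic X p q"
proof -
  have *: "path_homotopic X p (path_join (path_reverse c) (path_join c p))"
    if p: "pathin X p" "c 1 = p 0" for p
  proof -
    have "path_homotopic X p (path_join (\<lambda>t. p 0) p)"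
      using path_homotopic_sym[OF path_homotopic_const_join[OF p(1)]] .
    also have "path_homotopic X \<dots> (path_join (path_join (path_reverse c) c) p)"
      using path_homotopic_sym[OF path_homotopic_reverse_join[OF assms(4)]] p
      by (intro path_homotopic_join) auto
    also have "path_homotopic X \<dots> (path_join (path_reverse c) (path_join c p))"
      using p assms(4) by (intro path_homotopic_sym[OF path_homotopic_assoc]) (auto simp: pathin_reverse)
    finally show ?thesis .
  qed
  have "path_homotopic X p (path_join (path_reverse c) (path_join c p))" using * assms by blast
  also have "path_homotopic X \<dots> (path_join (path_reverse c) (path_join c q))"
    using assms by (intro path_homotopic_join[OF _ assms(1)]) (auto simp: pathin_reverse)
  also have "path_homotopic X \<dots> q" using * assms by (blast intro: path_homotopic_sym)
  finally show ?thesis .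
qed

text \<open>Paths with the same ends are closed up by the same two paths, and these can be cancelled
  from a homotopy.\<close>

lemma path_class_faithful:
  assumes X: "path_connected_space X" "x0 \<in> topspace X"
    and p: "pathin X p" and q: "pathin X q" and pq: "q 0 = p 0" "q 1 = p 1"
    and eq: "path_class X x0 p = path_class X x0 q"
  shows "path_homotopic X p q"
proof -
  let ?a = "base_path X x0 (p 0)" and ?b = "path_reverse (base_path X x0 (p 1))"
  have a: "pathin X ?a" "?a 0 = x0" "?a 1 = p 0" and b: "pathin X ?b" "?b 0 = p 1" "?b 1 = x0"
    using base_path[OF X] path_start_in_topspace[OF p] path_finish_in_topspace[OF p]
    by (auto simp: pathin_reverse)
  have "path_join (path_join ?a q) ?b \<in> loop_class X x0 (path_join (path_join ?a p) ?b)"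
    using eq a b p q pq by (auto simp: path_class_def pathin_join intro!: loop_class_self)
  then have "path_homotopic X (path_join (path_join ?a p) ?b) (path_join (path_join ?a q) ?b)"
    by (rule mem_loop_class) (use a b in auto)
  then have "path_homotopic X (path_join ?a p) (path_join ?a q)"
    by (rule path_homotopic_cancel_right) (use a b p q pq in \<open>auto simp: pathin_join\<close>)
  then show ?thesis
    by (rule path_homotopic_cancel_left) (use a p q pq in auto)
qed

lemma path_class_full:
  assumes X: "path_connected_space X" "x0 \<in> topspace X"
    and g: "g \<in> carrier (fundamental_group X x0)"
  shows "\<exists>p. pathin X p \<and> p 0 = x0 \<and> p 1 = x0 \<and> path_class X x0 p = g"
proof -
  let ?G = "fundamental_group X x0" and ?b = "base_path X x0 x0"
  interpret group ?G by (rule group_fundamental_group[OF X(2)])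
  have b: "pathin X ?b" "?b 0 = x0" "?b 1 = x0" using base_path[OF X X(2)] by auto
  let ?\<beta> = "loop_class X x0 ?b"
  have \<beta>: "?\<beta> \<in> carrier ?G" "loop_class X x0 (path_reverse ?b) \<in> carrier ?G"
    using b by (auto simp: pathin_reverse)
  have "loop_class X x0 (path_reverse ?b) \<otimes>\<^bsub>?G\<^esub> ?\<beta> = \<one>\<^bsub>?G\<^esub>"
    using b path_homotopic_reverse_join[OF b(1)]
    by (simp add: mult_fundamental_group pathin_reverse one_fundamental_group loop_class_cong)
  then have inv: "loop_class X x0 (path_reverse ?b) = inv\<^bsub>?G\<^esub> ?\<beta>"
    using \<beta> by (simp add: inv_equality)
  have "inv\<^bsub>?G\<^esub> ?\<beta> \<otimes>\<^bsub>?G\<^esub> g \<otimes>\<^bsub>?G\<^esub> ?\<beta> \<in> carrier ?G" using \<beta> g by simp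
  \<comment> \<open>\<open>path_class\<close> conjugates a loop at \<open>x0\<close> by the chosen
    path \<open>?b\<close>, so the loop is taken to represent \<open>g\<close> conjugated the other
    way.\<close>
  then obtain p where p: "pathin X p" "p 0 = x0" "p 1 = x0" "inv\<^bsub>?G\<^esub> ?\<beta> \<otimes>\<^bsub>?G\<^esub> g \<otimes>\<^bsub>?G\<^esub> ?\<beta> = loop_class X x0 p"
    by (rule fundamental_groupE)
  have "path_class X x0 p = ?\<beta> \<otimes>\<^bsub>?G\<^esub> loop_class X x0 p \<otimes>\<^bsub>?G\<^esub> loop_class X x0 (path_reverse ?b)"
    using b p by (simp add: path_class_def mult_fundamental_group pathin_join pathin_reverse)
  also have "\<dots> = g"
    unfolding p(4)[symmetric] inv using \<beta> g by (simp add: m_assoc) (simp flip: m_assoc)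
  finally show ?thesis using p by blast
qed

text \<open>Any path from \<open>x0\<close> to \<open>x\<close> can be preceded by a loop that
  cancels its class. Such paths serve as a frame in the Hurewicz argument.\<close>

lemma path_class_trivial_path:
  assumes X: "path_connected_space X" "x0 \<in> topspace X" and x: "x \<in> topspace X"
  shows "\<exists>p. pathin X p \<and> p 0 = x0 \<and> p 1 = x \<and> path_class X x0 p = \<one>\<^bsub>fundamental_group X x0\<^esub>"
proof -
  let ?G = "fundamental_group X x0"
  interpret group ?G by (rule group_fundamental_group[OF X(2)])
  note w = path_functor_path_class[OF X]
  note b = base_path[OF X x]
  have "inv\<^bsub>?G\<^esub> path_class X x0 (base_path X x0 x) \<in> carrier ?G"
    using path_functorD(1)[OF w b(1)] by simp
  then obtain q where q: "pathin X q" "q 0 = x0" "q 1 = x0" "path_class X x0 q = inv\<^bsub>?G\<^esub> path_class X x0 (base_path X x0 x)"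
    using path_class_full[OF X] by blast
  then show ?thesis
    using b path_functorD(1)[OF w b(1)]
    by (intro exI[of _ "path_join q (base_path X x0 x)"])
       (simp add: pathin_join path_functorD(3)[OF w])
qed

section \<open>Singular 1-simplices from paths, 2-simplices from homotopies\<close>

definition path_simplex :: "(real \<Rightarrow> 'a) \<Rightarrow> (nat \<Rightarrow> real) \<Rightarrow> 'a" where
  "path_simplex p = restrict (\<lambda>x. p (x 1)) (standard_simplex 1)"

lemma standard_simplex_1: "x \<in> standard_simplex 1 \<Longrightarrow> x 0 = 1 - x 1 \<and> x 1 \<in> {0..1} \<and> (\<forall>j>1. x j = 0)"
  by (auto simp: standard_simplex_def)

lemma standard_simplex_1_eq: "x \<in> standard_simplex 1 \<Longrightarrow> x = edge_path 0 1 (x 1)"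
  using standard_simplex_1[of x] by (auto simp: edge_path_def fun_eq_iff)

lemma path_simplex_cong:
  assumes "\<And>t. t \<in> {0..1} \<Longrightarrow> p t = q t"
  shows "path_simplex p = path_simplex q"
  unfolding path_simplex_def by (rule restrict_ext) (use assms standard_simplex_1 in blast)

lemma continuous_map_simplex_coordinate:
  "continuous_map (simplex_space n) euclideanreal (\<lambda>x. x i)"
  by (intro continuous_map_from_subtopology continuous_map_product_projection) simp

lemma singular_simplex_path_simplex:
  assumes "pathin X p"
  shows "singular_simplex 1 X (path_simplex p)"
proof -
  have "continuous_map (simplex_space 1) (top_of_set {0..1}) (\<lambda>x. x 1)"
    using continuous_map_simplex_coordinate standard_simplex_1
    by (auto simp: continuous_map_in_subtopology)
  from continuous_map_compose[OF this assms[unfolded pathin_def]]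
  show ?thesis
    by (auto simp: singular_simplex_def path_simplex_def o_def elim!: continuous_map_eq)
qed

lemma path_simplex_edge:
  assumes "singular_simplex 1 X \<sigma>"
  shows "path_simplex (simplex_edge \<sigma> 0) = \<sigma>"
proof
  fix x
  show "path_simplex (simplex_edge \<sigma> 0) x = \<sigma> x"
    using assms standard_simplex_1_eq[of x]
    by (auto simp: path_simplex_def singular_simplex_def extensional_def simplex_edge_eq)
qed

lemma simplex_edge_path_simplex:
  "t \<in> {0..1} \<Longrightarrow> simplex_edge (path_simplex p) 0 t = p t"
  using edge_path_in_simplex[of 0 1 1 t] by (simp add: simplex_edge_eq path_simplex_def edge_path_def)

lemma singular_face_triangle:
  "singular_face 2 0 \<tau> = path_simplex (\<tau> \<circ> edge_path 1 2)"
  "singular_face 2 1 \<tau> = path_simplex (\<tau> \<circ> edge_path 0 2)"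
  "singular_face 2 2 \<tau> = path_simplex (\<tau> \<circ> edge_path 0 1)"
proof -
  have *: "singular_face 2 k \<tau> = path_simplex (\<tau> \<circ> edge_path a b)"
    if "\<And>t. simplical_face k (edge_path 0 1 t) = edge_path a b t" for k a b
  proof -
    have "(\<tau> \<circ> simplical_face k) x = (\<tau> \<circ> edge_path a b) (x 1)" if "x \<in> standard_simplex 1" for x
      using \<open>\<And>t. simplical_face k (edge_path 0 1 t) = edge_path a b t\<close>[of "x 1"]
      by (subst standard_simplex_1_eq[OF that]) simp
    then have "restrict (\<tau> \<circ> simplical_face k) (standard_simplex 1) = (\<lambda>x\<in>standard_simplex 1. (\<tau> \<circ> edge_path a b) (x 1))"
      by (rule restrict_ext)
    then show ?thesis by (simp add: singular_face_def path_simplex_def)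
  qed
  show "singular_face 2 0 \<tau> = path_simplex (\<tau> \<circ> edge_path 1 2)"
    "singular_face 2 1 \<tau> = path_simplex (\<tau> \<circ> edge_path 0 2)"
    "singular_face 2 2 \<tau> = path_simplex (\<tau> \<circ> edge_path 0 1)"
    by (rule *; simp add: simplical_face_edge_path numeral_2_eq_2)+
qed

lemma chain_boundary_triangle:
  "chain_boundary 2 (frag_of \<tau>) = frag_of (path_simplex (\<tau> \<circ> edge_path 1 2))
     - frag_of (path_simplex (\<tau> \<circ> edge_path 0 2)) + frag_of (path_simplex (\<tau> \<circ> edge_path 0 1))"
proof -
  have "{..2} = {0, 1, 2::nat}" by auto
  then show ?thesis by (simp add: chain_boundary_of singular_face_triangle[unfolded One_nat_def])
qed

text \<open>Stationary edges allow a homotopy to be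
  transferred from the square to a triangle by a map that is continuous at the vertices.\<close>

definition slow :: "(real \<Rightarrow> 'a) \<Rightarrow> real \<Rightarrow> 'a" where
  "slow p = (\<lambda>t. p (max 0 (min 1 (3 * t - 1))))"

lemma path_homotopic_slow:
  assumes "pathin X p"
  shows "path_homotopic X (slow p) p"
proof -
  have "path_homotopic X (p \<circ> (\<lambda>t. max 0 (min 1 (3 * t - 1)))) p"
    using assms by (rule path_homotopic_reparam) (auto intro!: continuous_intros)
  then show ?thesis by (simp add: slow_def o_def)
qed

lemma pathin_slow: "pathin X p \<Longrightarrow> pathin X (slow p)"
  using path_homotopic_slow path_homotopic_imp_pathin by blast

text \<open>The side of the homotopy square carrying \<open>path_join p q\<close> is bent around
  vertex 1 at its midpoint, and the side \<open>r\<close> becomes the edge 02. The two constant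
  sides are spent on the stationary parts of the edges near vertices 0 and 2.\<close>

lemma homotopy_triangle:
  assumes pq: "p 1 = q 0" and hom: "path_homotopic X (path_join p q) r"
  shows "\<exists>\<tau>. singular_simplex 2 X \<tau> \<and> (\<forall>t\<in>{0..1}. \<tau> (edge_path 0 1 t) = slow p t \<and>
           \<tau> (edge_path 1 2 t) = slow q t \<and> \<tau> (edge_path 0 2 t) = slow r t)"
proof -
  obtain H :: "real \<times> real \<Rightarrow> _" where H: "continuous_map (top_of_set ({0..1} \<times> {0..1})) X H"
    "\<forall>t\<in>{0..1}. H (0, t) = path_join p q t" "\<forall>t\<in>{0..1}. H (1, t) = r t"
    "\<forall>s\<in>{0..1}. H (s, 0) = path_join p q 0 \<and> H (s, 1) = path_join p q 1"
    using hom unfolding path_homotopic_iff by blast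
  define cl where "cl = (\<lambda>t::real. max 0 (min 1 t))"
  have cl: "cl t \<in> {0..1}" for t by (simp add: cl_def)
  \<comment> \<open>The first coordinate is 1 where \<open>x 1 = 0\<close>, the edge carrying
    \<open>r\<close>, and 0 once \<open>x 1 \<ge> 1/3\<close>. The second advances by 1/2 with the
    middle third of \<open>x 1\<close> and by 1 with that of \<open>x 2\<close>; on the middle third
    of edge 12 one contribution falls while the other rises, with sum
    \<open>3/2 * t\<close>.\<close>
  define f where "f x = H (cl (1 - 3 * x 1), min 1 (cl (3 * x 1 - 1) / 2 + cl (3 * x 2 - 1)))" for x :: "nat \<Rightarrow> real"
  let ?S = "simplex_space 2"
  have "continuous_map ?S euclideanreal (\<lambda>x. cl (1 - 3 * x 1))"
    "continuous_map ?S euclideanreal (\<lambda>x. min 1 (cl (3 * x 1 - 1) / 2 + cl (3 * x 2 - 1)))"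
    unfolding cl_def
    by (intro continuous_map_real_max continuous_map_real_min continuous_map_diff continuous_map_add
        continuous_map_real_mult continuous_map_real_divide continuous_map_simplex_coordinate continuous_map_const[THEN iffD2]; simp)+
  then have "continuous_map ?S (prod_topology euclideanreal euclideanreal)
     (\<lambda>x. (cl (1 - 3 * x 1), min 1 (cl (3 * x 1 - 1) / 2 + cl (3 * x 2 - 1))))"
    by (rule continuous_map_pairedI)
  then have "continuous_map ?S (top_of_set ({0..1} \<times> {0..1}))
     (\<lambda>x. (cl (1 - 3 * x 1), min 1 (cl (3 * x 1 - 1) / 2 + cl (3 * x 2 - 1))))"
    using cl by (auto simp: continuous_map_in_subtopology)
  from continuous_map_compose[OF this H(1)]
  have "continuous_map ?S X f" by (rule continuous_map_eq) (simp add: f_def)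
  then have \<tau>: "singular_simplex 2 X (restrict f (standard_simplex 2))"
    by (auto simp: singular_simplex_def elim!: continuous_map_eq)
  have 01: "f (edge_path 0 1 t) = slow p t" if t: "t \<in> {0..1}" for t
  proof (cases "t \<le> 1/3")
    case True
    then have "f (edge_path 0 1 t) = H (cl (1 - 3 * t), 0)" "slow p t = p 0"
      by (auto simp: f_def edge_path_def slow_def cl_def)
    then show ?thesis using H(4) cl by simp
  next
    case False
    then have "f (edge_path 0 1 t) = H (0, cl (3 * t - 1) / 2)"
      using t by (auto simp: f_def edge_path_def cl_def)
    also have "\<dots> = slow p t" using H(2) cl[of "3 * t - 1"] by (simp add: path_join_def slow_def cl_def)
    finally show ?thesis .
  qed
  have 12: "f (edge_path 1 2 t) = slow q t" if t: "t \<in> {0..1}" for t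
  proof -
    consider "t \<le> 1/3" | "1/3 < t" "t < 2/3" | "2/3 \<le> t" by linarith
    then show ?thesis
    proof cases
      case 1
      then have "f (edge_path 1 2 t) = H (0, 1/2)" "slow q t = q 0"
        by (auto simp: f_def edge_path_def slow_def cl_def)
      then show ?thesis using H(2) pq by (simp add: path_join_def)
    next
      case 2
      then have "f (edge_path 1 2 t) = H (0, 3/2 * t)" "slow q t = q (3 * t - 1)"
        by (auto simp: f_def edge_path_def slow_def cl_def max_def min_def field_simps)
      then show ?thesis using H(2) 2 by (simp add: path_join_def)
    next
      case 3
      then have "f (edge_path 1 2 t) = H (cl (3 * t - 2), 1)" "slow q t = q 1"
        using t by (auto simp: f_def edge_path_def slow_def cl_def)
      then show ?thesis using H(4) cl by simp
    qed
  qed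
  have 02: "f (edge_path 0 2 t) = slow r t" if "t \<in> {0..1}" for t
    using H(3) cl[of "3 * t - 1"] by (simp add: f_def edge_path_def slow_def cl_def)
  show ?thesis
    using \<tau> 01 12 02 edge_path_in_simplex[of _ 2 _] by (intro exI[of _ "restrict f (standard_simplex 2)"]) simp
qed

text \<open>Edges produced by \<open>homotopy_triangle\<close> are slowed, those of a given chain
  are not; this triangle connects the two.\<close>

lemma slow_triangle:
  assumes p: "pathin X p"
  shows "\<exists>\<tau>. singular_simplex 2 X \<tau> \<and> (\<forall>t\<in>{0..1}. \<tau> (edge_path 0 1 t) = p t \<and>
           \<tau> (edge_path 1 2 t) = p 1 \<and> \<tau> (edge_path 0 2 t) = slow p t)"
proof -
  \<comment> \<open>\<open>x 1 + x 2\<close> is the wanted parameter on edges 01 and 12. The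
    correction that slows edge 02 is a function of \<open>x 2\<close>, so it is 0 on edge 01;
    clamping it to the interval from \<open>- x 0\<close> to \<open>x 0\<close> kills it on edge 12
    and leaves it unchanged on edge 02.\<close>
  define u where "u x = max 0 (min 1 (x 1 + x 2 + max (- x 0) (min (x 0) (max 0 (min 1 (3 * x 2 - 1)) - x 2))))"
    for x :: "nat \<Rightarrow> real"
  let ?S = "simplex_space 2"
  have "continuous_map ?S euclideanreal u"
    unfolding u_def
    by (intro continuous_map_real_max continuous_map_real_min continuous_map_diff continuous_map_add continuous_map_minus
        continuous_map_real_mult continuous_map_real_divide continuous_map_simplex_coordinate continuous_map_const[THEN iffD2]; simp)
  then have "continuous_map ?S (top_of_set {0..1}) u"
    by (auto simp: continuous_map_in_subtopology u_def)
  from continuous_map_compose[OF this p[unfolded pathin_def]]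
  have \<tau>: "singular_simplex 2 X (restrict (p \<circ> u) (standard_simplex 2))"
    by (auto simp: singular_simplex_def elim!: continuous_map_eq)
  have "u (edge_path 0 1 t) = t" "u (edge_path 1 2 t) = 1" "u (edge_path 0 2 t) = max 0 (min 1 (3 * t - 1))"
    if "t \<in> {0..1}" for t
    using that by (auto simp: u_def edge_path_def)
  then show ?thesis
    using \<tau> edge_path_in_simplex[of _ 2 _]
    by (intro exI[of _ "restrict (p \<circ> u) (standard_simplex 2)"]) (simp add: slow_def)
qed

abbreviation path_chain :: "(real \<Rightarrow> 'a) \<Rightarrow> 'a chain" where
  "path_chain p \<equiv> frag_of (path_simplex p)"

lemma singular_boundary_homotopy_triangle:
  assumes "p 1 = q 0" "path_homotopic X (path_join p q) r"
  shows "singular_relboundary 1 X {} (path_chain (slow q) - path_chain (slow r) + path_chain (slow p))"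
proof -
  obtain \<tau> where \<tau>: "singular_simplex 2 X \<tau>" "\<forall>t\<in>{0..1}. \<tau> (edge_path 0 1 t) = slow p t \<and>
           \<tau> (edge_path 1 2 t) = slow q t \<and> \<tau> (edge_path 0 2 t) = slow r t"
    using homotopy_triangle[OF assms] by blast
  then have "path_simplex (\<tau> \<circ> edge_path 1 2) = path_simplex (slow q)"
    "path_simplex (\<tau> \<circ> edge_path 0 2) = path_simplex (slow r)"
    "path_simplex (\<tau> \<circ> edge_path 0 1) = path_simplex (slow p)"
    by (auto intro!: path_simplex_cong)
  then have "chain_boundary 2 (frag_of \<tau>) = path_chain (slow q) - path_chain (slow r) + path_chain (slow p)"
    by (simp add: chain_boundary_triangle)
  then show ?thesis
    using \<tau>(1) unfolding singular_boundary by (metis one_add_one plus_1_eq_Suc singular_chain_of)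
qed

lemma singular_boundary_slow:
  assumes p: "pathin X p"
  shows "singular_relboundary 1 X {} (path_chain (slow p) - path_chain p)"
proof -
  obtain \<tau> where \<tau>: "singular_simplex 2 X \<tau>" "\<forall>t\<in>{0..1}. \<tau> (edge_path 0 1 t) = p t \<and>
           \<tau> (edge_path 1 2 t) = p 1 \<and> \<tau> (edge_path 0 2 t) = slow p t"
    using slow_triangle[OF p] by blast
  \<comment> \<open>The boundary of \<open>\<tau>\<close> contains one constant edge. The boundary
    of the same triangle over a constant path is just that edge, so it cancels in
    \<open>\<tau>' - \<tau>\<close>.\<close>
  obtain \<tau>' where \<tau>': "singular_simplex 2 X \<tau>'" "\<forall>t\<in>{0..1}. \<tau>' (edge_path 0 1 t) = p 1 \<and>
           \<tau>' (edge_path 1 2 t) = p 1 \<and> \<tau>' (edge_path 0 2 t) = slow (\<lambda>t. p 1) t"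
    using slow_triangle[of X "\<lambda>t. p 1"] path_finish_in_topspace[OF p] by auto
  have "path_simplex (\<tau> \<circ> edge_path 1 2) = path_simplex (\<lambda>t. p 1)"
    "path_simplex (\<tau> \<circ> edge_path 0 2) = path_simplex (slow p)"
    "path_simplex (\<tau> \<circ> edge_path 0 1) = path_simplex p"
    "path_simplex (\<tau>' \<circ> edge_path 1 2) = path_simplex (\<lambda>t. p 1)"
    "path_simplex (\<tau>' \<circ> edge_path 0 2) = path_simplex (\<lambda>t. p 1)"
    "path_simplex (\<tau>' \<circ> edge_path 0 1) = path_simplex (\<lambda>t. p 1)"
    using \<tau>(2) \<tau>'(2) by (auto intro!: path_simplex_cong simp: slow_def)
  then have "chain_boundary 2 (frag_of \<tau>' - frag_of \<tau>) = path_chain (slow p) - path_chain p"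
    by (simp add: chain_boundary_triangle chain_boundary_diff)
  moreover have "singular_chain 2 X (frag_of \<tau>' - frag_of \<tau>)"
    using \<tau>(1) \<tau>'(1) by (simp add: singular_chain_diff singular_chain_of)
  ultimately show ?thesis
    unfolding singular_boundary by (metis one_add_one plus_1_eq_Suc)
qed

section \<open>A section of the edge map in degrees 1 and 2\<close>

definition loop_rep :: "'a topology \<Rightarrow> 'a \<Rightarrow> (real \<Rightarrow> 'a) set \<Rightarrow> real \<Rightarrow> 'a" where
  "loop_rep X x0 g = (SOME p. pathin X p \<and> p 0 = x0 \<and> p 1 = x0 \<and> path_class X x0 p = g)"

definition bar_triangle :: "'a topology \<Rightarrow> 'a \<Rightarrow> (real \<Rightarrow> 'a) set \<Rightarrow> (real \<Rightarrow> 'a) set \<Rightarrow> (nat \<Rightarrow> real) \<Rightarrow> 'a" where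
  "bar_triangle X x0 g h = (SOME \<tau>. singular_simplex 2 X \<tau> \<and>
     (\<forall>t\<in>{0..1}. \<tau> (edge_path 0 1 t) = slow (loop_rep X x0 g) t \<and> \<tau> (edge_path 1 2 t) = slow (loop_rep X x0 h) t \<and>
        \<tau> (edge_path 0 2 t) = slow (loop_rep X x0 (g \<otimes>\<^bsub>fundamental_group X x0\<^esub> h)) t))"

text \<open>With \<open>bar_section_2\<close>, a right inverse of \<open>edge_chain\<close> that is
  compatible with boundaries. In degree 3 there is no such map in general, because the second
  homotopy group obstructs filling.\<close>

definition bar_section_1 :: "'a topology \<Rightarrow> 'a \<Rightarrow> ((real \<Rightarrow> 'a) set list \<Rightarrow>\<^sub>0 int) \<Rightarrow> 'a chain" where
  "bar_section_1 X x0 = frag_extend (\<lambda>xs. path_chain (slow (loop_rep X x0 (xs ! 0))))"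

definition bar_section_2 :: "'a topology \<Rightarrow> 'a \<Rightarrow> ((real \<Rightarrow> 'a) set list \<Rightarrow>\<^sub>0 int) \<Rightarrow> 'a chain" where
  "bar_section_2 X x0 = frag_extend (\<lambda>xs. frag_of (bar_triangle X x0 (xs ! 0) (xs ! 1)))"

lemma bar_section_simps [simp]:
  "bar_section_1 X x0 0 = 0"
  "bar_section_1 X x0 (frag_of xs) = path_chain (slow (loop_rep X x0 (xs ! 0)))"
  "bar_section_1 X x0 (a + b) = bar_section_1 X x0 a + bar_section_1 X x0 b"
  "bar_section_1 X x0 (a - b) = bar_section_1 X x0 a - bar_section_1 X x0 b"
  "bar_section_2 X x0 0 = 0"
  "bar_section_2 X x0 (frag_of xs) = frag_of (bar_triangle X x0 (xs ! 0) (xs ! 1))"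
  "bar_section_2 X x0 (a - b) = bar_section_2 X x0 a - bar_section_2 X x0 b"
  by (simp_all add: bar_section_1_def bar_section_2_def frag_extend_add frag_extend_diff)

lemma bar_boundary_2:
  "bar_boundary G (frag_of [g, h]) = frag_of [h] - frag_of [g \<otimes>\<^bsub>G\<^esub> h] + frag_of [g]"
  by (simp add: bar_boundary_of bar_face_def numeral_2_eq_2)

context
  fixes X :: "'a topology" and x0 :: 'a
  assumes X: "path_connected_space X" "x0 \<in> topspace X"
begin

private abbreviation (input) "\<pi> \<equiv> fundamental_group X x0"
private abbreviation (input) "\<omega> \<equiv> path_class X x0"

lemma loop_rep:
  assumes "g \<in> carrier \<pi>"
  shows "pathin X (loop_rep X x0 g)" "loop_rep X x0 g 0 = x0" "loop_rep X x0 g 1 = x0" "\<omega> (loop_rep X x0 g) = g"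
  using someI_ex[OF path_class_full[OF X assms]] by (auto simp: loop_rep_def)

lemma bar_triangle:
  assumes g: "g \<in> carrier \<pi>" and h: "h \<in> carrier \<pi>"
  shows "singular_simplex 2 X (bar_triangle X x0 g h)"
    "t \<in> {0..1} \<Longrightarrow> bar_triangle X x0 g h (edge_path 0 1 t) = slow (loop_rep X x0 g) t"
    "t \<in> {0..1} \<Longrightarrow> bar_triangle X x0 g h (edge_path 1 2 t) = slow (loop_rep X x0 h) t"
    "t \<in> {0..1} \<Longrightarrow> bar_triangle X x0 g h (edge_path 0 2 t) = slow (loop_rep X x0 (g \<otimes>\<^bsub>\<pi>\<^esub> h)) t"
proof -
  interpret group \<pi> by (rule group_fundamental_group[OF X(2)])
  note r = loop_rep[OF g] loop_rep[OF h] loop_rep[OF m_closed[OF g h]]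
  have "path_homotopic X (path_join (loop_rep X x0 g) (loop_rep X x0 h)) (loop_rep X x0 (g \<otimes>\<^bsub>\<pi>\<^esub> h))"
    by (rule path_class_faithful[OF X])
       (use r in \<open>auto simp: pathin_join path_functorD(3)[OF path_functor_path_class[OF X]]\<close>)
  from someI_ex[OF homotopy_triangle[OF _ this]] r
  show "singular_simplex 2 X (bar_triangle X x0 g h)"
    "t \<in> {0..1} \<Longrightarrow> bar_triangle X x0 g h (edge_path 0 1 t) = slow (loop_rep X x0 g) t"
    "t \<in> {0..1} \<Longrightarrow> bar_triangle X x0 g h (edge_path 1 2 t) = slow (loop_rep X x0 h) t"
    "t \<in> {0..1} \<Longrightarrow> bar_triangle X x0 g h (edge_path 0 2 t) = slow (loop_rep X x0 (g \<otimes>\<^bsub>\<pi>\<^esub> h)) t"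
    unfolding bar_triangle_def by auto
qed

lemma path_class_slow_loop_rep:
  assumes "g \<in> carrier \<pi>"
  shows "\<omega> (slow (loop_rep X x0 g)) = g"
  using path_functorD(2)[OF path_functor_path_class[OF X] path_homotopic_slow[OF loop_rep(1)[OF assms]]]
    loop_rep(4)[OF assms] by simp

lemma path_class_eqI:
  assumes "pathin X p" "\<And>t. t \<in> {0..1} \<Longrightarrow> q t = p t"
  shows "\<omega> q = \<omega> p"
  using path_functorD(2)[OF path_functor_path_class[OF X] path_homotopic_eq[of X p q]] assms by simp

lemma bar_section_1_chain:
  assumes c: "c \<in> carrier (bar_chain_group 1 \<pi>)"
  shows "singular_relcycle 1 X {} (bar_section_1 X x0 c)" "edge_chain \<omega> 1 (bar_section_1 X x0 c) = c"
proof -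
  have "Poly_Mapping.keys c \<subseteq> {xs. length xs = 1 \<and> set xs \<subseteq> carrier \<pi>}" using c by simp
  then have "singular_relcycle 1 X {} (bar_section_1 X x0 c) \<and> edge_chain \<omega> 1 (bar_section_1 X x0 c) = c"
  proof (induction rule: frag_induction)
    case (one xs)
    then obtain g where xs: "xs = [g]" and g: "g \<in> carrier \<pi>" by (auto simp: length_Suc_conv)
    let ?l = "slow (loop_rep X x0 g)"
    have l: "pathin X ?l" "?l 0 = x0" "?l 1 = x0"
      using loop_rep[OF g] pathin_slow by (auto simp: slow_def)
    note s = singular_simplex_path_simplex[OF l(1)]
    have "singular_face 1 0 (path_simplex ?l) = singular_face 1 1 (path_simplex ?l)"
    proof -
      have e: "simplical_face 0 x 1 = 1" "simplical_face 1 x 1 = 0" if "x \<in> standard_simplex 0" for x :: "nat \<Rightarrow> real"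
        using that by (auto simp: simplical_face_def standard_simplex_0)
      have "path_simplex ?l (simplical_face 0 x) = path_simplex ?l (simplical_face 1 x)" if "x \<in> standard_simplex 0" for x
        using simplical_face_in_standard_simplex[of 1 0 x] simplical_face_in_standard_simplex[of 1 1 x] that e[OF that] l
        by (simp add: path_simplex_def)
      then show ?thesis by (auto simp: singular_face_def)
    qed
    then have "chain_boundary 1 (path_chain ?l) = 0" by (simp add: chain_boundary_of)
    then have "singular_relcycle 1 X {} (path_chain ?l)"
      using s by (simp add: singular_cycle singular_chain_of)
    moreover have "\<omega> (simplex_edge (path_simplex ?l) 0) = g"
      using path_class_eqI[OF l(1), of "simplex_edge (path_simplex ?l) 0"] simplex_edge_path_simplex[of _ ?l]
        path_class_slow_loop_rep[OF g] by simp
    ultimately show ?case by (simp add: xs)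
  qed (auto simp: singular_relcycle_diff)
  then show "singular_relcycle 1 X {} (bar_section_1 X x0 c)" "edge_chain \<omega> 1 (bar_section_1 X x0 c) = c" by auto
qed

text \<open>The faces of \<open>bar_triangle X x0 g h\<close> are the very simplices that
  \<open>bar_section_1\<close> assigns to \<open>h\<close>, to the product and to \<open>g\<close>,
  so the boundaries agree as chains and not merely up to homology.\<close>

lemma bar_section_2_chain:
  assumes c: "c \<in> carrier (bar_chain_group 2 \<pi>)"
  shows "singular_chain 2 X (bar_section_2 X x0 c)" "edge_chain \<omega> 2 (bar_section_2 X x0 c) = c"
    "chain_boundary 2 (bar_section_2 X x0 c) = bar_section_1 X x0 (bar_boundary \<pi> c)"
proof -
  have "Poly_Mapping.keys c \<subseteq> {xs. length xs = 2 \<and> set xs \<subseteq> carrier \<pi>}" using c by simp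
  then have "singular_chain 2 X (bar_section_2 X x0 c) \<and> edge_chain \<omega> 2 (bar_section_2 X x0 c) = c \<and>
    chain_boundary 2 (bar_section_2 X x0 c) = bar_section_1 X x0 (bar_boundary \<pi> c)"
  proof (induction rule: frag_induction)
    case (one xs)
    then obtain g h where xs: "xs = [g, h]" and g: "g \<in> carrier \<pi>" and h: "h \<in> carrier \<pi>"
      by (auto simp: length_Suc_conv numeral_2_eq_2)
    note \<tau> = bar_triangle[OF g h]
    let ?\<tau> = "bar_triangle X x0 g h"
    have "\<omega> (simplex_edge ?\<tau> 0) = g"
      using path_class_eqI[OF pathin_slow[OF loop_rep(1)[OF g]], of "simplex_edge ?\<tau> 0"] \<tau>(2)
        path_class_slow_loop_rep[OF g] by (simp add: simplex_edge_eq)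
    moreover have "\<omega> (simplex_edge ?\<tau> 1) = h"
      using path_class_eqI[OF pathin_slow[OF loop_rep(1)[OF h]], of "simplex_edge ?\<tau> 1"] \<tau>(3)
        path_class_slow_loop_rep[OF h] by (simp add: simplex_edge_eq numeral_2_eq_2)
    moreover have "path_simplex (?\<tau> \<circ> edge_path 1 2) = path_simplex (slow (loop_rep X x0 h))"
      "path_simplex (?\<tau> \<circ> edge_path 0 2) = path_simplex (slow (loop_rep X x0 (g \<otimes>\<^bsub>\<pi>\<^esub> h)))"
      "path_simplex (?\<tau> \<circ> edge_path 0 1) = path_simplex (slow (loop_rep X x0 g))"
      using \<tau> by (auto intro!: path_simplex_cong)
    moreover have "[0..<2] = [0, 1::nat]" by (simp add: numeral_2_eq_2)
    ultimately show ?case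
      using \<tau>(1) by (simp add: xs singular_chain_of chain_boundary_triangle bar_boundary_2)
  qed (auto simp: singular_chain_diff chain_boundary_diff)
  then show "singular_chain 2 X (bar_section_2 X x0 c)" "edge_chain \<omega> 2 (bar_section_2 X x0 c) = c"
    "chain_boundary 2 (bar_section_2 X x0 c) = bar_section_1 X x0 (bar_boundary \<pi> c)" by auto
qed

text \<open>The section of a cycle is again a cycle: in degree 1 because it consists of loops, in
  degree 2 because it commutes with the boundary. In degree 2 this is the surjection in Hopf's
  theorem.\<close>

lemma bar_cycle_lift:
  assumes "n = 1 \<or> n = 2" "z \<in> bar_cycles n \<pi>"
  shows "\<exists>c. singular_relcycle n X {} c \<and> edge_chain \<omega> n c = z"
proof -
  have z: "z \<in> carrier (bar_chain_group n \<pi>)" "bar_boundary \<pi> z = 0"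
    using assms(2) by (auto simp: bar_cycles_def)
  show ?thesis
  proof (cases "n = 1")
    case True
    then show ?thesis using bar_section_1_chain z by blast
  next
    case False
    then have n: "n = 2" using assms(1) by simp
    show ?thesis
      using bar_section_2_chain[of z] z unfolding n
      by (intro exI[of _ "bar_section_2 X x0 z"]) (auto simp: singular_cycle)
  qed
qed

text \<open>The Hurewicz argument: modulo boundaries, a 1-chain \<open>c\<close> differs from the loops representing its
  edges by a chain depending linearly on \<open>\<partial>c\<close> only.\<close>

lemma singular_boundary_of_edge_boundary:
  assumes c: "singular_relcycle 1 X {} c" and b: "edge_chain \<omega> 1 c \<in> bar_boundaries 1 \<pi>"
  shows "singular_relboundary 1 X {} c"
proof -
  interpret group \<pi> by (rule group_fundamental_group[OF X(2)])
  note w = path_functor_path_class[OF X]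
  have "\<exists>\<delta>. \<forall>x\<in>topspace X. pathin X (\<delta> x) \<and> \<delta> x 0 = x0 \<and> \<delta> x 1 = x \<and> \<omega> (\<delta> x) = \<one>\<^bsub>\<pi>\<^esub>"
    using path_class_trivial_path[OF X] by (intro bchoice) blast
  then obtain \<delta> where \<delta>: "\<And>x. x \<in> topspace X \<Longrightarrow> pathin X (\<delta> x) \<and> \<delta> x 0 = x0 \<and> \<delta> x 1 = x \<and> \<omega> (\<delta> x) = \<one>\<^bsub>\<pi>\<^esub>"
    by blast
  \<comment> \<open>Extends linearly to 0-chains the choice of a path from \<open>x0\<close> to each
    point; the argument of \<open>\<rho>\<close> is the only point of the standard
    0-simplex.\<close>
  define B where "B = frag_extend (\<lambda>\<rho>. path_chain (slow (\<delta> (\<rho> (\<lambda>j::nat. if j = 0 then 1 else 0 :: real)))))"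
  have "Poly_Mapping.keys c \<subseteq> singular_simplex_set 1 X"
    using c by (auto simp: singular_cycle singular_chain_def)
  then have "singular_relboundary 1 X {} (bar_section_1 X x0 (edge_chain \<omega> 1 c) - c + B (chain_boundary 1 c))"
  proof (induction rule: frag_induction)
    case (one \<sigma>)
    then have \<sigma>: "singular_simplex 1 X \<sigma>" by simp
    define p where "p = simplex_edge \<sigma> 0"
    define g where "g = \<omega> p"
    have p: "pathin X p" using pathin_simplex_edge[OF \<sigma>] by (simp add: p_def)
    have \<sigma>p: "\<sigma> = path_simplex p" using path_simplex_edge[OF \<sigma>] by (simp add: p_def)
    have g: "g \<in> carrier \<pi>" using path_functorD(1)[OF w p] by (simp add: g_def)
    note ends = path_start_in_topspace[OF p] path_finish_in_topspace[OF p]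
    note d0 = \<delta>[OF ends(1)] and d1 = \<delta>[OF ends(2)]
    note l = loop_rep[OF g]
    \<comment> \<open>The paths chosen by \<open>\<delta>\<close> have trivial class, so both sides
      have class \<open>g\<close>.\<close>
    have "path_homotopic X (path_join (loop_rep X x0 g) (\<delta> (p 1))) (path_join (\<delta> (p 0)) p)"
      by (rule path_class_faithful[OF X])
         (use d0 d1 l p g in \<open>auto simp: pathin_join path_functorD(3)[OF w] simp flip: g_def\<close>)
    then have T1: "singular_relboundary 1 X {} (path_chain (slow (\<delta> (p 1))) - path_chain (slow (path_join (\<delta> (p 0)) p))
        + path_chain (slow (loop_rep X x0 g)))"
      by (rule singular_boundary_homotopy_triangle[rotated]) (use d1 l in auto)
    have T2: "singular_relboundary 1 X {} (path_chain (slow p) - path_chain (slow (path_join (\<delta> (p 0)) p))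
        + path_chain (slow (\<delta> (p 0))))"
      using d0 p by (intro singular_boundary_homotopy_triangle) (auto simp: pathin_join)
    \<comment> \<open>\<open>T1\<close> and \<open>T2\<close> share the edge
      \<open>path_join (\<delta> (p 0)) p\<close>, which cancels in their difference;
      \<open>singular_boundary_slow\<close> then turns \<open>slow p\<close> into
      \<open>p\<close>.\<close>
    have "singular_relboundary 1 X {} (path_chain (slow (loop_rep X x0 g)) - path_chain p +
        (path_chain (slow (\<delta> (p 1))) - path_chain (slow (\<delta> (p 0)))))"
      using singular_relboundary_add[OF singular_relboundary_diff[OF T1 T2] singular_boundary_slow[OF p]]
      by (simp add: algebra_simps)
    also have "path_chain (slow (loop_rep X x0 g)) = bar_section_1 X x0 (edge_chain \<omega> 1 (frag_of \<sigma>))"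
      by (simp add: g_def p_def)
    also have "path_chain (slow (\<delta> (p 1))) - path_chain (slow (\<delta> (p 0))) = B (chain_boundary 1 (frag_of \<sigma>))"
    proof -
      have "simplical_face 0 (\<lambda>j::nat. if j = 0 then 1 else 0 :: real) = edge_path 0 1 1"
        "simplical_face 1 (\<lambda>j::nat. if j = 0 then 1 else 0 :: real) = edge_path 0 1 0"
        by (auto simp: simplical_face_def fun_eq_iff)
      then have "singular_face 1 0 \<sigma> (\<lambda>j. if j = 0 then 1 else 0) = p 1"
        "singular_face 1 1 \<sigma> (\<lambda>j. if j = 0 then 1 else 0) = p 0"
        by (auto simp: singular_face_def p_def simplex_edge_eq)
      then show ?thesis by (simp add: chain_boundary_of B_def frag_extend_add frag_extend_cmul frag_extend_diff frag_extend_minus)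
    qed
    finally show ?case by (simp add: \<sigma>p)
  next
    case (diff a b)
    have "bar_section_1 X x0 (edge_chain \<omega> 1 (a - b)) - (a - b) + B (chain_boundary 1 (a - b)) =
      (bar_section_1 X x0 (edge_chain \<omega> 1 a) - a + B (chain_boundary 1 a)) -
      (bar_section_1 X x0 (edge_chain \<omega> 1 b) - b + B (chain_boundary 1 b))"
      by (simp add: B_def chain_boundary_diff frag_extend_diff)
    then show ?case using singular_relboundary_diff[OF diff] by (simp only:)
  qed (simp add: B_def)
  then have 1: "singular_relboundary 1 X {} (bar_section_1 X x0 (edge_chain \<omega> 1 c) - c)"
    using c by (simp add: singular_cycle B_def)
  obtain e where e: "e \<in> carrier (bar_chain_group 2 \<pi>)" "edge_chain \<omega> 1 c = bar_boundary \<pi> e"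
    using b by (auto simp: bar_boundaries_def numeral_2_eq_2)
  have "singular_relboundary 1 X {} (bar_section_1 X x0 (edge_chain \<omega> 1 c))"
    unfolding e(2) singular_boundary using bar_section_2_chain[OF e(1)]
    by (metis one_add_one plus_1_eq_Suc)
  from singular_relboundary_diff[OF this 1] show ?thesis by simp
qed

end

text \<open>A chase in the naturality square of H_n(space) \<rightarrow> H_n(fundamental group),
  which is onto for n = 1, 2 and injective for n = 1. On H_2 only surjectivity passes from spaces to
  groups.\<close>

lemma two_connected_functor_hom:
  fixes M :: "'m topology" and W :: "'w topology"
  assumes M: "path_connected_space M" "m0 \<in> topspace M" and W: "path_connected_space W" "w0 \<in> topspace W"
    and i: "continuous_map M W i"
    and iso: "hom_induced 1 M {} W {} i \<in> iso (homology_group 1 M) (homology_group 1 W)"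
    and epi: "hom_induced 2 M {} W {} i \<in> epi (homology_group 2 M) (homology_group 2 W)"
  shows "two_connected (fundamental_group M m0) (fundamental_group W w0)
    (functor_hom (\<lambda>p. path_class W w0 (i \<circ> p)))"
proof -
  let ?A = "fundamental_group M m0" and ?B = "fundamental_group W w0"
  let ?w = "\<lambda>p. path_class W w0 (i \<circ> p)"
  let ?H = "\<lambda>n. group_homology_map n ?B (functor_hom ?w)"
  note wM = path_functor_path_class[OF M] and wW = path_functor_path_class[OF W]
  have w: "path_functor M ?B ?w" by (rule path_functor_map[OF wW i])
  have hom: "functor_hom ?w \<in> hom ?A ?B" by (rule functor_hom_hom[OF w])
  have B: "group ?B" by (rule group_fundamental_group[OF W(2)])
  have H: "?H n (bar_class n ?A (edge_chain (path_class M m0) n c)) =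
      bar_class n ?B (edge_chain (path_class W w0) n (chain_map n i c))" if c: "singular_relcycle n M {} c" for n c
    using group_homology_map_functor_hom[OF M w B c] edge_chain_map[OF wW i, of n c] c
    unfolding classifying_homology_map_eq[OF M c] by (simp add: singular_cycle)
  have ind: "hom_induced (int n) M {} W {} i (homologous_rel_set n M {} c) = homologous_rel_set n W {} (chain_map n i c)"
    if "singular_relcycle n M {} c" for n c
    using hom_induced_chain_map[OF i _ that] by simp
  have surj: "?H n \<in> epi (group_homology n ?A) (group_homology n ?B)"
    if n: "n = 1 \<or> n = 2" and epi: "hom_induced (int n) M {} W {} i \<in> epi (homology_group n M) (homology_group n W)" for n
  proof -
    have "carrier (group_homology n ?B) \<subseteq> ?H n ` carrier (group_homology n ?A)"
    proof
      fix y assume "y \<in> carrier (group_homology n ?B)"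
      then obtain z where z: "z \<in> bar_cycles n ?B" "y = bar_class n ?B z"
        by (auto simp: carrier_group_homology)
      \<comment> \<open>The class is lifted to a singular cycle of \<open>W\<close>, which is
        homologous to the image of a cycle of \<open>M\<close>; the edges of the latter give the
        preimage.\<close>
      obtain c' where c': "singular_relcycle n W {} c'" "edge_chain (path_class W w0) n c' = z"
        using bar_cycle_lift[OF W n z(1)] by blast
      have "homologous_rel_set n W {} c' \<in> hom_induced (int n) M {} W {} i ` carrier (homology_group n M)"
        using epi c'(1) by (auto simp: epi_def carrier_relative_homology_group)
      then obtain c where c: "singular_relcycle n M {} c"
        "homologous_rel_set n W {} c' = homologous_rel_set n W {} (chain_map n i c)"
        by (auto simp: carrier_relative_homology_group ind)
      then have "y = ?H n (bar_class n ?A (edge_chain (path_class M m0) n c))"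
        unfolding H[OF c(1)] z(2) c'(2)[symmetric]
        by (intro bar_class_edge_chain_eq[OF wW]) (simp add: homologous_rel_set_eq)
      then show "y \<in> ?H n ` carrier (group_homology n ?A)"
        using edge_chain_cycle[OF wM c(1)] by (auto simp: carrier_group_homology)
    qed
    moreover have "?H n \<in> hom (group_homology n ?A) (group_homology n ?B)"
      by (rule group_homology_map_hom[OF hom])
    ultimately show ?thesis by (auto simp: epi_def hom_def)
  qed
  have "inj_on (?H 1) (carrier (group_homology 1 ?A))"
  proof (rule inj_onI)
    fix x x' assume x: "x \<in> carrier (group_homology 1 ?A)" "x' \<in> carrier (group_homology 1 ?A)" and eq: "?H 1 x = ?H 1 x'"
    have lift: "\<exists>c. singular_relcycle 1 M {} c \<and> x = bar_class 1 ?A (edge_chain (path_class M m0) 1 c)"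
      if x: "x \<in> carrier (group_homology 1 ?A)" for x
      using that bar_cycle_lift[OF M, of 1] by (auto simp: carrier_group_homology)
    obtain c c' where c: "singular_relcycle 1 M {} c" "x = bar_class 1 ?A (edge_chain (path_class M m0) 1 c)"
      and c': "singular_relcycle 1 M {} c'" "x' = bar_class 1 ?A (edge_chain (path_class M m0) 1 c')"
      using lift[OF x(1)] lift[OF x(2)] by auto
    let ?d = "c - c'"
    have d: "singular_relcycle 1 M {} ?d" using c c' by (simp add: singular_relcycle_diff)
    \<comment> \<open>Trivial in the group of \<open>W\<close> means null-homologous in
      \<open>W\<close> by the Hurewicz argument; the isomorphism on H_1 then leads back to
      \<open>M\<close>.\<close>
    have "edge_chain (path_class W w0) 1 (chain_map 1 i ?d) \<in> bar_boundaries 1 ?B"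
      using eq unfolding c(2) c'(2) H[OF c(1)] H[OF c'(1)] by (simp add: bar_class_eq_iff chain_map_diff)
    then have "singular_relboundary 1 W {} (chain_map 1 i ?d)"
      using singular_relcycle_chain_map[OF d i] by (intro singular_boundary_of_edge_boundary[OF W]) auto
    then have "homologous_rel 1 W {} (chain_map 1 i c) (chain_map 1 i c')"
      by (simp add: homologous_rel_def chain_map_diff)
    then have "hom_induced 1 M {} W {} i (homologous_rel_set 1 M {} c) = hom_induced 1 M {} W {} i (homologous_rel_set 1 M {} c')"
      using ind[OF c(1)] ind[OF c'(1)] by (simp add: homologous_rel_set_eq)
    moreover have "homologous_rel_set 1 M {} c \<in> carrier (homology_group 1 M)" "homologous_rel_set 1 M {} c' \<in> carrier (homology_group 1 M)"
      using c(1) c'(1) carrier_relative_homology_group[of 1 M "{}"] by auto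
    ultimately have "homologous_rel_set 1 M {} c = homologous_rel_set 1 M {} c'"
      using iso by (auto simp: iso_def bij_betw_def dest: inj_onD)
    then show "x = x'"
      unfolding c(2) c'(2) by (intro bar_class_edge_chain_eq[OF wM]) (simp add: homologous_rel_set_eq)
  qed
  moreover have "?H 1 \<in> epi (group_homology 1 ?A) (group_homology 1 ?B)"
    using surj[of 1] iso by (auto simp: epi_def iso_def bij_betw_def)
  ultimately have "?H 1 \<in> iso (group_homology 1 ?A) (group_homology 1 ?B)"
    by (auto simp: epi_def iso_def bij_betw_def)
  then show ?thesis
    using surj[of 2] epi hom by (simp add: two_connected_def)
qed

section \<open>Finitely presented groups\<close>

lemma group_hom_values:
  assumes "group G" "group H" "f \<in> hom G H"
  shows "f \<one>\<^bsub>G\<^esub> = \<one>\<^bsub>H\<^esub>" "x \<in> carrier G \<Longrightarrow> f (inv\<^bsub>G\<^esub> x) = inv\<^bsub>H\<^esub> f x" "x \<in> carrier G \<Longrightarrow> f x \<in> carrier H"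
proof -
  interpret group_hom G H f using assms by (simp add: group_hom_def group_hom_axioms_def)
  show "f \<one>\<^bsub>G\<^esub> = \<one>\<^bsub>H\<^esub>" "x \<in> carrier G \<Longrightarrow> f (inv\<^bsub>G\<^esub> x) = inv\<^bsub>H\<^esub> f x" "x \<in> carrier G \<Longrightarrow> f x \<in> carrier H"
    by simp_all
qed

text \<open>Transport of structure, used to place groups on \<open>nat\<close> or on the test type
  of \<open>homology_localization\<close>.\<close>

lemma image_group_isomorphisms:
  assumes "group G" "inj_on f (carrier G)"
  shows "group_isomorphisms G (image_group f G) f (inv_into (carrier G) f)" "group (image_group f G)"
proof -
  interpret group G by fact
  note inv = inv_into_f_f[OF assms(2)]
  have iso: "group_isomorphisms G (image_group f G) f (inv_into (carrier G) f)"
    unfolding group_isomorphisms_def hom_def image_group_def by (auto simp: inv)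
  then show "group_isomorphisms G (image_group f G) f (inv_into (carrier G) f)" .
  have "monoid (image_group f G)"
    by (rule monoidI) (auto simp: image_group_def inv m_assoc)
  moreover have "G \<cong> image_group f G"
    using group_isomorphisms_imp_iso[OF iso] by (rule is_isoI)
  ultimately show "group (image_group f G)" using iso_imp_group by blast
qed

section \<open>Words and presented groups\<close>

definition word_inverse :: "gen_word \<Rightarrow> gen_word" where
  "word_inverse u = rev (map (\<lambda>(b, i). (\<not> b, i)) u)"

lemma gen_words_simps [simp]:
  "[] \<in> gen_words n"
  "x # u \<in> gen_words n \<longleftrightarrow> snd x < n \<and> u \<in> gen_words n"
  "u @ v \<in> gen_words n \<longleftrightarrow> u \<in> gen_words n \<and> v \<in> gen_words n"
  "word_inverse u \<in> gen_words n \<longleftrightarrow> u \<in> gen_words n"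
  by (cases x; auto simp: gen_words_def lists_eq_set word_inverse_def)+

lemma presentation_eq_append:
  assumes "presentation_eq R u v"
  shows "presentation_eq R (a @ u @ b) (a @ v @ b)"
  using assms
proof (induction rule: presentation_eq.induct)
  case (cancel u c i v)
  then show ?case using presentation_eq.cancel[of R "a @ u" c i "v @ b"] by simp
next
  case (relator s u v)
  then show ?case using presentation_eq.relator[of s R "a @ u" "v @ b"] by simp
qed (blast intro: presentation_eq.intros)+

lemma presentation_eq_append2:
  assumes "presentation_eq R u u'" "presentation_eq R v v'"
  shows "presentation_eq R (u @ v) (u' @ v')"
  using presentation_eq_append[OF assms(1), of "[]" v] presentation_eq_append[OF assms(2), of u' "[]"]
  by (auto intro: presentation_eq.trans)

lemma presentation_eq_word_inverse: "presentation_eq R (word_inverse u @ u) []"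
proof (induction u)
  case (Cons x u)
  obtain b i where x: "x = (b, i)" by (cases x)
  have "presentation_eq R (word_inverse u @ [(\<not> b, i), (b, i)] @ u) (word_inverse u @ u)"
    using presentation_eq.cancel[of R "word_inverse u" "\<not> b" i u] by simp
  then show ?case using Cons by (auto simp: word_inverse_def x intro: presentation_eq.trans)
qed (simp add: word_inverse_def presentation_eq.refl)

lemma presentation_class_eq_iff:
  assumes "v \<in> gen_words n"
  shows "presentation_class n R u = presentation_class n R v \<longleftrightarrow> presentation_eq R u v"
proof
  assume "presentation_class n R u = presentation_class n R v"
  then have "v \<in> presentation_class n R u"
    using assms by (simp add: presentation_class_def presentation_eq.refl)
  then show "presentation_eq R u v" by (simp add: presentation_class_def)
qed (auto simp: presentation_class_def intro: presentation_eq.sym presentation_eq.trans)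

lemma carrier_presented_group: "carrier (presented_group n R) = presentation_class n R ` gen_words n"
  by (simp add: presented_group_def)

lemma one_presented_group: "\<one>\<^bsub>presented_group n R\<^esub> = presentation_class n R []"
  by (simp add: presented_group_def)

lemma mult_presented_group:
  assumes "u \<in> gen_words n" "v \<in> gen_words n"
  shows "presentation_class n R u \<otimes>\<^bsub>presented_group n R\<^esub> presentation_class n R v = presentation_class n R (u @ v)"
proof -
  have "presentation_class n R (u' @ v') = presentation_class n R (u @ v)"
    if "u' \<in> presentation_class n R u" "v' \<in> presentation_class n R v" for u' v'
    using that assms
    by (subst presentation_class_eq_iff)
       (auto simp: presentation_class_def intro: presentation_eq_append2 presentation_eq.sym)
  moreover have "u \<in> presentation_class n R u" "v \<in> presentation_class n R v"
    using assms by (simp_all add: presentation_class_def presentation_eq.refl)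
  ultimately have "(\<Union>u'\<in>presentation_class n R u. \<Union>v'\<in>presentation_class n R v. presentation_class n R (u' @ v'))
      = presentation_class n R (u @ v)"
    by (intro SUP_eq_const) blast+
  then show ?thesis by (simp add: presented_group_def)
qed

lemma group_presented_group: "group (presented_group n R)"
proof (rule groupI)
  fix A assume "A \<in> carrier (presented_group n R)"
  then obtain u where u: "u \<in> gen_words n" "A = presentation_class n R u"
    by (auto simp: carrier_presented_group)
  then have "presentation_class n R (word_inverse u) \<otimes>\<^bsub>presented_group n R\<^esub> A = \<one>\<^bsub>presented_group n R\<^esub>"
    by (simp add: mult_presented_group one_presented_group presentation_class_eq_iff presentation_eq_word_inverse)
  then show "\<exists>B\<in>carrier (presented_group n R). B \<otimes>\<^bsub>presented_group n R\<^esub> A = \<one>\<^bsub>presented_group n R\<^esub>"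
    using u by (auto simp: carrier_presented_group)
qed (auto simp: carrier_presented_group one_presented_group mult_presented_group)

definition presented_gen :: "nat \<Rightarrow> gen_word set \<Rightarrow> nat \<Rightarrow> gen_word set" where
  "presented_gen n R i = presentation_class n R [(True, i)]"

lemma presented_gen_carrier: "i < n \<Longrightarrow> presented_gen n R i \<in> carrier (presented_group n R)"
  by (auto simp: presented_gen_def carrier_presented_group)

fun word_eval :: "('h, 'b) monoid_scheme \<Rightarrow> (nat \<Rightarrow> 'h) \<Rightarrow> gen_word \<Rightarrow> 'h" where
  "word_eval H \<phi> [] = \<one>\<^bsub>H\<^esub>"
| "word_eval H \<phi> ((b, i) # u) = (if b then \<phi> i else inv\<^bsub>H\<^esub> \<phi> i) \<otimes>\<^bsub>H\<^esub> word_eval H \<phi> u"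

lemma word_eval_cong:
  "u \<in> gen_words n \<Longrightarrow> (\<And>i. i < n \<Longrightarrow> \<phi> i = \<psi> i) \<Longrightarrow> word_eval H \<phi> u = word_eval H \<psi> u"
  by (induction H \<phi> u rule: word_eval.induct) auto

context
  fixes H :: "('h, 'b) monoid_scheme" (structure) and \<phi> :: "nat \<Rightarrow> 'h"
  assumes H: "group H" and \<phi>: "\<And>i. \<phi> i \<in> carrier H"
begin

interpretation group H by (rule H)

lemma word_eval_closed: "word_eval H \<phi> u \<in> carrier H"
proof (induction u)
  case (Cons x u)
  then show ?case by (cases x) (use \<phi> in auto)
qed simp

lemma word_eval_append: "word_eval H \<phi> (u @ v) = word_eval H \<phi> u \<otimes> word_eval H \<phi> v"
proof (induction u)
  case (Cons x u)
  then show ?case by (cases x) (use \<phi> word_eval_closed in \<open>simp add: m_assoc\<close>)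
qed (use word_eval_closed in simp)

lemma word_eval_presentation_eq:
  assumes "presentation_eq R u v" "\<And>s. s \<in> R \<Longrightarrow> word_eval H \<phi> s = \<one>"
  shows "word_eval H \<phi> u = word_eval H \<phi> v"
  using assms(1)
proof (induction rule: presentation_eq.induct)
  case (cancel u b i v)
  have "word_eval H \<phi> [(b, i), (\<not> b, i)] = \<one>" using \<phi> by simp
  then show ?case by (simp only: word_eval_append) (simp add: word_eval_closed)
next
  case (relator s u v)
  then show ?case by (simp only: word_eval_append assms(2)) (simp add: word_eval_closed)
qed auto

end

lemma presented_group_hom_exists:
  assumes H: "group H" and \<phi>: "\<And>i. i < n \<Longrightarrow> \<phi> i \<in> carrier H"
    and R: "R \<subseteq> gen_words n" "\<And>s. s \<in> R \<Longrightarrow> word_eval H \<phi> s = \<one>\<^bsub>H\<^esub>"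
  shows "\<exists>f\<in>hom (presented_group n R) H. \<forall>u\<in>gen_words n. f (presentation_class n R u) = word_eval H \<phi> u"
proof -
  interpret group H by (rule H)
  \<comment> \<open>A derivation of \<open>presentation_eq\<close> may insert and cancel letters
    with index at least \<open>n\<close>. They get the value one, so that evaluation stays in
    \<open>H\<close> along the whole derivation.\<close>
  define \<psi> where "\<psi> i = (if i < n then \<phi> i else \<one>\<^bsub>H\<^esub>)" for i
  have \<psi>: "\<psi> i \<in> carrier H" for i using \<phi> by (simp add: \<psi>_def)
  have eq: "word_eval H \<phi> u = word_eval H \<psi> u" if "u \<in> gen_words n" for u
    using that by (rule word_eval_cong) (simp add: \<psi>_def)
  define f where "f A = word_eval H \<psi> (SOME u. u \<in> A)" for A
  have f: "f (presentation_class n R u) = word_eval H \<psi> u" if "u \<in> gen_words n" for u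
  proof -
    have "(SOME v. v \<in> presentation_class n R u) \<in> presentation_class n R u"
      using someI[of "\<lambda>v. v \<in> presentation_class n R u" u] that
      by (simp add: presentation_class_def presentation_eq.refl)
    then have "presentation_eq R u (SOME v. v \<in> presentation_class n R u)"
      by (simp add: presentation_class_def)
    from word_eval_presentation_eq[where \<phi> = \<psi>, OF H \<psi> this] R eq show ?thesis
      by (auto simp: f_def subset_iff)
  qed
  have "f \<in> hom (presented_group n R) H"
    by (rule homI)
       (auto simp: carrier_presented_group f mult_presented_group word_eval_append[where \<phi> = \<psi>, OF H \<psi>] word_eval_closed[where \<phi> = \<psi>, OF H \<psi>])
  then show ?thesis using f eq by (intro bexI[of _ f]) auto
qed

lemma presented_group_hom_eval:
  assumes H: "group H" and f: "f \<in> hom (presented_group n R) H" and u: "u \<in> gen_words n"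
  shows "f (presentation_class n R u) = word_eval H (\<lambda>i. f (presented_gen n R i)) u"
  using u
proof (induction u)
  case Nil
  then show ?case
    using group_hom_values(1)[OF group_presented_group H f] by (simp add: one_presented_group)
next
  case (Cons x u)
  obtain b i where x: "x = (b, i)" by (cases x)
  interpret P: group "presented_group n R" by (rule group_presented_group)
  have i: "i < n" and u: "u \<in> gen_words n" using Cons x by auto
  have "f (presentation_class n R (x # u)) = f (presentation_class n R [x] \<otimes>\<^bsub>presented_group n R\<^esub> presentation_class n R u)"
    using Cons.prems by (simp add: mult_presented_group)
  also have "\<dots> = f (presentation_class n R [x]) \<otimes>\<^bsub>H\<^esub> f (presentation_class n R u)"
    using i u by (intro hom_mult[OF f]) (auto simp: carrier_presented_group x)
  also have "f (presentation_class n R [x]) = (if b then f (presented_gen n R i) else inv\<^bsub>H\<^esub> f (presented_gen n R i))"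
  proof (cases b)
    case False
    have "presentation_class n R [(False, i)] \<otimes>\<^bsub>presented_group n R\<^esub> presented_gen n R i = \<one>\<^bsub>presented_group n R\<^esub>"
      using i presentation_eq.cancel[of R "[]" False i "[]"]
      by (simp add: presented_gen_def mult_presented_group one_presented_group presentation_class_eq_iff)
    then have "presentation_class n R [(False, i)] = inv\<^bsub>presented_group n R\<^esub> presented_gen n R i"
      using i presented_gen_carrier by (intro P.inv_equality[symmetric]) (auto simp: carrier_presented_group)
    then show ?thesis
      using False group_hom_values(2)[OF group_presented_group H f presented_gen_carrier[OF i]] x by simp
  qed (simp add: x presented_gen_def)
  finally show ?case using Cons.IH[OF u] by (simp add: x)
qed

lemma presented_group_hom_eqI:
  assumes H: "group H" and f: "f \<in> hom (presented_group n R) H" and g: "g \<in> hom (presented_group n R) H"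
    and eq: "\<And>i. i < n \<Longrightarrow> f (presented_gen n R i) = g (presented_gen n R i)"
    and x: "x \<in> carrier (presented_group n R)"
  shows "f x = g x"
proof -
  obtain u where u: "u \<in> gen_words n" "x = presentation_class n R u" using x by (auto simp: carrier_presented_group)
  have "word_eval H (\<lambda>i. f (presented_gen n R i)) u = word_eval H (\<lambda>i. g (presented_gen n R i)) u"
    by (rule word_eval_cong[OF u(1)]) (use eq in auto)
  then show ?thesis
    using presented_group_hom_eval[OF H f u(1)] presented_group_hom_eval[OF H g u(1)] u(2) by simp
qed

lemma word_eval_presented_gen:
  assumes "u \<in> gen_words n"
  shows "word_eval (presented_group n R) (presented_gen n R) u = presentation_class n R u"
proof -
  have "(\<lambda>x. x) \<in> hom (presented_group n R) (presented_group n R)" by (simp add: hom_def)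
  from presented_group_hom_eval[OF group_presented_group this assms] show ?thesis by simp
qed

lemma finitely_presented_group: "finitely_presented G \<Longrightarrow> group G"
  by (simp add: finitely_presented_def)

lemma finitely_presented_presented_group:
  "finite R \<Longrightarrow> R \<subseteq> gen_words n \<Longrightarrow> finitely_presented (presented_group n R)"
  unfolding finitely_presented_def using group_presented_group iso_refl by blast

lemma finitely_presented_iso:
  assumes "finitely_presented G" "group H" "G \<cong> H"
  shows "finitely_presented H"
  using assms group.iso_sym[of G H] iso_trans by (auto simp: finitely_presented_def) blast

lemma countable_gen_words: "countable (gen_words n)"
  unfolding gen_words_def by (rule countable_lists) simp

lemma finitely_presented_countable:
  assumes "finitely_presented G"
  shows "countable (carrier G)"
proof -
  obtain n R where "G \<cong> presented_group n R" and G: "group G"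
    using assms by (auto simp: finitely_presented_def)
  then obtain h where "h \<in> iso G (presented_group n R)" by (auto simp: is_iso_def)
  then have "bij_betw h (carrier G) (presentation_class n R ` gen_words n)"
    by (auto simp: iso_def carrier_presented_group)
  then show ?thesis
    using countable_gen_words by (metis bij_betw_imp_inj_on bij_betw_imp_surj_on countable_image countable_image_inj_on)
qed

text \<open>Add the relations identifying each generator with its image under the retraction.\<close>

lemma finitely_presented_retract:
  assumes G: "group G" and R: "finite R" "R \<subseteq> gen_words n"
    and \<iota>: "\<iota> \<in> hom G (presented_group n R)" and \<rho>: "\<rho> \<in> hom (presented_group n R) G"
    and id: "\<And>g. g \<in> carrier G \<Longrightarrow> \<rho> (\<iota> g) = g"
  shows "finitely_presented G"
proof -
  interpret group G by (rule G)
  let ?P = "presented_group n R"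
  let ?gen = "presented_gen n R"
  have gen: "?gen i \<in> carrier ?P" if "i < n" for i using presented_gen_carrier[OF that] .
  have \<rho>gen: "\<rho> (?gen i) \<in> carrier G" if "i < n" for i using gen[OF that] \<rho> by (auto simp: hom_def)
  have "\<exists>v. \<forall>i\<in>{..<n}. v i \<in> gen_words n \<and> \<iota> (\<rho> (?gen i)) = presentation_class n R (v i)"
  proof (intro bchoice ballI)
    fix i assume "i \<in> {..<n}"
    then have "\<iota> (\<rho> (?gen i)) \<in> carrier ?P" using \<rho>gen \<iota> by (auto simp: hom_def)
    then show "\<exists>v. v \<in> gen_words n \<and> \<iota> (\<rho> (?gen i)) = presentation_class n R v"
      by (auto simp: carrier_presented_group)
  qed
  then obtain v where v: "\<And>i. i < n \<Longrightarrow> v i \<in> gen_words n" "\<And>i. i < n \<Longrightarrow> \<iota> (\<rho> (?gen i)) = presentation_class n R (v i)"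
    by auto
  \<comment> \<open>The word \<open>v i\<close> represents the image of generator \<open>i\<close>
    under \<open>\<iota> \<circ> \<rho>\<close>; the new relator, the inverse letter followed by
    \<open>v i\<close>, makes that image equal to the generator.\<close>
  define R' where "R' = R \<union> (\<lambda>i. (False, i) # v i) ` {..<n}"
  have R': "finite R'" "R' \<subseteq> gen_words n" using R v by (auto simp: R'_def)
  let ?Q = "presented_group n R'" and ?gen' = "presented_gen n R'"
  have \<rho>eval: "word_eval G (\<lambda>i. \<rho> (?gen i)) u = \<rho> (presentation_class n R u)" if "u \<in> gen_words n" for u
    using presented_group_hom_eval[OF G \<rho> that] by simp
  have "word_eval G (\<lambda>i. \<rho> (?gen i)) s = \<one>\<^bsub>G\<^esub>" if s: "s \<in> R'" for s
  proof (cases "s \<in> R")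
    case True
    then have "presentation_class n R s = \<one>\<^bsub>?P\<^esub>"
      using R presentation_eq.relator[of s R "[]" "[]"] by (simp add: one_presented_group presentation_class_eq_iff)
    then show ?thesis using True R \<rho>eval group_hom_values(1)[OF group_presented_group G \<rho>] by auto
  next
    case False
    then obtain i where i: "i < n" "s = (False, i) # v i" using s by (auto simp: R'_def)
    have "word_eval G (\<lambda>i. \<rho> (?gen i)) (v i) = \<rho> (?gen i)"
      using \<rho>eval[OF v(1)[OF i(1)]] v(2)[OF i(1)] id[OF \<rho>gen[OF i(1)]] by simp
    then show ?thesis using i \<rho>gen by simp
  qed
  from presented_group_hom_exists[where \<phi> = "\<lambda>i. \<rho> (?gen i)", OF G \<rho>gen R'(2) this]
  obtain \<rho>' where \<rho>': "\<rho>' \<in> hom ?Q G"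
    "\<And>u. u \<in> gen_words n \<Longrightarrow> \<rho>' (presentation_class n R' u) = word_eval G (\<lambda>i. \<rho> (?gen i)) u"
    by auto
  have "word_eval ?Q ?gen' s = \<one>\<^bsub>?Q\<^esub>" if "s \<in> R" for s
    using that R presentation_eq.relator[of s R' "[]" "[]"]
    by (subst word_eval_presented_gen) (auto simp: one_presented_group presentation_class_eq_iff R'_def)
  from presented_group_hom_exists[where \<phi> = ?gen', OF group_presented_group presented_gen_carrier R(2) this]
  obtain \<pi> where \<pi>: "\<pi> \<in> hom ?P ?Q" "\<And>u. u \<in> gen_words n \<Longrightarrow> \<pi> (presentation_class n R u) = presentation_class n R' u"
    using word_eval_presented_gen by auto
  have \<rho>'\<pi>: "\<rho>' (\<pi> x) = \<rho> x" if "x \<in> carrier ?P" for x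
    using that \<rho>'(2) \<pi>(2) \<rho>eval by (auto simp: carrier_presented_group)
  have "\<pi> (\<iota> (\<rho>' x)) = x" if "x \<in> carrier ?Q" for x
  proof (rule presented_group_hom_eqI[OF group_presented_group _ _ _ that])
    have "\<pi> \<circ> \<iota> \<circ> \<rho>' \<in> hom ?Q ?Q" using Group.hom_compose[OF \<rho>'(1) Group.hom_compose[OF \<iota> \<pi>(1)]] .
    then show "(\<lambda>x. \<pi> (\<iota> (\<rho>' x))) \<in> hom ?Q ?Q" by (simp add: o_def)
    show "(\<lambda>x. x) \<in> hom ?Q ?Q" by (simp add: hom_def)
    fix i assume i: "i < n"
    have "\<rho>' (?gen' i) = \<rho> (?gen i)"
      using \<rho>'(2)[of "[(True, i)]"] \<rho>gen[OF i] i by (simp add: presented_gen_def)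
    then have "\<pi> (\<iota> (\<rho>' (?gen' i))) = presentation_class n R' (v i)"
      using v[OF i] \<pi>(2) by simp
    also have "presentation_eq R' ([(True, i)] @ ((False, i) # v i) @ []) ([(True, i)] @ [])"
      by (rule presentation_eq.relator) (use i in \<open>auto simp: R'_def\<close>)
    then have "presentation_eq R' (v i) [(True, i)]"
      using presentation_eq.cancel[of R' "[]" True i "v i"] by (auto intro: presentation_eq.sym presentation_eq.trans)
    then have "presentation_class n R' (v i) = ?gen' i"
      using i by (simp add: presented_gen_def presentation_class_eq_iff)
    finally show "\<pi> (\<iota> (\<rho>' (?gen' i))) = ?gen' i" .
  qed
  moreover have "\<rho>' (\<pi> (\<iota> g)) = g" if "g \<in> carrier G" for g
    using \<rho>'\<pi>[of "\<iota> g"] id[OF that] \<iota> that by (auto simp: hom_def)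
  moreover have "\<pi> \<circ> \<iota> \<in> hom G ?Q" using Group.hom_compose[OF \<iota> \<pi>(1)] .
  ultimately have "group_isomorphisms G ?Q (\<pi> \<circ> \<iota>) \<rho>'" using \<rho>'(1) by (simp add: group_isomorphisms_def)
  then have "G \<cong> ?Q" using group_isomorphisms_imp_iso is_isoI by blast
  then show ?thesis using G R' by (auto simp: finitely_presented_def)
qed

text \<open>Elements of a fundamental group are sets of paths, while locality is tested on groups
  with carrier in \<open>nat\<close>; countability provides the copy.\<close>

lemma finitely_presented_nat_copy:
  assumes "finitely_presented G"
  obtains G' :: "nat monoid" and a b where "finitely_presented G'" "group_isomorphisms G G' a b"
proof -
  have G: "group G" using assms by (rule finitely_presented_group)
  let ?f = "to_nat_on (carrier G)"
  have "inj_on ?f (carrier G)" using finitely_presented_countable[OF assms] by (rule inj_on_to_nat_on)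
  note iso = image_group_isomorphisms[OF G this]
  have "finitely_presented (image_group ?f G)"
    using finitely_presented_iso[OF assms iso(2)] group_isomorphisms_imp_iso[OF iso(1)] is_isoI by blast
  then show ?thesis using that iso(1) by blast
qed

section \<open>Local groups and localization\<close>

lemma two_connected_iff:
  assumes "\<alpha> \<in> hom A B"
  shows "two_connected A B \<alpha> \<longleftrightarrow>
    bij_betw (group_homology_map 1 B \<alpha>) (carrier (group_homology 1 A)) (carrier (group_homology 1 B)) \<and>
    group_homology_map 2 B \<alpha> ` carrier (group_homology 2 A) = carrier (group_homology 2 B)"
  using assms group_homology_map_hom[OF assms] by (simp add: two_connected_def iso_def epi_def)

text \<open>Lets a two-connected map be replaced by its restriction to the carrier, so that maps
  with the same values become equal and can be counted.\<close>

lemma two_connected_cong: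
  assumes "two_connected A B \<alpha>" "\<alpha>' \<in> hom A B" "\<And>a. a \<in> carrier A \<Longrightarrow> \<alpha>' a = \<alpha> a"
  shows "two_connected A B \<alpha>'"
proof -
  have \<alpha>: "\<alpha> \<in> hom A B" using assms(1) by (simp add: two_connected_def)
  have eq: "group_homology_map n B \<alpha>' x = group_homology_map n B \<alpha> x" if "x \<in> carrier (group_homology n A)" for n x
    using group_homology_map_cong[OF assms(2) \<alpha> assms(3) that] .
  have "bij_betw (group_homology_map 1 B \<alpha>') (carrier (group_homology 1 A)) (carrier (group_homology 1 B)) \<longleftrightarrow>
      bij_betw (group_homology_map 1 B \<alpha>) (carrier (group_homology 1 A)) (carrier (group_homology 1 B))"
    by (rule bij_betw_cong) (rule eq)
  moreover have "group_homology_map 2 B \<alpha>' ` carrier (group_homology 2 A) = group_homology_map 2 B \<alpha> ` carrier (group_homology 2 A)"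
    by (rule image_cong[OF HOL.refl]) (rule eq)
  ultimately show ?thesis
    using assms(1) unfolding two_connected_iff[OF \<alpha>] two_connected_iff[OF assms(2)] by argo
qed

lemma two_connected_compose:
  assumes "two_connected A B \<alpha>" "two_connected B C \<beta>"
  shows "two_connected A C (\<beta> \<circ> \<alpha>)"
proof -
  have \<alpha>: "\<alpha> \<in> hom A B" and \<beta>: "\<beta> \<in> hom B C" using assms by (simp_all add: two_connected_def)
  have comp: "group_homology_map n C (\<beta> \<circ> \<alpha>) x = (group_homology_map n C \<beta> \<circ> group_homology_map n B \<alpha>) x"
    if "x \<in> carrier (group_homology n A)" for n x
    using group_homology_map_compose[OF \<alpha> \<beta> that] by simp
  have 1: "bij_betw (group_homology_map 1 C \<beta> \<circ> group_homology_map 1 B \<alpha>) (carrier (group_homology 1 A)) (carrier (group_homology 1 C))"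
    using assms by (intro bij_betw_trans) (auto simp: two_connected_iff \<alpha> \<beta>)
  have 2: "(group_homology_map 2 C \<beta> \<circ> group_homology_map 2 B \<alpha>) ` carrier (group_homology 2 A) = carrier (group_homology 2 C)"
    using assms unfolding image_comp[symmetric] by (simp add: two_connected_iff \<alpha> \<beta>)
  have "bij_betw (group_homology_map 1 C (\<beta> \<circ> \<alpha>)) (carrier (group_homology 1 A)) (carrier (group_homology 1 C))"
    using bij_betw_cong[THEN iffD2, OF _ 1] comp by blast
  moreover have "group_homology_map 2 C (\<beta> \<circ> \<alpha>) ` carrier (group_homology 2 A) = carrier (group_homology 2 C)"
    unfolding 2[symmetric] by (rule image_cong[OF HOL.refl]) (rule comp)
  ultimately show ?thesis
    unfolding two_connected_iff[OF Group.hom_compose[OF \<alpha> \<beta>]] by blast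
qed

lemma two_connected_iso:
  assumes "group_isomorphisms A B h k"
  shows "two_connected A B h"
proof -
  have h: "h \<in> hom A B" and k: "k \<in> hom B A" using assms by (simp_all add: group_isomorphisms_def)
  have kh: "group_homology_map n A k (group_homology_map n B h x) = x" if "x \<in> carrier (group_homology n A)" for n x
    using assms unfolding group_homology_map_compose[OF h k that]
    by (intro group_homology_map_id[OF Group.hom_compose[OF h k] _ that]) (simp add: group_isomorphisms_def)
  have hk: "group_homology_map n B h (group_homology_map n A k x) = x" if "x \<in> carrier (group_homology n B)" for n x
    using assms unfolding group_homology_map_compose[OF k h that]
    by (intro group_homology_map_id[OF Group.hom_compose[OF k h] _ that]) (simp add: group_isomorphisms_def)
  have "group_isomorphisms (group_homology n A) (group_homology n B) (group_homology_map n B h) (group_homology_map n A k)" for n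
    using kh hk group_homology_map_hom[OF h] group_homology_map_hom[OF k] by (simp add: group_isomorphisms_def)
  from group_isomorphisms_imp_iso[OF this]
  show ?thesis by (auto simp: two_connected_iff[OF h] iso_def bij_betw_def)
qed

text \<open>Existence and uniqueness on the carrier, with no extensionality demanded of
  \<open>g\<close>, so that composites of homomorphisms can be used as they are;
  \<open>unique_extension_iff\<close> is the bridge to the given definitions.\<close>

definition unique_extension :: "('a, 'r) monoid_scheme \<Rightarrow> ('b, 's) monoid_scheme \<Rightarrow> ('l, 't) monoid_scheme \<Rightarrow> ('a \<Rightarrow> 'b) \<Rightarrow> ('a \<Rightarrow> 'l) \<Rightarrow> bool" where
  "unique_extension A B L \<alpha> f \<longleftrightarrow>
     (\<exists>g\<in>hom B L. \<forall>a\<in>carrier A. g (\<alpha> a) = f a) \<and>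
     (\<forall>g\<in>hom B L. \<forall>g'\<in>hom B L. (\<forall>a\<in>carrier A. g (\<alpha> a) = f a) \<longrightarrow> (\<forall>a\<in>carrier A. g' (\<alpha> a) = f a) \<longrightarrow>
        (\<forall>b\<in>carrier B. g b = g' b))"

lemma unique_extension_iff:
  assumes B: "group B" and \<alpha>: "\<alpha> ` carrier A \<subseteq> carrier B"
  shows "unique_extension A B L \<alpha> f \<longleftrightarrow>
    (\<exists>!g. g \<in> hom B L \<inter> extensional (carrier B) \<and> (\<forall>a\<in>carrier A. g (\<alpha> a) = f a))"
proof
  have rest: "restrict g (carrier B) \<in> hom B L \<inter> extensional (carrier B)" if "g \<in> hom B L" for g
    using group.hom_eq[OF B that, of "restrict g (carrier B)"] by simp
  have val: "restrict g (carrier B) (\<alpha> a) = g (\<alpha> a)" if "a \<in> carrier A" for g a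
    using \<alpha> that by auto
  {
    assume u: "unique_extension A B L \<alpha> f"
    then obtain g where g: "g \<in> hom B L" "\<forall>a\<in>carrier A. g (\<alpha> a) = f a"
      by (auto simp: unique_extension_def)
    show "\<exists>!g. g \<in> hom B L \<inter> extensional (carrier B) \<and> (\<forall>a\<in>carrier A. g (\<alpha> a) = f a)"
    proof (rule ex1I[of _ "restrict g (carrier B)"])
      show "restrict g (carrier B) \<in> hom B L \<inter> extensional (carrier B) \<and> (\<forall>a\<in>carrier A. restrict g (carrier B) (\<alpha> a) = f a)"
        using rest[OF g(1)] g(2) val[of _ g] by (auto simp del: restrict_apply)
      show "g' = restrict g (carrier B)" if "g' \<in> hom B L \<inter> extensional (carrier B) \<and> (\<forall>a\<in>carrier A. g' (\<alpha> a) = f a)" for g'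
        using u that g unfolding unique_extension_def
        by (intro extensionalityI[of _ "carrier B"]) auto
    qed
  }
  {
    assume ex1: "\<exists>!g. g \<in> hom B L \<inter> extensional (carrier B) \<and> (\<forall>a\<in>carrier A. g (\<alpha> a) = f a)"
    have "g b = g' b" if "g \<in> hom B L" "g' \<in> hom B L" "\<forall>a\<in>carrier A. g (\<alpha> a) = f a" "\<forall>a\<in>carrier A. g' (\<alpha> a) = f a" "b \<in> carrier B" for g g' b
    proof -
      have "restrict g (carrier B) = restrict g' (carrier B)"
        using ex1 rest[OF that(1)] rest[OF that(2)] val that(3,4) by (metis (no_types, lifting))
      then show ?thesis using that(5) by (metis restrict_apply')
    qed
    then show "unique_extension A B L \<alpha> f" using ex1 unfolding unique_extension_def by blast
  }
qed

lemma unique_extension_exists: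
  assumes "unique_extension A B L \<alpha> f"
  obtains g where "g \<in> hom B L" "\<And>a. a \<in> carrier A \<Longrightarrow> g (\<alpha> a) = f a"
  using assms unfolding unique_extension_def by blast

lemma unique_extension_unique:
  assumes "unique_extension A B L \<alpha> f" "g \<in> hom B L" "g' \<in> hom B L"
    "\<And>a. a \<in> carrier A \<Longrightarrow> g (\<alpha> a) = f a" "\<And>a. a \<in> carrier A \<Longrightarrow> g' (\<alpha> a) = f a" "b \<in> carrier B"
  shows "g b = g' b"
  using assms unfolding unique_extension_def by blast

lemma unique_extension_iso_target:
  assumes u: "unique_extension A B L \<alpha> (k \<circ> f)" and iso: "group_isomorphisms L L' h k" and B: "group B"
    and f: "f \<in> hom A L'" and \<alpha>: "\<alpha> ` carrier A \<subseteq> carrier B"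
  shows "unique_extension A B L' \<alpha> f"
  unfolding unique_extension_def
proof (intro conjI ballI impI)
  have h: "h \<in> hom L L'" and k: "k \<in> hom L' L" and kh: "\<And>x. x \<in> carrier L \<Longrightarrow> k (h x) = x" and hk: "\<And>y. y \<in> carrier L' \<Longrightarrow> h (k y) = y"
    using iso by (auto simp: group_isomorphisms_def)
  have fc: "f a \<in> carrier L'" if "a \<in> carrier A" for a using f that by (auto simp: hom_def)
  obtain g where g: "g \<in> hom B L" "\<And>a. a \<in> carrier A \<Longrightarrow> g (\<alpha> a) = (k \<circ> f) a"
    using unique_extension_exists[OF u] by blast
  show "\<exists>g\<in>hom B L'. \<forall>a\<in>carrier A. g (\<alpha> a) = f a"
    using g hk fc Group.hom_compose[OF g(1) h] by (intro bexI[of _ "h \<circ> g"]) auto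
  fix g g' b assume gs: "g \<in> hom B L'" "g' \<in> hom B L'" "\<forall>a\<in>carrier A. g (\<alpha> a) = f a" "\<forall>a\<in>carrier A. g' (\<alpha> a) = f a" "b \<in> carrier B"
  have "(k \<circ> g) b = (k \<circ> g') b"
    by (rule unique_extension_unique[OF u Group.hom_compose[OF gs(1) k] Group.hom_compose[OF gs(2) k]]) (use gs in auto)
  moreover have "g b \<in> carrier L'" "g' b \<in> carrier L'" using gs by (auto simp: hom_def)
  ultimately show "g b = g' b" using hk by (metis comp_apply)
qed

lemma local_group_iff:
  "local_group L \<longleftrightarrow> group L \<and>
     (\<forall>(A :: nat monoid) (B :: nat monoid) \<alpha> f.
        finitely_presented A \<and> finitely_presented B \<and> two_connected A B \<alpha> \<and> f \<in> hom A L \<longrightarrow> unique_extension A B L \<alpha> f)"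
proof -
  have "unique_extension A B L \<alpha> f \<longleftrightarrow> (\<exists>!g. g \<in> hom B L \<inter> extensional (carrier B) \<and> (\<forall>a\<in>carrier A. g (\<alpha> a) = f a))"
    if "finitely_presented B" "two_connected A B \<alpha>" for A B :: "nat monoid" and \<alpha> f
    using that by (intro unique_extension_iff finitely_presented_group) (auto simp: two_connected_def hom_def)
  then have "(finitely_presented A \<and> finitely_presented B \<and> two_connected A B \<alpha> \<and> f \<in> hom A L \<longrightarrow> unique_extension A B L \<alpha> f) \<longleftrightarrow>
     (finitely_presented A \<and> finitely_presented B \<and> two_connected A B \<alpha> \<and> f \<in> hom A L \<longrightarrow>
        (\<exists>!g. g \<in> hom B L \<inter> extensional (carrier B) \<and> (\<forall>a\<in>carrier A. g (\<alpha> a) = f a)))"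
    for A B :: "nat monoid" and \<alpha> f
    by simp
  then show ?thesis unfolding local_group_def by (simp only:)
qed

lemma local_group_group: "local_group L \<Longrightarrow> group L"
  by (simp add: local_group_def)

text \<open>\<open>local_group\<close> tests only groups on \<open>nat\<close>. The problem is moved
  to copies of \<open>A\<close> and \<open>B\<close> there, with \<open>\<alpha>\<close> conjugated
  by the copying isomorphisms, and its solution is moved back.\<close>

lemma local_group_extension:
  assumes L: "local_group L" and A: "finitely_presented A" and B: "finitely_presented B"
    and \<alpha>: "two_connected A B \<alpha>" and f: "f \<in> hom A L"
  shows "unique_extension A B L \<alpha> f"
proof -
  obtain A' :: "nat monoid" and a a' where A': "finitely_presented A'" and a: "group_isomorphisms A A' a a'"
    using finitely_presented_nat_copy[OF A] by blast
  obtain B' :: "nat monoid" and b b' where B': "finitely_presented B'" and b: "group_isomorphisms B B' b b'"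
    using finitely_presented_nat_copy[OF B] by blast
  have ha: "a \<in> hom A A'" "a' \<in> hom A' A" "\<And>x. x \<in> carrier A \<Longrightarrow> a' (a x) = x" "\<And>x. x \<in> carrier A' \<Longrightarrow> a (a' x) = x"
    "\<And>x. x \<in> carrier A \<Longrightarrow> a x \<in> carrier A'" "\<And>x. x \<in> carrier A' \<Longrightarrow> a' x \<in> carrier A"
    and hb: "b \<in> hom B B'" "b' \<in> hom B' B" "\<And>x. x \<in> carrier B \<Longrightarrow> b' (b x) = x" "\<And>x. x \<in> carrier B' \<Longrightarrow> b (b' x) = x"
    "\<And>x. x \<in> carrier B \<Longrightarrow> b x \<in> carrier B'" "\<And>x. x \<in> carrier B' \<Longrightarrow> b' x \<in> carrier B"
    using a b by (auto simp: group_isomorphisms_def hom_def)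
  have \<alpha>c: "\<alpha> x \<in> carrier B" if "x \<in> carrier A" for x using \<alpha> that by (auto simp: two_connected_def hom_def)
  have "two_connected A' B' (b \<circ> (\<alpha> \<circ> a'))"
    using two_connected_iso[OF b] two_connected_iso[OF group_isomorphisms_sym[OF a]] \<alpha>
    by (intro two_connected_compose)
  then have u: "unique_extension A' B' L (b \<circ> (\<alpha> \<circ> a')) (f \<circ> a')"
    using L A' B' Group.hom_compose[OF ha(2) f] unfolding local_group_iff by blast
  show ?thesis
    unfolding unique_extension_def
  proof (intro conjI ballI impI)
    obtain g where g: "g \<in> hom B' L" "\<And>x. x \<in> carrier A' \<Longrightarrow> g ((b \<circ> (\<alpha> \<circ> a')) x) = (f \<circ> a') x"
      using unique_extension_exists[OF u] by blast
    have "g (b (\<alpha> x)) = f x" if "x \<in> carrier A" for x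
      using g(2)[OF ha(5)[OF that]] ha(3)[OF that] by simp
    then show "\<exists>g\<in>hom B L. \<forall>a\<in>carrier A. g (\<alpha> a) = f a"
      using Group.hom_compose[OF hb(1) g(1)] by (intro bexI[of _ "g \<circ> b"]) auto
    fix g g' x assume gs: "g \<in> hom B L" "g' \<in> hom B L" "\<forall>a\<in>carrier A. g (\<alpha> a) = f a" "\<forall>a\<in>carrier A. g' (\<alpha> a) = f a" "x \<in> carrier B"
    have "(g \<circ> b') (b x) = (g' \<circ> b') (b x)"
      by (rule unique_extension_unique[OF u Group.hom_compose[OF hb(2) gs(1)] Group.hom_compose[OF hb(2) gs(2)]])
         (use gs hb ha \<alpha>c in auto)
    then show "g x = g' x" using hb(3)[OF gs(5)] by simp
  qed
qed

lemma local_group_iso: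
  assumes L: "local_group L" and iso: "group_isomorphisms L L' h k" and L': "group L'"
  shows "local_group L'"
  unfolding local_group_iff
proof (intro conjI allI impI L')
  have k: "k \<in> hom L' L" using iso by (simp add: group_isomorphisms_def)
  fix A B :: "nat monoid" and \<alpha> f
  assume h: "finitely_presented A \<and> finitely_presented B \<and> two_connected A B \<alpha> \<and> f \<in> hom A L'"
  with finitely_presented_group have B: "group B" and f: "f \<in> hom A L'" and \<alpha>: "\<alpha> ` carrier A \<subseteq> carrier B"
    by (auto simp: two_connected_def hom_def)
  have "unique_extension A B L \<alpha> (k \<circ> f)"
    using h by (intro local_group_extension[OF L] Group.hom_compose[OF f k]) auto
  from unique_extension_iso_target[OF this iso B f \<alpha>] show "unique_extension A B L' \<alpha> f" .
qed

subsection \<open>Localizations are countable\<close>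

lemma countable_generate:
  assumes G: "group G" and S: "S \<subseteq> carrier G" "countable S"
  shows "countable (generate G S)"
proof -
  interpret group G by (rule G)
  \<comment> \<open>The default one is for empty \<open>S\<close>, where the enumeration has no
    element of \<open>S\<close> to return.\<close>
  define \<phi> where "\<phi> i = (if from_nat_into S i \<in> S then from_nat_into S i else \<one>\<^bsub>G\<^esub>)" for i
  have \<phi>: "\<phi> i \<in> carrier G" for i using S(1) by (auto simp: \<phi>_def)
  have "x \<in> range (word_eval G \<phi>)" if "x \<in> generate G S" for x
    using that
  proof (induction rule: generate.induct)
    case one
    show ?case by (rule range_eqI[of _ _ "[]"]) simp
  next
    case (incl h)
    then have "\<phi> (to_nat_on S h) = h" using S(2) by (simp add: \<phi>_def)
    then show ?case using \<phi>[of "to_nat_on S h"] by (intro range_eqI[of _ _ "[(True, to_nat_on S h)]"]) simp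
  next
    case (inv h)
    then have "\<phi> (to_nat_on S h) = h" using S(2) by (simp add: \<phi>_def)
    then show ?case using \<phi>[of "to_nat_on S h"] by (intro range_eqI[of _ _ "[(False, to_nat_on S h)]"]) simp
  next
    case (eng h1 h2)
    then obtain u v where "h1 = word_eval G \<phi> u" "h2 = word_eval G \<phi> v" by blast
    then show ?case
      by (intro range_eqI[of _ _ "u @ v"]) (simp add: word_eval_append[where \<phi> = \<phi>, OF G \<phi>])
  qed
  then have "generate G S \<subseteq> range (word_eval G \<phi>)" by blast
  then show ?thesis by (rule countable_subset) simp
qed

text \<open>A homomorphism is determined on the carrier by its values on the \<open>n\<close>
  generators, and extensionality fixes it elsewhere; so these maps inject into the lists over
  \<open>S\<close>.\<close>

lemma countable_homs_from_presented_group: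
  assumes E: "group E" and S: "countable S"
  shows "countable {f \<in> hom (presented_group n R) E \<inter> extensional (carrier (presented_group n R)). f ` carrier (presented_group n R) \<subseteq> S}"
    (is "countable ?F")
proof -
  let ?c = "\<lambda>f. map (\<lambda>i. f (presented_gen n R i)) [0..<n]"
  have "inj_on ?c ?F"
  proof (rule inj_onI)
    fix f g assume f: "f \<in> ?F" and g: "g \<in> ?F" and "?c f = ?c g"
    then have eq: "f (presented_gen n R i) = g (presented_gen n R i)" if "i < n" for i using that by simp
    have "f \<in> hom (presented_group n R) E" "g \<in> hom (presented_group n R) E"
      using f g by blast+
    from presented_group_hom_eqI[OF E this eq]
    have "f x = g x" if "x \<in> carrier (presented_group n R)" for x using that by blast
    then show "f = g" using f g by (intro extensionalityI[of _ "carrier (presented_group n R)"]) auto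
  qed
  moreover have "?c ` ?F \<subseteq> lists S" using presented_gen_carrier by fastforce
  then have "countable (?c ` ?F)" using S countable_lists countable_subset by blast
  ultimately show ?thesis using countable_image_inj_on by blast
qed

text \<open>One closure step towards a local subgroup. Indexing by finite presentations rather than
  by groups leaves countably many extension problems, since words and finite sets of words are
  countable.\<close>

definition extension_values :: "('e, 'r) monoid_scheme \<Rightarrow> 'e set \<Rightarrow> 'e set" where
  "extension_values E S = {g y | g y n R m R' \<alpha> f. finite R \<and> R \<subseteq> gen_words n \<and> finite R' \<and> R' \<subseteq> gen_words m \<and>
     two_connected (presented_group n R) (presented_group m R') \<alpha> \<and>
     f \<in> hom (presented_group n R) E \<and> f ` carrier (presented_group n R) \<subseteq> S \<and>
     g \<in> hom (presented_group m R') E \<and> (\<forall>a\<in>carrier (presented_group n R). g (\<alpha> a) = f a) \<and>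
     y \<in> carrier (presented_group m R')}"

lemma extension_valuesI:
  assumes "finite R" "R \<subseteq> gen_words n" "finite R'" "R' \<subseteq> gen_words m"
    "two_connected (presented_group n R) (presented_group m R') \<alpha>"
    "f \<in> hom (presented_group n R) E" "f ` carrier (presented_group n R) \<subseteq> S"
    "g \<in> hom (presented_group m R') E" "\<forall>a\<in>carrier (presented_group n R). g (\<alpha> a) = f a"
    "y \<in> carrier (presented_group m R')"
  shows "g y \<in> extension_values E S"
  unfolding extension_values_def
  by (rule CollectI, rule exI[of _ g], rule exI[of _ y], rule exI[of _ n], rule exI[of _ R], rule exI[of _ m],
      rule exI[of _ R'], rule exI[of _ \<alpha>], rule exI[of _ f]) (intro conjI HOL.refl assms)

lemma extension_values_subset: "extension_values E S \<subseteq> carrier E"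
  by (auto simp: extension_values_def hom_def)

lemma countable_extension_values:
  assumes E: "local_group E" and S: "countable S"
  shows "countable (extension_values E S)"
proof -
  define P where "P = {(n, R). finite R \<and> R \<subseteq> gen_words n}"
  have "countable {R :: gen_word set. finite R}"
    using countable_Collect_finite by blast
  then have P: "countable P"
    by (intro countable_subset[of P "UNIV \<times> {R. finite R}"]) (auto simp: P_def)
  define Hom where "Hom n R m R' = {\<alpha> \<in> hom (presented_group n R) (presented_group m R') \<inter> extensional (carrier (presented_group n R)). \<alpha> ` carrier (presented_group n R) \<subseteq> carrier (presented_group m R')}" for n R m R'
  define F where "F n R = {f \<in> hom (presented_group n R) E \<inter> extensional (carrier (presented_group n R)). f ` carrier (presented_group n R) \<subseteq> S}" for n R
  define ext where "ext n R m R' \<alpha> f = (SOME g. g \<in> hom (presented_group m R') E \<and> (\<forall>a\<in>carrier (presented_group n R). g (\<alpha> a) = f a))" for n R m R' \<alpha> f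
  define T where "T = (\<Union>(n, R)\<in>P. \<Union>(m, R')\<in>P. \<Union>\<alpha>\<in>Hom n R m R'. \<Union>f\<in>F n R. ext n R m R' \<alpha> f ` carrier (presented_group m R'))"
  have cP: "countable (carrier (presented_group m R'))" for m R'
    using countable_gen_words by (simp add: carrier_presented_group)
  have "countable (Hom n R m R')" for n R m R'
    unfolding Hom_def by (rule countable_homs_from_presented_group[OF group_presented_group cP])
  moreover have "countable (F n R)" for n R
    unfolding F_def by (rule countable_homs_from_presented_group[OF local_group_group[OF E] S])
  ultimately have "countable T"
    unfolding T_def using P cP by (auto intro!: countable_UN simp: case_prod_unfold)
  moreover have "extension_values E S \<subseteq> T"
  proof
    fix x assume "x \<in> extension_values E S"
    then obtain g y n R m R' \<alpha> f where *: "x = g y" "finite R" "R \<subseteq> gen_words n" "finite R'" "R' \<subseteq> gen_words m"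
      "two_connected (presented_group n R) (presented_group m R') \<alpha>"
      "f \<in> hom (presented_group n R) E" "f ` carrier (presented_group n R) \<subseteq> S"
      "g \<in> hom (presented_group m R') E" "\<forall>a\<in>carrier (presented_group n R). g (\<alpha> a) = f a"
      "y \<in> carrier (presented_group m R')"
      unfolding extension_values_def by (elim CollectE exE conjE) (rule that; assumption)
    let ?A = "presented_group n R" and ?B = "presented_group m R'"
    \<comment> \<open>Restriction to the carrier puts both maps into the countable sets
      \<open>Hom n R m R'\<close> and \<open>F n R\<close>; uniqueness of extensions then identifies
      \<open>g\<close> with the chosen \<open>ext\<close>.\<close>
    define \<alpha>' where "\<alpha>' = restrict \<alpha> (carrier ?A)"
    define f' where "f' = restrict f (carrier ?A)"
    have \<alpha>: "\<alpha> \<in> hom ?A ?B" using *(6) by (simp add: two_connected_def)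
    have \<alpha>': "\<alpha>' \<in> hom ?A ?B" using group.hom_eq[OF group_presented_group \<alpha>] by (simp add: \<alpha>'_def)
    have f': "f' \<in> hom ?A E" using group.hom_eq[OF group_presented_group *(7)] by (simp add: f'_def)
    have "two_connected ?A ?B \<alpha>'" using two_connected_cong[OF *(6) \<alpha>'] by (simp add: \<alpha>'_def)
    then have u: "unique_extension ?A ?B E \<alpha>' f'"
      using * f' by (intro local_group_extension[OF E] finitely_presented_presented_group) auto
    have "\<exists>g. g \<in> hom ?B E \<and> (\<forall>a\<in>carrier ?A. g (\<alpha>' a) = f' a)"
      using unique_extension_exists[OF u] by metis
    from someI_ex[OF this]
    have e: "ext n R m R' \<alpha>' f' \<in> hom ?B E" "\<forall>a\<in>carrier ?A. ext n R m R' \<alpha>' f' (\<alpha>' a) = f' a"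
      by (auto simp: ext_def)
    have "g y = ext n R m R' \<alpha>' f' y"
      by (rule unique_extension_unique[OF u *(9) e(1)]) (use * e in \<open>auto simp: \<alpha>'_def f'_def\<close>)
    moreover have "\<alpha>' \<in> Hom n R m R'"
      using \<alpha>' hom_carrier[OF \<alpha>'] by (simp add: Hom_def) (simp add: \<alpha>'_def)
    moreover have "f' \<in> F n R" using f' *(8) by (auto simp: F_def f'_def)
    moreover have "(n, R) \<in> P" "(m, R') \<in> P" using * by (auto simp: P_def)
    ultimately have P: "(n, R) \<in> P" "(m, R') \<in> P"
      and x: "x \<in> (\<Union>\<alpha>\<in>Hom n R m R'. \<Union>f\<in>F n R. ext n R m R' \<alpha> f ` carrier ?B)"
      using *(1,11) by blast+
    show "x \<in> T"
      unfolding T_def by (rule UN_I[OF P(1)], unfold prod.case, rule UN_I[OF P(2)], unfold prod.case, rule x)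
  qed
  ultimately show ?thesis by (rule countable_subset[rotated])
qed

lemma presented_group_hom_in_subgroup:
  assumes E: "group E" and K: "subgroup K E" and f: "f \<in> hom (presented_group n R) E"
    and gen: "\<And>i. i < n \<Longrightarrow> f (presented_gen n R i) \<in> K"
  shows "f ` carrier (presented_group n R) \<subseteq> K"
proof -
  have "word_eval E (\<lambda>i. f (presented_gen n R i)) u \<in> K" if "u \<in> gen_words n" for u
    using that
  proof (induction u)
    case Nil
    then show ?case using K by (simp add: subgroup.one_closed)
  next
    case (Cons x u)
    then show ?case
      by (cases x) (use gen K in \<open>auto intro!: subgroup.m_closed subgroup.m_inv_closed\<close>)
  qed
  then show ?thesis
    using presented_group_hom_eval[OF E f] by (auto simp: carrier_presented_group)
qed

text \<open>Extension values are adjoined \<omega> times. A map from a finitely presented group into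
  the union already lands in one stage, so its extension has values in the next; uniqueness is
  inherited from \<open>E\<close>.\<close>

lemma countable_local_subgroup:
  assumes E: "local_group E" and S: "S \<subseteq> carrier E" "countable S"
  shows "\<exists>K. subgroup K E \<and> S \<subseteq> K \<and> countable K \<and> local_group (E\<lparr>carrier := K\<rparr>)"
proof -
  interpret group E by (rule local_group_group[OF E])
  define K where "K = rec_nat (generate E S) (\<lambda>k T. generate E (T \<union> extension_values E T))"
  have K0: "K 0 = generate E S" and KS: "K (Suc k) = generate E (K k \<union> extension_values E (K k))" for k
    by (simp_all add: K_def)
  have sub: "subgroup (K k) E" for k
  proof (induction k)
    case (Suc k)
    show ?case
      unfolding KS using extension_values_subset[of E "K k"] subgroup.subset[OF Suc]
      by (intro generate_is_subgroup) blast
  qed (simp add: K0 generate_is_subgroup S)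
  have count: "countable (K k)" for k
  proof (induction k)
    case (Suc k)
    show ?case
      unfolding KS using extension_values_subset[of E "K k"] subgroup.subset[OF sub[of k]] countable_extension_values[OF E Suc] Suc
      by (intro countable_generate is_group) auto
  qed (simp add: K0 countable_generate S)
  have step: "K k \<subseteq> K (Suc k)" "extension_values E (K k) \<subseteq> K (Suc k)" for k
    unfolding KS by (auto intro: generate.incl)
  have mono: "K k \<subseteq> K l" if "k \<le> l" for k l
    using that by (induction rule: dec_induct) (use step in blast)+
  let ?K = "\<Union>k. K k"
  have subK: "subgroup ?K E"
  proof (rule subgroupI)
    show "?K \<subseteq> carrier E" using subgroup.subset[OF sub] by blast
    show "?K \<noteq> {}" using subgroup.one_closed[OF sub] by blast
    show "inv\<^bsub>E\<^esub> a \<in> ?K" if "a \<in> ?K" for a using that subgroup.m_inv_closed[OF sub] by blast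
    fix a b assume "a \<in> ?K" "b \<in> ?K"
    then obtain k l where "a \<in> K k" "b \<in> K l" by blast
    then have "a \<in> K (max k l)" "b \<in> K (max k l)"
      using mono[of k "max k l"] mono[of l "max k l"] by auto
    then show "a \<otimes>\<^bsub>E\<^esub> b \<in> ?K" using subgroup.m_closed[OF sub] by blast
  qed
  have hom_iff: "h \<in> hom A (E\<lparr>carrier := ?K\<rparr>) \<longleftrightarrow> h \<in> hom A E \<and> h ` carrier A \<subseteq> ?K" for A :: "nat monoid" and h
  proof -
    have "h \<in> carrier A \<rightarrow> ?K \<longleftrightarrow> h \<in> carrier A \<rightarrow> carrier E \<and> h ` carrier A \<subseteq> ?K"
      using subgroup.subset[OF subK] unfolding Pi_iff image_subset_iff by blast
    then show ?thesis unfolding hom_def by (simp del: image_subset_iff) blast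
  qed
  have "local_group (E\<lparr>carrier := ?K\<rparr>)"
    unfolding local_group_iff
  proof (intro conjI allI impI)
    show "group (E\<lparr>carrier := ?K\<rparr>)" using subgroup.subgroup_is_group[OF subK is_group] .
    fix A B :: "nat monoid" and \<alpha> f
    assume "finitely_presented A \<and> finitely_presented B \<and> two_connected A B \<alpha> \<and> f \<in> hom A (E\<lparr>carrier := ?K\<rparr>)"
    then have A: "finitely_presented A" and B: "finitely_presented B" and \<alpha>: "two_connected A B \<alpha>"
      and f: "f \<in> hom A E" "f ` carrier A \<subseteq> ?K"
      using hom_iff by auto
    note u = local_group_extension[OF E A B \<alpha> f(1)]
    obtain g where g: "g \<in> hom B E" "\<And>a. a \<in> carrier A \<Longrightarrow> g (\<alpha> a) = f a"
      using unique_extension_exists[OF u] by blast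
    obtain n R a where R: "finite R" "R \<subseteq> gen_words n" and a: "a \<in> iso A (presented_group n R)"
      using A by (auto simp: finitely_presented_def is_iso_def)
    obtain m R' b where R': "finite R'" "R' \<subseteq> gen_words m" and b: "b \<in> iso B (presented_group m R')"
      using B by (auto simp: finitely_presented_def is_iso_def)
    obtain a' where a': "group_isomorphisms A (presented_group n R) a a'"
      using a group.iso_iff_group_isomorphisms[OF finitely_presented_group[OF A]] by blast
    obtain b' where b': "group_isomorphisms B (presented_group m R') b b'"
      using b group.iso_iff_group_isomorphisms[OF finitely_presented_group[OF B]] by blast
    have ha: "a' \<in> hom (presented_group n R) A" "\<And>x. x \<in> carrier (presented_group n R) \<Longrightarrow> a' x \<in> carrier A"
      and hb: "b \<in> hom B (presented_group m R')" "b' \<in> hom (presented_group m R') B" "\<And>x. x \<in> carrier B \<Longrightarrow> b' (b x) = x"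
      "\<And>x. x \<in> carrier B \<Longrightarrow> b x \<in> carrier (presented_group m R')"
      using a' b' by (auto simp: group_isomorphisms_def hom_def)
    have \<alpha>c: "\<alpha> x \<in> carrier B" if "x \<in> carrier A" for x using \<alpha> that by (auto simp: two_connected_def hom_def)
    have \<alpha>': "two_connected (presented_group n R) (presented_group m R') (b \<circ> (\<alpha> \<circ> a'))"
      using two_connected_iso[OF b'] two_connected_iso[OF group_isomorphisms_sym[OF a']] \<alpha>
      by (intro two_connected_compose)
    have f': "f \<circ> a' \<in> hom (presented_group n R) E" by (rule Group.hom_compose[OF ha(1) f(1)])
    have g': "g \<circ> b' \<in> hom (presented_group m R') E" by (rule Group.hom_compose[OF hb(2) g(1)])
    have "(f \<circ> a') (presented_gen n R i) \<in> ?K" if "i < n" for i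
      using subsetD[OF f(2) imageI[OF ha(2)[OF presented_gen_carrier[OF that]]]] by simp
    then have "\<forall>i\<in>{..<n}. \<exists>k. (f \<circ> a') (presented_gen n R i) \<in> K k" by blast
    then have "\<exists>ks. \<forall>i\<in>{..<n}. (f \<circ> a') (presented_gen n R i) \<in> K (ks i)" by (rule bchoice)
    then obtain ks where ks: "\<And>i. i < n \<Longrightarrow> (f \<circ> a') (presented_gen n R i) \<in> K (ks i)" by blast
    \<comment> \<open>A common stage for the finitely many generators; the inserted 0 keeps the set
      nonempty when \<open>n = 0\<close>.\<close>
    define k where "k = Max (insert 0 (ks ` {..<n}))"
    have "(f \<circ> a') (presented_gen n R i) \<in> K k" if "i < n" for i
      using ks[OF that] mono[of "ks i" k] that by (auto simp: k_def)
    then have fK: "(f \<circ> a') ` carrier (presented_group n R) \<subseteq> K k"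
      by (rule presented_group_hom_in_subgroup[OF is_group sub f'])
    have ext: "\<forall>x\<in>carrier (presented_group n R). (g \<circ> b') ((b \<circ> (\<alpha> \<circ> a')) x) = (f \<circ> a') x"
      using ha(2) \<alpha>c hb(3) g(2) by simp
    have "(g \<circ> b') y \<in> extension_values E (K k)" if "y \<in> carrier (presented_group m R')" for y
      by (rule extension_valuesI[OF R R' \<alpha>' f' fK g' ext that])
    then have gK: "g y \<in> ?K" if "y \<in> carrier B" for y
      using step(2)[of k] hb(3,4)[OF that] by fastforce
    show "unique_extension A B (E\<lparr>carrier := ?K\<rparr>) \<alpha> f"
      unfolding unique_extension_def
    proof (intro conjI ballI impI)
      show "\<exists>g\<in>hom B (E\<lparr>carrier := ?K\<rparr>). \<forall>a\<in>carrier A. g (\<alpha> a) = f a"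
        using g gK hom_iff by (intro bexI[of _ g]) auto
    qed (use unique_extension_unique[OF u] hom_iff in blast)
  qed
  moreover have "S \<subseteq> ?K" using generate.incl[of _ S E] by (force simp flip: K0)
  ultimately show ?thesis using subK count by blast
qed

section \<open>The universal property for targets on other types\<close>

lemma homology_localization_extension_aux:
  fixes G :: "('a, 'r) monoid_scheme" and E :: "'e monoid" and L :: "('e + 'a + nat) monoid"
  assumes "homology_localization G E l" "local_group L" "f \<in> hom G L"
  shows "unique_extension G E L l f"
proof -
  have "group E" "l ` carrier G \<subseteq> carrier E"
    using assms local_group_group by (auto simp: homology_localization_def hom_def)
  then show ?thesis
    using assms unfolding homology_localization_def by (subst unique_extension_iff) blast+
qed

text \<open>The universal property is stated for one type. A local group whose carrier embeds in it
  can be copied there, and the extension carried back.\<close>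

lemma homology_localization_extension_inj:
  fixes G :: "('a, 'r) monoid_scheme" and E :: "'e monoid" and L :: "('l, 's) monoid_scheme" and c :: "'l \<Rightarrow> 'e + 'a + nat"
  assumes loc: "homology_localization G E l" and L: "local_group L" and f: "f \<in> hom G L" and c: "inj_on c (carrier L)"
  shows "unique_extension G E L l f"
proof -
  note iso = image_group_isomorphisms[OF local_group_group[OF L] c]
  have c': "c \<in> hom L (image_group c L)" using iso(1) by (simp add: group_isomorphisms_def)
  have "local_group (image_group c L)" using local_group_iso[OF L iso] .
  from homology_localization_extension_aux[OF loc this Group.hom_compose[OF f c']]
  have u: "unique_extension G E (image_group c L) l (c \<circ> f)" .
  show ?thesis
    by (rule unique_extension_iso_target[OF u group_isomorphisms_sym[OF iso(1)]])
       (use loc f local_group_group in \<open>auto simp: homology_localization_def hom_def\<close>)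
qed

lemma homology_localization_countable:
  assumes loc: "homology_localization G E l" and G: "countable (carrier G)"
  shows "countable (carrier E)"
proof -
  have E: "local_group E" and l: "l \<in> hom G E" using loc by (auto simp: homology_localization_def)
  interpret group E by (rule local_group_group[OF E])
  have lG: "l ` carrier G \<subseteq> carrier E" using l by (auto simp: hom_def)
  obtain K where K: "subgroup K E" "l ` carrier G \<subseteq> K" "countable K" "local_group (E\<lparr>carrier := K\<rparr>)"
    using countable_local_subgroup[OF E lG] G by blast
  have sub: "K \<subseteq> carrier E" using K(1) by (rule subgroup.subset)
  have "l \<in> hom G (E\<lparr>carrier := K\<rparr>)" using l K(2) by (auto simp: hom_def)
  \<comment> \<open>Subgroups of \<open>E\<close> embed in the test type by \<open>Inl\<close>. The
    resulting map \<open>g\<close> into \<open>K\<close> and the identity both extend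
    \<open>l\<close> to endomorphisms of \<open>E\<close>, so they agree and \<open>K\<close> is
    everything.\<close>
  then have "unique_extension G E (E\<lparr>carrier := K\<rparr>) l l"
    by (rule homology_localization_extension_inj[OF loc K(4), of _ Inl]) simp
  then obtain g where g: "g \<in> hom E (E\<lparr>carrier := K\<rparr>)" "\<And>x. x \<in> carrier G \<Longrightarrow> g (l x) = l x"
    unfolding unique_extension_def by blast
  have u: "unique_extension G E E l l"
    by (rule homology_localization_extension_inj[OF loc E l, of Inl]) simp
  have gE: "g \<in> hom E E" using g(1) sub by (auto simp: hom_def)
  have id: "(\<lambda>x. x) \<in> hom E E" by (simp add: hom_def)
  have "g x = x" if "x \<in> carrier E" for x
    using unique_extension_unique[OF u gE id _ _ that] g(2) by simp
  then have "carrier E \<subseteq> K" using g(1) by (auto simp: hom_def Pi_iff)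
  then show ?thesis using K(3) by (rule countable_subset)
qed

text \<open>A countable target embeds in the summand \<open>nat\<close> of the test type, whatever
  type it lives on.\<close>

lemma homology_localization_extension:
  assumes loc: "homology_localization G E l" and L: "local_group L" "countable (carrier L)" and f: "f \<in> hom G L"
  shows "unique_extension G E L l f"
proof (rule homology_localization_extension_inj[OF loc L(1) f])
  show "inj_on (Inr \<circ> (Inr \<circ> to_nat_on (carrier L))) (carrier L)"
    using inj_on_to_nat_on[OF L(2)] by (auto simp: inj_on_def)
qed

text \<open>Locality extends \<open>l\<close> and \<open>l'\<close> over \<open>B\<close> to
  \<open>g\<close> and \<open>g'\<close>. The universal properties, applied to
  \<open>g' \<circ> \<alpha>\<close> and \<open>g \<circ> \<beta>\<close>, give \<open>h\<close> and
  \<open>h'\<close>. Uniqueness of extensions to \<open>B\<close> yields that \<open>h\<close> after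
  \<open>g\<close> is \<open>g'\<close> and \<open>h'\<close> after \<open>g'\<close> is
  \<open>g\<close>; uniqueness on \<open>E\<close> and \<open>E'\<close> then makes \<open>h\<close>
  and \<open>h'\<close> mutually inverse.\<close>

lemma localizations_isomorphic:
  assumes A: "finitely_presented A" and B: "finitely_presented B" and C: "finitely_presented C"
    and \<alpha>: "two_connected A B \<alpha>" and \<beta>: "two_connected C B \<beta>"
    and E: "homology_localization A E l" and E': "homology_localization C E' l'"
  shows "\<exists>g \<Phi>. g \<in> hom B E \<and> \<Phi> \<in> iso E' E \<and> (\<forall>a\<in>carrier A. g (\<alpha> a) = l a) \<and> (\<forall>c\<in>carrier C. \<Phi> (l' c) = g (\<beta> c))"
proof -
  have lE: "local_group E" "l \<in> hom A E" and lE': "local_group E'" "l' \<in> hom C E'"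
    using E E' by (auto simp: homology_localization_def)
  have cE: "countable (carrier E)" and cE': "countable (carrier E')"
    using homology_localization_countable[OF E finitely_presented_countable[OF A]]
      homology_localization_countable[OF E' finitely_presented_countable[OF C]] by auto
  have \<alpha>h: "\<alpha> \<in> hom A B" and \<beta>h: "\<beta> \<in> hom C B" using \<alpha> \<beta> by (auto simp: two_connected_def)
  have \<alpha>c: "\<alpha> a \<in> carrier B" if "a \<in> carrier A" for a using \<alpha>h that by (auto simp: hom_def)
  have \<beta>c: "\<beta> a \<in> carrier B" if "a \<in> carrier C" for a using \<beta>h that by (auto simp: hom_def)
  note uE = local_group_extension[OF lE(1) A B \<alpha> lE(2)] and uE' = local_group_extension[OF lE'(1) C B \<beta> lE'(2)]
  obtain g where g: "g \<in> hom B E" "\<And>a. a \<in> carrier A \<Longrightarrow> g (\<alpha> a) = l a"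
    using unique_extension_exists[OF uE] by blast
  obtain g' where g': "g' \<in> hom B E'" "\<And>c. c \<in> carrier C \<Longrightarrow> g' (\<beta> c) = l' c"
    using unique_extension_exists[OF uE'] by blast
  obtain h where h: "h \<in> hom E E'" "\<And>a. a \<in> carrier A \<Longrightarrow> h (l a) = g' (\<alpha> a)"
    using unique_extension_exists[OF homology_localization_extension[OF E lE'(1) cE' Group.hom_compose[OF \<alpha>h g'(1)]]] by auto
  obtain h' where h': "h' \<in> hom E' E" "\<And>c. c \<in> carrier C \<Longrightarrow> h' (l' c) = g (\<beta> c)"
    using unique_extension_exists[OF homology_localization_extension[OF E' lE(1) cE Group.hom_compose[OF \<beta>h g(1)]]] by auto
  have uhg: "unique_extension A B E' \<alpha> (g' \<circ> \<alpha>)"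
    using local_group_extension[OF lE'(1) A B \<alpha> Group.hom_compose[OF \<alpha>h g'(1)]] .
  have "(h \<circ> g) b = g' b" if "b \<in> carrier B" for b
    by (rule unique_extension_unique[OF uhg Group.hom_compose[OF g(1) h(1)] g'(1) _ _ that]) (simp_all add: g(2) h(2))
  then have hg: "h (g b) = g' b" if "b \<in> carrier B" for b using that by simp
  have uh'g': "unique_extension C B E \<beta> (g \<circ> \<beta>)"
    using local_group_extension[OF lE(1) C B \<beta> Group.hom_compose[OF \<beta>h g(1)]] .
  have "(h' \<circ> g') b = g b" if "b \<in> carrier B" for b
    by (rule unique_extension_unique[OF uh'g' Group.hom_compose[OF g'(1) h'(1)] g(1) _ _ that]) (simp_all add: g'(2) h'(2))
  then have h'g': "h' (g' b) = g b" if "b \<in> carrier B" for b using that by simp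
  have idE: "(\<lambda>x. x) \<in> hom E E" and idE': "(\<lambda>x. x) \<in> hom E' E'" by (simp_all add: hom_def)
  have "(h' \<circ> h) x = x" if "x \<in> carrier E" for x
    by (rule unique_extension_unique[OF homology_localization_extension[OF E lE(1) cE lE(2)] Group.hom_compose[OF h(1) h'(1)] idE _ _ that])
      (simp_all add: h(2) h'g' g(2) \<alpha>c)
  moreover have "(h \<circ> h') x = x" if "x \<in> carrier E'" for x
    by (rule unique_extension_unique[OF homology_localization_extension[OF E' lE'(1) cE' lE'(2)] Group.hom_compose[OF h'(1) h(1)] idE' _ _ that])
      (simp_all add: h'(2) hg g'(2) \<beta>c)
  ultimately have "group_isomorphisms E' E h' h" using h(1) h'(1) by (simp add: group_isomorphisms_def)
  then have "h' \<in> iso E' E" by (rule group_isomorphisms_imp_iso)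
  then show ?thesis using g h' by blast
qed

section \<open>Local structure of manifolds\<close>

text \<open>The homotopies may leave \<open>V\<close>; only the paths stay inside. For this reason
  the property passes to all smaller sets, which simple connectedness of \<open>V\<close> would
  not.\<close>

definition paths_homotopic_in :: "'a topology \<Rightarrow> 'a set \<Rightarrow> bool" where
  "paths_homotopic_in X V \<longleftrightarrow> (\<forall>p q. pathin X p \<and> pathin X q \<and> p ` {0..1} \<subseteq> V \<and> q ` {0..1} \<subseteq> V \<and>
     p 0 = q 0 \<and> p 1 = q 1 \<longrightarrow> path_homotopic X p q)"

definition locally_simple :: "'a topology \<Rightarrow> bool" where
  "locally_simple X \<longleftrightarrow> (\<forall>U x. openin X U \<and> x \<in> U \<longrightarrow>
     (\<exists>V. openin X V \<and> x \<in> V \<and> V \<subseteq> U \<and> path_connectedin X V \<and> paths_homotopic_in X V))"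

lemma paths_homotopic_in_mono: "paths_homotopic_in X V \<Longrightarrow> W \<subseteq> V \<Longrightarrow> paths_homotopic_in X W"
  unfolding paths_homotopic_in_def by (meson order_trans)

lemma half_space_eq:
  "half_space n = subtopology (powertop_real UNIV) {x. (\<forall>i\<ge>n. x i = 0) \<and> 0 \<le> x 0}"
  by (simp add: half_space_def Euclidean_space_def subtopology_subtopology Collect_conj_eq)

definition pointwise_convex :: "(nat \<Rightarrow> real) set \<Rightarrow> bool" where
  "pointwise_convex B \<longleftrightarrow> (\<forall>x\<in>B. \<forall>y\<in>B. \<forall>s\<in>{0..1}. (\<lambda>i. (1 - s) * x i + s * y i) \<in> B)"

lemma half_space_convex_neighbourhood:
  assumes "openin (half_space n) T" "a \<in> T"
  shows "\<exists>B. openin (half_space n) B \<and> a \<in> B \<and> B \<subseteq> T \<and> pointwise_convex B"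
proof -
  let ?S = "{x :: nat \<Rightarrow> real. (\<forall>i\<ge>n. x i = 0) \<and> 0 \<le> x 0}"
  obtain T' where T': "openin (powertop_real UNIV) T'" "T = T' \<inter> ?S"
    using assms(1) unfolding half_space_eq openin_subtopology by blast
  then obtain U where U: "a \<in> PiE UNIV U" "\<And>i. open (U i)" "finite {i. U i \<noteq> UNIV}" "PiE UNIV U \<subseteq> T'"
    using product_topology_open_contains_basis[OF T'(1), of a] assms(2) by (auto simp flip: open_openin)
  have "\<exists>e>0. ball (a i) e \<subseteq> U i" for i
    using U(1,2) open_contains_ball by (metis PiE_E UNIV_I)
  then obtain e where e: "\<And>i. e i > 0" "\<And>i. ball (a i) (e i) \<subseteq> U i" by metis
  \<comment> \<open>Balls are used only in the finitely many constrained coordinates; the others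
    keep the whole line, so the product of the \<open>B i\<close> is still open.\<close>
  define B where "B i = (if U i = UNIV then UNIV else ball (a i) (e i))" for i
  have B: "open (B i)" "a i \<in> B i" "B i \<subseteq> U i" "convex (B i)" for i
    using e by (auto simp: B_def)
  have "finite {i. B i \<noteq> UNIV}" by (rule finite_subset[OF _ U(3)]) (auto simp: B_def)
  then have "openin (powertop_real UNIV) (PiE UNIV B)"
    using B(1) by (intro product_topology_basis) auto
  then have 1: "openin (half_space n) (PiE UNIV B \<inter> ?S)"
    unfolding half_space_eq by (auto simp: openin_subtopology)
  have 2: "a \<in> PiE UNIV B \<inter> ?S" using assms(2) T' B by auto
  have 3: "PiE UNIV B \<inter> ?S \<subseteq> T" using T' U(4) B(3) by fastforce
  have "(1 - s) * x i + s * y i \<in> B i" if "x i \<in> B i" "y i \<in> B i" "s \<in> {0..1}" for x y s i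
    using convexD[OF B(4) that(1,2), of "1 - s" s] that(3) by simp
  then have "pointwise_convex (PiE UNIV B \<inter> ?S)"
    by (auto simp: pointwise_convex_def PiE_iff)
  then show ?thesis using 1 2 3 by blast
qed

text \<open>Straight lines in the convex model, carried to \<open>X\<close> by the chart.\<close>

lemma homeomorphic_convex_imp_simple:
  assumes B: "pointwise_convex B"
    and g: "continuous_map (subtopology (powertop_real UNIV) B) X g"
    and h: "continuous_map (subtopology X V) (subtopology (powertop_real UNIV) B) h"
    and gh: "\<And>y. y \<in> V \<Longrightarrow> g (h y) = y" and gB: "g ` B = V"
  shows "path_connectedin X V" "paths_homotopic_in X V"
proof -
  let ?TB = "subtopology (powertop_real UNIV) B"
  have "continuous_map (top_of_set {0..1}) ?TB (\<lambda>s i. (1 - s) * x i + s * y i)" if "x \<in> B" "y \<in> B" for x y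
  proof -
    have "continuous_map (top_of_set {0..1}) (powertop_real UNIV) (\<lambda>s i. (1 - s) * x i + s * y i)"
      by (subst continuous_map_componentwise_UNIV) (auto intro!: continuous_intros)
    then show ?thesis
      using B that by (auto simp: continuous_map_in_subtopology pointwise_convex_def)
  qed
  then have "path_connected_space ?TB"
    unfolding path_connected_space_def pathin_def
    by (intro ballI) (rule_tac x="\<lambda>s i. (1 - s) * x i + s * y i" in exI, auto)
  then have "path_connectedin ?TB (topspace ?TB)" using path_connectedin_topspace by blast
  from path_connectedin_continuous_map_image[OF g this] show "path_connectedin X V"
    using gB by simp
  show "paths_homotopic_in X V"
    unfolding paths_homotopic_in_def
  proof (intro allI impI, elim conjE)
    fix p q assume p: "pathin X p" "p ` {0..1} \<subseteq> V" and q: "pathin X q" "q ` {0..1} \<subseteq> V" and pq: "p 0 = q 0" "p 1 = q 1"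
    have "pathin (subtopology X V) p" "pathin (subtopology X V) q"
      using p q by (auto simp: pathin_subtopology)
    then have "pathin ?TB (h \<circ> p)" "pathin ?TB (h \<circ> q)" using h pathin_compose by blast+
    then have "path_homotopic ?TB (h \<circ> p) (h \<circ> q)"
      using B pq by (intro path_homotopic_pointwise_convex) (auto simp: pointwise_convex_def)
    from path_homotopic_compose[OF this g]
    have *: "path_homotopic X (g \<circ> (h \<circ> p)) (g \<circ> (h \<circ> q))" .
    have "path_homotopic X p (g \<circ> (h \<circ> p))" "path_homotopic X q (g \<circ> (h \<circ> q))"
      using p q gh by (auto intro!: path_homotopic_eq simp: image_subset_iff)
    with * show "path_homotopic X p q" by (meson path_homotopic_sym path_homotopic_trans)
  qed
qed

text \<open>The half-space is convex, so small convex sets exist around its boundary points as well;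
  one argument covers the closed manifolds and the cobordism.\<close>

lemma manifold_locally_simple:
  assumes "manifold_with_boundary n X"
  shows "locally_simple X"
  unfolding locally_simple_def
proof (intro allI impI, elim conjE)
  fix U x assume U: "openin X U" "x \<in> U"
  then have "x \<in> topspace X" using openin_subset by blast
  then obtain U0 V0 where U0: "openin X U0" "x \<in> U0" and V0: "openin (half_space n) V0"
    and "subtopology X U0 homeomorphic_space subtopology (half_space n) V0"
    using assms unfolding manifold_with_boundary_def by blast
  then obtain h g where hg: "homeomorphic_maps (subtopology X U0) (subtopology (half_space n) V0) h g"
    by (auto simp: homeomorphic_space_def)
  have top: "topspace (subtopology X U0) = U0" "topspace (subtopology (half_space n) V0) = V0"
    using U0 V0 openin_subset by (auto simp: Int_absorb1)
  have h: "continuous_map (subtopology X U0) (subtopology (half_space n) V0) h"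
    and g: "continuous_map (subtopology (half_space n) V0) (subtopology X U0) g"
    and gh: "\<And>y. y \<in> U0 \<Longrightarrow> g (h y) = y" and hg': "\<And>y. y \<in> V0 \<Longrightarrow> h (g y) = y"
    using hg unfolding homeomorphic_maps_def top by blast+
  have hV: "h y \<in> V0" if "y \<in> U0" for y
    using continuous_map_funspace[OF h] that unfolding top by blast
  have gU: "g y \<in> U0" if "y \<in> V0" for y
    using continuous_map_funspace[OF g] that unfolding top by blast
  have "openin (subtopology (half_space n) V0) {y \<in> V0. g y \<in> U \<inter> U0}"
    using openin_continuous_map_preimage[OF g openin_subtopology_Int[OF U(1)]] unfolding top .
  then have o1: "openin (half_space n) {y \<in> V0. g y \<in> U \<inter> U0}"
    using V0 openin_trans_full by blast
  have o2: "h x \<in> {y \<in> V0. g y \<in> U \<inter> U0}" using U0 U gh hV by auto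
  obtain B where B: "openin (half_space n) B" "h x \<in> B" "B \<subseteq> {y \<in> V0. g y \<in> U \<inter> U0}" "pointwise_convex B"
    using half_space_convex_neighbourhood[OF o1 o2] by blast
  define V where "V = {y \<in> U0. h y \<in> B}"
  have BV0: "B \<subseteq> V0" and gB: "g ` B = V"
    using B(3) hg' gU gh by (auto simp: V_def) (metis imageI)
  have "openin (subtopology (half_space n) V0) B"
    using openin_open_subtopology[OF V0] B(1) BV0 by blast
  from openin_continuous_map_preimage[OF h this] have "openin (subtopology X U0) V"
    unfolding top V_def .
  then have V: "openin X V" using U0(1) openin_trans_full by blast
  have BS: "subtopology (half_space n) B = subtopology (powertop_real UNIV) B"
    using openin_subset[OF B(1)] unfolding half_space_eq by (simp add: subtopology_subtopology Int_absorb1)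
  have "continuous_map (subtopology (half_space n) V0) X g"
    using g continuous_map_in_subtopology by blast
  then have "continuous_map (subtopology (subtopology (half_space n) V0) B) X g"
    by (rule continuous_map_from_subtopology)
  then have g': "continuous_map (subtopology (powertop_real UNIV) B) X g"
    using BV0 by (simp add: subtopology_subtopology Int_absorb1 BS)
  have "continuous_map (subtopology (subtopology X U0) V) (half_space n) h"
    using h continuous_map_in_subtopology continuous_map_from_subtopology by blast
  moreover have "subtopology (subtopology X U0) V = subtopology X V"
    by (simp add: subtopology_subtopology V_def Int_absorb1 subset_iff)
  ultimately have h': "continuous_map (subtopology X V) (subtopology (powertop_real UNIV) B) h"
    unfolding BS[symmetric] by (auto simp: continuous_map_in_subtopology V_def)
  have "path_connectedin X V" "paths_homotopic_in X V"
    using homeomorphic_convex_imp_simple[OF B(4) g' h' _ gB] gh by (auto simp: V_def)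
  moreover have "x \<in> V" "V \<subseteq> U" using U0 U B gh by (auto simp: V_def)
  ultimately show "\<exists>V. openin X V \<and> x \<in> V \<and> V \<subseteq> U \<and> path_connectedin X V \<and> paths_homotopic_in X V"
    using V by blast
qed

lemma connected_locally_simple_imp_path_connected:
  assumes "connected_space X" "locally_simple X"
  shows "path_connected_space X"
proof -
  have "locally_path_connected_space X"
    unfolding locally_path_connected_space_def neighbourhood_base_of
    using assms(2) unfolding locally_simple_def by (metis order_refl)
  then show ?thesis using assms(1) path_connected_eq_connected_space by blast
qed

lemma compact_space_finite_subcover:
  assumes "compact_space X" and U: "\<And>x. x \<in> topspace X \<Longrightarrow> openin X (U x) \<and> x \<in> U x"
  obtains F where "finite F" "F \<subseteq> topspace X" "topspace X \<subseteq> (\<Union>x\<in>F. U x)"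
proof -
  have "\<forall>S\<in>U ` topspace X. openin X S" "topspace X \<subseteq> \<Union>(U ` topspace X)" using U by auto
  then obtain \<F> where \<F>: "finite \<F>" "\<F> \<subseteq> U ` topspace X" "topspace X \<subseteq> \<Union>\<F>"
    using assms(1) unfolding compact_space_alt by meson
  obtain F where "F \<subseteq> topspace X" "finite F" "\<F> = U ` F" using finite_subset_image[OF \<F>(1,2)] by blast
  then show ?thesis using that \<F>(3) by blast
qed

text \<open>A barycentric refinement of a cover by sets whose paths are determined up to homotopy by their ends.\<close>

lemma good_cover_exists:
  assumes X: "compact_space X" "Hausdorff_space X" "locally_simple X"
  shows "\<exists>\<W>. finite \<W> \<and> \<Union>\<W> = topspace X \<and> (\<forall>W\<in>\<W>. openin X W \<and> W \<noteq> {} \<and> path_connectedin X W) \<and>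
    (\<forall>z\<in>topspace X. paths_homotopic_in X (\<Union>{W\<in>\<W>. z \<in> W}))"
proof -
  have "\<exists>V. openin X V \<and> x \<in> V \<and> paths_homotopic_in X V" if "x \<in> topspace X" for x
    using X(3) that unfolding locally_simple_def by (metis openin_topspace)
  then obtain V where V: "\<And>x. x \<in> topspace X \<Longrightarrow> openin X (V x) \<and> x \<in> V x \<and> paths_homotopic_in X (V x)" by metis
  have "neighbourhood_base_of (closedin X) X"
    using X compact_Hausdorff_imp_regular_space by (simp add: neighbourhood_base_of_closedin)
  then have "\<exists>U K. openin X U \<and> closedin X K \<and> x \<in> U \<and> U \<subseteq> K \<and> K \<subseteq> V x" if "x \<in> topspace X" for x
    using V[OF that] unfolding neighbourhood_base_of by metis
  then obtain U K where UK: "\<And>x. x \<in> topspace X \<Longrightarrow> openin X (U x) \<and> closedin X (K x) \<and> x \<in> U x \<and> U x \<subseteq> K x \<and> K x \<subseteq> V x"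
    by metis
  obtain F where F: "finite F" "F \<subseteq> topspace X" "topspace X \<subseteq> (\<Union>x\<in>F. U x)"
    using compact_space_finite_subcover[OF X(1), of U] UK by blast
  \<comment> \<open>A neighbourhood of \<open>y\<close> inside every \<open>V x\<close> that
    contains \<open>y\<close> and off every \<open>K x\<close> that misses \<open>y\<close>, for
    \<open>x\<close> in \<open>F\<close>. If a point of \<open>K x\<close> lies in
    \<open>D y\<close>, then \<open>y\<close> is in \<open>K x\<close>, hence in \<open>V x\<close>,
    and \<open>D y\<close> lies in \<open>V x\<close>; so the star of that point does too.\<close>
  define D where "D y = topspace X \<inter> \<Inter>(V ` {x\<in>F. y \<in> V x}) \<inter> \<Inter>((\<lambda>x. topspace X - K x) ` {x\<in>F. y \<notin> K x})" for y
  have DV: "D y \<subseteq> V x" if "x \<in> F" "y \<in> V x" for x y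
    using that unfolding D_def by blast
  have DK: "z \<notin> D y" if "x \<in> F" "y \<notin> K x" "z \<in> K x" for x y z
    using that unfolding D_def by blast
  have D: "openin X (D y)" "y \<in> D y" if "y \<in> topspace X" for y
  proof -
    have "openin X (topspace X \<inter> \<Inter>((\<lambda>x. V x) ` {x\<in>F. y \<in> V x} \<union> (\<lambda>x. topspace X - K x) ` {x\<in>F. y \<notin> K x}))"
    proof (intro openin_Int_Inter)
      have "openin X (V x)" "openin X (topspace X - K x)" if "x \<in> F" for x
        using V UK F(2) that by (blast intro: openin_diff openin_topspace)+
      then show "openin X S" if "S \<in> V ` {x\<in>F. y \<in> V x} \<union> (\<lambda>x. topspace X - K x) ` {x\<in>F. y \<notin> K x}" for S
        using that by auto
    qed (use F(1) in auto)
    then show "openin X (D y)" by (simp add: D_def Inter_Un_distrib Int_assoc)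
    show "y \<in> D y" using that by (auto simp: D_def)
  qed
  have "\<exists>W. openin X W \<and> y \<in> W \<and> W \<subseteq> D y \<and> path_connectedin X W" if "y \<in> topspace X" for y
    using X(3) D[OF that] unfolding locally_simple_def by metis
  then obtain W where W: "\<And>y. y \<in> topspace X \<Longrightarrow> openin X (W y) \<and> y \<in> W y \<and> W y \<subseteq> D y \<and> path_connectedin X (W y)" by metis
  obtain F' where F': "finite F'" "F' \<subseteq> topspace X" "topspace X \<subseteq> (\<Union>x\<in>F'. W x)"
    using compact_space_finite_subcover[OF X(1), of W] W by blast
  have "paths_homotopic_in X (\<Union>{S\<in>W ` F'. z \<in> S})" if z: "z \<in> topspace X" for z
  proof -
    obtain x where x: "x \<in> F" "z \<in> U x" using F z by blast
    have zK: "z \<in> K x" using UK x F by blast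
    have "W y \<subseteq> V x" if y: "y \<in> F'" "z \<in> W y" for y
    proof -
      have "z \<in> D y" "W y \<subseteq> D y" using W y F' by blast+
      then have "y \<in> K x" using zK x(1) DK by blast
      then have "y \<in> V x" using UK x(1) F by blast
      then show ?thesis using \<open>W y \<subseteq> D y\<close> x(1) DV by blast
    qed
    then have "\<Union>{S\<in>W ` F'. z \<in> S} \<subseteq> V x" by blast
    then show ?thesis using V x(1) F paths_homotopic_in_mono by blast
  qed
  moreover have W': "openin X (W y) \<and> y \<in> W y \<and> path_connectedin X (W y)" if "y \<in> F'" for y
    using W[of y] that F'(2) by blast
  then have "W y \<subseteq> topspace X" if "y \<in> F'" for y using that openin_subset by metis
  then have "\<Union>(W ` F') = topspace X" using F'(3) by blast
  moreover have "\<forall>S\<in>W ` F'. openin X S \<and> S \<noteq> {} \<and> path_connectedin X S" using W' by blast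
  ultimately show ?thesis using F'(1) by (intro exI[of _ "W ` F'"]) blast
qed

section \<open>Holonomy of local systems\<close>

text \<open>Integrate the cocycle along the segments from the origin.\<close>

lemma convex_cocycle_trivial:
  fixes S :: "'v::real_normed_vector set" and Q (structure) and \<mu> :: "'v \<Rightarrow> 'v \<Rightarrow> 'q"
  assumes Q: "group Q" and S: "convex S" "0 \<in> S" "bounded S" and \<delta>: "\<delta> > 0"
    and \<mu>: "\<And>a b. a \<in> S \<Longrightarrow> b \<in> S \<Longrightarrow> dist a b < \<delta> \<Longrightarrow> \<mu> a b \<in> carrier Q"
    and cocycle: "\<And>a b c. a \<in> S \<Longrightarrow> b \<in> S \<Longrightarrow> c \<in> S \<Longrightarrow> dist a b < \<delta> \<Longrightarrow> dist b c < \<delta> \<Longrightarrow> dist a c < \<delta> \<Longrightarrow>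
      \<mu> a b \<otimes> \<mu> b c = \<mu> a c"
  shows "\<exists>F. (\<forall>a\<in>S. F a \<in> carrier Q) \<and> (\<forall>a\<in>S. \<forall>b\<in>S. dist a b < \<delta> / 2 \<longrightarrow> F b = F a \<otimes> \<mu> a b)"
proof -
  interpret group Q by (rule Q)
  obtain R where R: "\<And>x. x \<in> S \<Longrightarrow> norm x \<le> R" using S(3) by (auto simp: bounded_iff)
  \<comment> \<open>Points of \<open>S\<close> have norm at most \<open>R\<close>, so cutting the
    segment from the origin into \<open>n\<close> equal pieces gives pieces shorter than
    \<open>\<delta> / 2\<close>.\<close>
  obtain n :: nat where n: "n > 0" "R / real n < \<delta> / 2"
  proof -
    obtain n :: nat where "2 * R / \<delta> < real n" using reals_Archimedean2 by blast
    then have "R < \<delta> / 2 * real (Suc n)" using \<delta> by (simp add: field_simps)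
    then show ?thesis using that[of "Suc n"] by (simp add: pos_divide_less_eq)
  qed
  define pt where "pt k a = (real k / real n) *\<^sub>R a" for k and a :: 'v
  have pt: "pt k a \<in> S" if "a \<in> S" "k \<le> n" for k a
  proof -
    have "(1 - real k / real n) *\<^sub>R 0 + (real k / real n) *\<^sub>R a \<in> S"
      using that n S by (intro convexD) (auto simp: field_simps)
    then show ?thesis by (simp add: pt_def)
  qed
  have dist_pt: "dist (pt k a) (pt k b) \<le> dist a b" if "k \<le> n" for k a b
  proof -
    have "dist (pt k a) (pt k b) = (real k / real n) * dist a b"
      by (simp add: pt_def dist_norm flip: scaleR_diff_right)
    also have "\<dots> \<le> 1 * dist a b" using that n by (intro mult_right_mono) (auto simp: field_simps)
    finally show ?thesis by simp
  qed
  have dist_step: "dist (pt k a) (pt (Suc k) a) < \<delta> / 2" if "a \<in> S" for k a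
  proof -
    have "pt (Suc k) a - pt k a = (1 / real n) *\<^sub>R a"
      by (simp add: pt_def add_divide_distrib flip: scaleR_diff_left)
    then have "norm (pt (Suc k) a - pt k a) = norm a / real n" by simp
    then have "dist (pt k a) (pt (Suc k) a) = norm a / real n"
      unfolding dist_norm by (simp only: norm_minus_commute)
    also have "\<dots> \<le> R / real n" using R[OF that] n by (simp add: divide_right_mono)
    finally show ?thesis using n(2) by (rule le_less_trans)
  qed
  define F where "F = rec_nat (\<lambda>a. \<one>) (\<lambda>k G a. G a \<otimes> \<mu> (pt k a) (pt (Suc k) a))"
  have F0: "F 0 a = \<one>" and FS: "F (Suc k) a = F k a \<otimes> \<mu> (pt k a) (pt (Suc k) a)" for k a
    by (simp_all add: F_def)
  have step_closed: "\<mu> (pt k a) (pt (Suc k) a) \<in> carrier Q" if "a \<in> S" "Suc k \<le> n" for k a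
    using dist_step[OF that(1), of k] \<delta> that pt by (intro \<mu>) auto
  have closed: "F k a \<in> carrier Q" if "a \<in> S" "k \<le> n" for k a
    using that(2) by (induction k) (use that(1) step_closed in \<open>auto simp: F0 FS\<close>)
  \<comment> \<open>Compares the segments to \<open>a\<close> and to \<open>b\<close> rung by rung.
    Each quadrilateral is cut by a diagonal into two triangles of the cocycle relation; sides below
    \<open>\<delta> / 2\<close> keep the diagonal below \<open>\<delta>\<close>.\<close>
  have ladder: "F k b = F k a \<otimes> \<mu> (pt k a) (pt k b)"
    if a: "a \<in> S" and b: "b \<in> S" and ab: "dist a b < \<delta> / 2" and k: "k \<le> n" for k a b
    using k
  proof (induction k)
    case 0
    have "\<mu> 0 0 \<otimes> \<mu> 0 0 = \<mu> 0 0" "\<mu> 0 0 \<in> carrier Q" using S \<delta> cocycle[of 0 0 0] \<mu>[of 0 0] by auto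
    then have "\<mu> 0 0 = \<one>" using l_cancel_one by blast
    then show ?case by (simp add: F0 pt_def)
  next
    case (Suc k)
    note pts = pt[OF a, of k] pt[OF b, of k] pt[OF a, of "Suc k"] pt[OF b, of "Suc k"]
    have d: "dist (pt k a) (pt k b) < \<delta> / 2" "dist (pt (Suc k) a) (pt (Suc k) b) < \<delta> / 2"
      using dist_pt[of k a b] dist_pt[of "Suc k" a b] ab Suc.prems by auto
    note s = dist_step[OF a, of k] dist_step[OF b, of k]
    have d2: "dist (pt k a) (pt (Suc k) b) < \<delta>"
      using dist_triangle[of "pt k a" "pt (Suc k) b" "pt k b"] d s by linarith
    have c: "\<mu> (pt k a) (pt k b) \<in> carrier Q" "\<mu> (pt k b) (pt (Suc k) b) \<in> carrier Q"
      "\<mu> (pt k a) (pt (Suc k) a) \<in> carrier Q" "\<mu> (pt (Suc k) a) (pt (Suc k) b) \<in> carrier Q"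
      using pts d s Suc.prems \<delta> by (auto intro!: \<mu>)
    have "F (Suc k) b = F k a \<otimes> \<mu> (pt k a) (pt k b) \<otimes> \<mu> (pt k b) (pt (Suc k) b)"
      using Suc by (simp add: FS)
    also have "\<dots> = F k a \<otimes> (\<mu> (pt k a) (pt k b) \<otimes> \<mu> (pt k b) (pt (Suc k) b))"
      using c closed[OF a, of k] Suc.prems by (simp add: m_assoc)
    also have "\<mu> (pt k a) (pt k b) \<otimes> \<mu> (pt k b) (pt (Suc k) b) = \<mu> (pt k a) (pt (Suc k) b)"
      using pts d s d2 Suc.prems \<delta> by (intro cocycle) auto
    also have "\<dots> = \<mu> (pt k a) (pt (Suc k) a) \<otimes> \<mu> (pt (Suc k) a) (pt (Suc k) b)"
      using pts d s d2 Suc.prems \<delta> by (intro cocycle[symmetric]) auto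
    also have "F k a \<otimes> (\<mu> (pt k a) (pt (Suc k) a) \<otimes> \<mu> (pt (Suc k) a) (pt (Suc k) b)) =
        F (Suc k) a \<otimes> \<mu> (pt (Suc k) a) (pt (Suc k) b)"
      using c closed[OF a, of k] Suc.prems by (simp add: FS m_assoc)
    finally show ?case .
  qed
  have "pt n a = a" for a using n by (simp add: pt_def)
  then show ?thesis using closed ladder[where k = n] by (intro exI[of _ "F n"]) auto
qed

lemma Lebesgue_number_preimage:
  fixes S :: "'v::metric_space set"
  assumes S: "compact S" and h: "continuous_map (top_of_set S) X h"
    and U: "\<And>U. U \<in> \<U> \<Longrightarrow> openin X U" "topspace X \<subseteq> \<Union>\<U>"
  obtains \<delta> where "\<delta> > 0" "\<And>T. T \<subseteq> S \<Longrightarrow> T \<noteq> {} \<Longrightarrow> diameter T < \<delta> \<Longrightarrow> \<exists>U\<in>\<U>. h ` T \<subseteq> U"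
proof -
  have "\<exists>V. open V \<and> {x\<in>S. h x \<in> U} = S \<inter> V" if "U \<in> \<U>" for U
    using openin_continuous_map_preimage[OF h U(1)[OF that]] by (auto simp: openin_open)
  then obtain V where V: "\<And>U. U \<in> \<U> \<Longrightarrow> open (V U) \<and> {x\<in>S. h x \<in> U} = S \<inter> V U" by metis
  show ?thesis
  proof (cases "S = {}")
    case True
    then show ?thesis using that[of 1] by auto
  next
    case False
    have hS: "h x \<in> topspace X" if "x \<in> S" for x using continuous_map_funspace[OF h] that by auto
    have cov: "S \<subseteq> \<Union>(V ` \<U>)"
    proof
      fix x assume x: "x \<in> S"
      then obtain U where "U \<in> \<U>" "h x \<in> U" using hS U(2) by blast
      then show "x \<in> \<Union>(V ` \<U>)" using V x by blast
    qed
    then have "V ` \<U> \<noteq> {}" using False by auto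
    from Lebesgue_number_lemma[OF S this cov]
    obtain \<delta> where \<delta>: "0 < \<delta>" "\<And>T. T \<subseteq> S \<Longrightarrow> diameter T < \<delta> \<Longrightarrow> \<exists>B\<in>V ` \<U>. T \<subseteq> B" using V by blast
    show ?thesis
    proof (rule that[OF \<delta>(1)])
      fix T assume T: "T \<subseteq> S" "diameter T < \<delta>"
      then obtain U where "U \<in> \<U>" "T \<subseteq> V U" using \<delta>(2) by blast
      then show "\<exists>U\<in>\<U>. h ` T \<subseteq> U" using V T(1) by blast
    qed
  qed
qed

lemma diameter_triple:
  fixes a b c :: "'v::metric_space"
  assumes "dist a b < \<delta>" "dist b c < \<delta>" "dist a c < \<delta>"
  shows "diameter {a, b, c} < \<delta>"
proof -
  have "0 < \<delta>" using assms(1) zero_le_dist[of a b] by linarith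
  define m where "m = Max {dist a b, dist b c, dist a c}"
  have "diameter {a, b, c} \<le> m"
    unfolding diameter_def
    by (simp only: insert_not_empty if_False, rule cSUP_least) (auto simp: m_def dist_commute le_max_iff_disj)
  also have "m < \<delta>" using assms by (simp add: m_def)
  finally show ?thesis .
qed

text \<open>A flat bundle with group \<open>Q\<close> over \<open>X\<close>:
  \<open>\<tau> x y\<close> is parallel transport between points of a common cover member. No
  continuity is imposed, since \<open>Q\<close> is discrete and frames may vary arbitrarily from
  point to point.\<close>

locale local_system =
  fixes X :: "'x topology" and \<U> :: "'x set set" and Q (structure) and \<tau> :: "'x \<Rightarrow> 'x \<Rightarrow> 'q"
  assumes group_Q: "group Q"
    and cover: "\<And>U. U \<in> \<U> \<Longrightarrow> openin X U" "topspace X \<subseteq> \<Union>\<U>"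
    and \<tau>_closed: "\<And>U x y. U \<in> \<U> \<Longrightarrow> x \<in> U \<Longrightarrow> y \<in> U \<Longrightarrow> \<tau> x y \<in> carrier Q"
    and \<tau>_mult: "\<And>U x y z. U \<in> \<U> \<Longrightarrow> x \<in> U \<Longrightarrow> y \<in> U \<Longrightarrow> z \<in> U \<Longrightarrow> \<tau> x y \<otimes> \<tau> y z = \<tau> x z"
begin

interpretation group Q by (rule group_Q)

text \<open>A parallel section along \<open>h\<close>. Nearness is measured in the domain, so that
  lifts restrict along Lipschitz maps.\<close>

definition lift :: "'v::metric_space set \<Rightarrow> ('v \<Rightarrow> 'x) \<Rightarrow> ('v \<Rightarrow> 'q) \<Rightarrow> bool" where
  "lift S h F \<longleftrightarrow> (\<forall>a\<in>S. F a \<in> carrier Q) \<and>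
     (\<exists>\<delta>>0. \<forall>a\<in>S. \<forall>b\<in>S. dist a b < \<delta> \<longrightarrow> F b = F a \<otimes> \<tau> (h a) (h b))"

lemma lift_exists:
  fixes S :: "'v::real_normed_vector set"
  assumes S: "convex S" "0 \<in> S" "compact S" and h: "continuous_map (top_of_set S) X h"
  shows "\<exists>F. lift S h F"
proof -
  obtain \<delta> where \<delta>: "\<delta> > 0" "\<And>T. T \<subseteq> S \<Longrightarrow> T \<noteq> {} \<Longrightarrow> diameter T < \<delta> \<Longrightarrow> \<exists>U\<in>\<U>. h ` T \<subseteq> U"
    using Lebesgue_number_preimage[OF S(3) h cover] by blast
  have triple: "\<exists>U\<in>\<U>. h a \<in> U \<and> h b \<in> U \<and> h c \<in> U"
    if "a \<in> S" "b \<in> S" "c \<in> S" "dist a b < \<delta>" "dist b c < \<delta>" "dist a c < \<delta>" for a b c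
    using \<delta>(2)[of "{a, b, c}"] that diameter_triple by fastforce
  have "\<tau> (h a) (h b) \<in> carrier Q" if "a \<in> S" "b \<in> S" "dist a b < \<delta>" for a b
    using triple[of a b b] that \<delta>(1) \<tau>_closed by fastforce
  moreover have "\<tau> (h a) (h b) \<otimes> \<tau> (h b) (h c) = \<tau> (h a) (h c)"
    if "a \<in> S" "b \<in> S" "c \<in> S" "dist a b < \<delta>" "dist b c < \<delta>" "dist a c < \<delta>" for a b c
    using triple[OF that] \<tau>_mult by blast
  ultimately obtain F where "\<forall>a\<in>S. F a \<in> carrier Q"
    "\<forall>a\<in>S. \<forall>b\<in>S. dist a b < \<delta> / 2 \<longrightarrow> F b = F a \<otimes> \<tau> (h a) (h b)"
    using convex_cocycle_trivial[OF group_Q S(1,2) compact_imp_bounded[OF S(3)] \<delta>(1), of "\<lambda>a b. \<tau> (h a) (h b)"] by blast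
  then show ?thesis unfolding lift_def using \<delta>(1) half_gt_zero by blast
qed

lemma lift_closed: "lift S h F \<Longrightarrow> a \<in> S \<Longrightarrow> F a \<in> carrier Q"
  by (simp add: lift_def)

lemma lift_compose:
  assumes F: "lift S h F" and g: "g ` T \<subseteq> S" "L > 0" "\<And>a b. a \<in> T \<Longrightarrow> b \<in> T \<Longrightarrow> dist (g a) (g b) \<le> L * dist a b"
    and k: "\<And>a. a \<in> T \<Longrightarrow> h (g a) = k a"
  shows "lift T k (F \<circ> g)"
proof -
  obtain \<delta> where \<delta>: "\<delta> > 0" "\<And>a b. a \<in> S \<Longrightarrow> b \<in> S \<Longrightarrow> dist a b < \<delta> \<Longrightarrow> F b = F a \<otimes> \<tau> (h a) (h b)"
    using F unfolding lift_def by blast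
  have "(F \<circ> g) b = (F \<circ> g) a \<otimes> \<tau> (k a) (k b)" if "a \<in> T" "b \<in> T" "dist a b < \<delta> / L" for a b
  proof -
    have "dist (g a) (g b) < \<delta>"
      using g(3)[OF that(1,2)] that(3) g(2) by (simp add: field_simps)
    moreover have "g a \<in> S" "g b \<in> S" using g(1) that by auto
    ultimately show ?thesis using \<delta>(2)[of "g a" "g b"] k that by simp
  qed
  moreover have "\<delta> / L > 0" using \<delta>(1) g(2) by simp
  moreover have "\<forall>a\<in>T. (F \<circ> g) a \<in> carrier Q" using lift_closed[OF F] g(1) by auto
  ultimately show ?thesis unfolding lift_def by blast
qed

text \<open>In each short step \<open>F\<close> and \<open>G\<close> are multiplied on the right by
  the same \<open>\<tau>\<close>, so they differ by a constant left factor, which drops out of the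
  quotient of the end values.\<close>

lemma lift_unique:
  assumes F: "lift {0..1::real} p F" and G: "lift {0..1} p G" and p: "pathin X p"
  shows "inv F 0 \<otimes> F 1 = inv G 0 \<otimes> G 1"
proof -
  obtain \<delta> where \<delta>: "\<delta> > 0" "\<And>a b. a \<in> {0..1} \<Longrightarrow> b \<in> {0..1} \<Longrightarrow> dist a b < \<delta> \<Longrightarrow> F b = F a \<otimes> \<tau> (p a) (p b)"
    using F unfolding lift_def by blast
  obtain \<epsilon> where \<epsilon>: "\<epsilon> > 0" "\<And>a b. a \<in> {0..1} \<Longrightarrow> b \<in> {0..1} \<Longrightarrow> dist a b < \<epsilon> \<Longrightarrow> G b = G a \<otimes> \<tau> (p a) (p b)"
    using G unfolding lift_def by blast
  have "continuous_map (top_of_set {0..1}) X p" using p by (simp add: pathin_def)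
  from Lebesgue_number_preimage[OF compact_Icc this cover]
  obtain \<eta> where \<eta>: "\<eta> > 0" "\<And>T. T \<subseteq> {0..1} \<Longrightarrow> T \<noteq> {} \<Longrightarrow> diameter T < \<eta> \<Longrightarrow> \<exists>U\<in>\<U>. p ` T \<subseteq> U" by blast
  have \<tau>c: "\<tau> (p a) (p b) \<in> carrier Q" if "a \<in> {0..1}" "b \<in> {0..1}" "dist a b < \<eta>" for a b
  proof -
    have "diameter {a, b, b} < \<eta>" by (rule diameter_triple) (use that \<eta>(1) in auto)
    moreover have "{a, b, b} \<subseteq> {0..1}" "{a, b, b} \<noteq> {}" using that by auto
    ultimately obtain U where "U \<in> \<U>" "p ` {a, b, b} \<subseteq> U" using \<eta>(2) by meson
    then show ?thesis using \<tau>_closed by blast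
  qed
  \<comment> \<open>\<open>\<delta>\<close> and \<open>\<epsilon>\<close> govern the two lifts;
    \<open>\<eta>\<close> keeps consecutive points in a common cover member, where
    \<open>\<tau>\<close> takes values in the group.\<close>
  obtain n :: nat where n: "n > 0" "1 / real n < min \<delta> (min \<epsilon> \<eta>)"
    using \<delta>(1) \<epsilon>(1) \<eta>(1) real_arch_invD[of "min \<delta> (min \<epsilon> \<eta>)"] by (auto simp: inverse_eq_divide)
  have "inv F 0 \<otimes> F (real k / real n) = inv G 0 \<otimes> G (real k / real n)" if "k \<le> n" for k
    using that
  proof (induction k)
    case 0
    then show ?case using lift_closed[OF F] lift_closed[OF G] by simp
  next
    case (Suc k)
    let ?a = "real k / real n" and ?b = "real (Suc k) / real n"
    have ab: "?a \<in> {0..1}" "?b \<in> {0..1}" "dist ?a ?b < min \<delta> (min \<epsilon> \<eta>)"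
      using Suc.prems n by (auto simp: field_simps dist_real_def simp flip: diff_divide_distrib)
    then have "F ?b = F ?a \<otimes> \<tau> (p ?a) (p ?b)" "G ?b = G ?a \<otimes> \<tau> (p ?a) (p ?b)" "\<tau> (p ?a) (p ?b) \<in> carrier Q"
      using \<delta>(2)[OF ab(1,2)] \<epsilon>(2)[OF ab(1,2)] \<tau>c[OF ab(1,2)] by auto
    moreover have "F 0 \<in> carrier Q" "G 0 \<in> carrier Q" "F ?a \<in> carrier Q" "G ?a \<in> carrier Q"
      using lift_closed[OF F] lift_closed[OF G] ab by auto
    moreover have "inv F 0 \<otimes> F ?a = inv G 0 \<otimes> G ?a" using Suc by simp
    ultimately show ?case by (simp flip: m_assoc)
  qed
  from this[of n] show ?thesis using n by simp
qed

definition holonomy :: "(real \<Rightarrow> 'x) \<Rightarrow> 'q" where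
  "holonomy p = (let F = (SOME F. lift {0..1} p F) in inv F 0 \<otimes> F 1)"

lemma path_lift_exists: "pathin X p \<Longrightarrow> \<exists>F. lift {0..1::real} p F"
  by (rule lift_exists) (auto simp: pathin_def)

lemma holonomy_eq:
  assumes "pathin X p" "lift {0..1} p F"
  shows "holonomy p = inv F 0 \<otimes> F 1"
proof -
  have "lift {0..1} p (SOME F. lift {0..1} p F)"
    using someI[of "\<lambda>F. lift {0..1} p F", OF assms(2)] .
  from lift_unique[OF this assms(2,1)] show ?thesis by (simp add: holonomy_def Let_def)
qed

lemma holonomy_small:
  assumes p: "pathin X p" and U: "U \<in> \<U>" "p ` {0..1} \<subseteq> U"
  shows "holonomy p = \<tau> (p 0) (p 1)"
proof -
  have in_U: "p t \<in> U" if "t \<in> {0..1}" for t using U(2) that by auto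
  have c: "\<tau> (p s) (p t) \<in> carrier Q" if "s \<in> {0..1}" "t \<in> {0..1}" for s t
    using \<tau>_closed[OF U(1)] in_U that by blast
  have m: "\<tau> (p 0) (p s) \<otimes> \<tau> (p s) (p t) = \<tau> (p 0) (p t)" if "s \<in> {0..1}" "t \<in> {0..1}" for s t
    using that by (intro \<tau>_mult[OF U(1)] in_U) auto
  \<comment> \<open>Inside one member, transport from the starting point is itself a lift; the
    relation holds for all pairs of parameters, so any bound, here 1, will do.\<close>
  have "lift {0..1} p (\<lambda>t. \<tau> (p 0) (p t))"
    unfolding lift_def using c m by (intro conjI exI[of _ 1]) auto
  from holonomy_eq[OF p this] have "holonomy p = inv \<tau> (p 0) (p 0) \<otimes> \<tau> (p 0) (p 1)" .
  moreover have "\<tau> (p 0) (p 0) = \<one>" using m[of 0 0] c[of 0 0] by (simp add: l_cancel_one)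
  ultimately show ?thesis using c[of 0 1] by simp
qed

text \<open>Homotopy invariance comes from lifting the whole square: a lift takes equal values at
  the two ends of each side that is constant in \<open>X\<close>, so the sides over \<open>p\<close>
  and \<open>q\<close> have the same end values. Multiplicativity comes from restricting a lift of
  the join to its halves.\<close>

lemma path_functor_holonomy: "path_functor X Q holonomy"
  unfolding path_functor_def
proof (intro conjI allI impI)
  fix p assume p: "pathin X p"
  then obtain F where F: "lift {0..1} p F" using path_lift_exists by blast
  have "F 0 \<in> carrier Q" "F 1 \<in> carrier Q" using lift_closed[OF F] by auto
  then show "holonomy p \<in> carrier Q" unfolding holonomy_eq[OF p F] by simp
next
  fix p q assume h: "path_homotopic X p q"
  note pq = path_homotopic_imp_pathin[OF h]
  obtain H :: "real \<times> real \<Rightarrow> 'x" where H: "continuous_map (top_of_set ({0..1} \<times> {0..1})) X H"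
    "\<forall>t\<in>{0..1}. H (0, t) = p t" "\<forall>t\<in>{0..1}. H (1, t) = q t"
    "\<forall>s\<in>{0..1}. H (s, 0) = p 0 \<and> H (s, 1) = p 1"
    using h unfolding path_homotopic_iff by blast
  have "convex ({0..1} \<times> {0..1} :: (real \<times> real) set)" "(0 :: real \<times> real) \<in> {0..1} \<times> {0..1}"
    "compact ({0..1} \<times> {0..1} :: (real \<times> real) set)"
    by (auto intro: convex_Times compact_Times simp: zero_prod_def)
  from lift_exists[OF this H(1)] obtain F where F: "lift ({0..1} \<times> {0..1}) H F" by blast
  have hor: "lift {0..1} k (\<lambda>t. F (s, t))" if "s \<in> {0..1}" "\<And>t. t \<in> {0..1} \<Longrightarrow> H (s, t) = k t" for s k
  proof -
    have "lift {0..1} k (F \<circ> (\<lambda>t. (s, t)))"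
      by (rule lift_compose[OF F, of _ _ 1]) (use that in \<open>auto simp: dist_prod_def\<close>)
    then show ?thesis by (simp add: o_def)
  qed
  have ver: "lift {0..1} k (\<lambda>s. F (s, t))" if "t \<in> {0..1}" "\<And>s. s \<in> {0..1} \<Longrightarrow> H (s, t) = k s" for t k
  proof -
    have "lift {0..1} k (F \<circ> (\<lambda>s. (s, t)))"
      by (rule lift_compose[OF F, of _ _ 1]) (use that in \<open>auto simp: dist_prod_def\<close>)
    then show ?thesis by (simp add: o_def)
  qed
  have const: "G 0 = G 1" if G: "lift {0..1::real} (\<lambda>s. x) G" and x: "x \<in> topspace X" for G x
  proof -
    obtain U where U: "U \<in> \<U>" "x \<in> U" using x cover(2) by blast
    have "\<tau> x x = \<one>" using \<tau>_mult[OF U(1) U(2) U(2) U(2)] \<tau>_closed[OF U(1) U(2) U(2)] by (simp add: l_cancel_one)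
    then have "holonomy (\<lambda>s. x) = \<one>" using holonomy_small[of "\<lambda>s. x" U] U x by auto
    then have "inv G 0 \<otimes> G 1 = \<one>" using holonomy_eq[of "\<lambda>s. x" G] G x by simp
    moreover have "G 0 \<in> carrier Q" "G 1 \<in> carrier Q" using lift_closed[OF G] by auto
    ultimately show ?thesis by (metis inv_closed inv_equality inv_inv)
  qed
  have "F (0, 0) = F (1, 0)"
    by (rule const[OF ver[of 0 "\<lambda>s. p 0"]]) (use H(4) path_start_in_topspace[OF pq(1)] in auto)
  moreover have "F (0, 1) = F (1, 1)"
    by (rule const[OF ver[of 1 "\<lambda>s. p 1"]]) (use H(4) path_finish_in_topspace[OF pq(1)] in auto)
  moreover have "holonomy p = inv F (0, 0) \<otimes> F (0, 1)"
    using holonomy_eq[OF pq(1) hor[of 0 p]] H(2) by simp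
  moreover have "holonomy q = inv F (1, 0) \<otimes> F (1, 1)"
    using holonomy_eq[OF pq(2) hor[of 1 q]] H(3) by simp
  ultimately show "holonomy p = holonomy q" by simp
next
  fix p q assume p: "pathin X p" and q: "pathin X q" and pq: "p 1 = q 0"
  obtain F where F: "lift {0..1} (path_join p q) F"
    using path_lift_exists[OF pathin_join[OF p q pq]] by blast
  have "lift {0..1} p (F \<circ> (\<lambda>t. t / 2))"
    by (rule lift_compose[OF F, of _ _ 1]) (auto simp: path_join_def dist_real_def)
  from holonomy_eq[OF p this] have 1: "holonomy p = inv F 0 \<otimes> F (1/2)" by simp
  have "lift {0..1} q (F \<circ> (\<lambda>t. 1/2 + t / 2))"
    by (rule lift_compose[OF F, of _ _ 1]) (auto simp: path_join_def dist_real_def pq)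
  from holonomy_eq[OF q this] have 2: "holonomy q = inv F (1/2) \<otimes> F 1" by simp
  have "F 0 \<in> carrier Q" "F (1/2) \<in> carrier Q" "F 1 \<in> carrier Q" using lift_closed[OF F] by auto
  then have "inv F 0 \<otimes> F 1 = (inv F 0 \<otimes> F (1/2)) \<otimes> (inv F (1/2) \<otimes> F 1)"
    by (simp add: m_assoc) (simp flip: m_assoc)
  then show "holonomy (path_join p q) = holonomy p \<otimes> holonomy q"
    using holonomy_eq[OF pathin_join[OF p q pq] F] 1 2 by simp
qed

end

text \<open>By a Lebesgue number every path is homotopic to a join of short ones, each inside a
  cover member. This is the uniqueness half of van Kampen.\<close>

lemma path_functor_eqI:
  assumes w: "path_functor X Q w" and v: "path_functor X Q v" and Q: "group Q"
    and cover: "\<And>U. U \<in> \<U> \<Longrightarrow> openin X U" "topspace X \<subseteq> \<Union>\<U>"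
    and small: "\<And>U p. U \<in> \<U> \<Longrightarrow> pathin X p \<Longrightarrow> p ` {0..1} \<subseteq> U \<Longrightarrow> w p = v p"
    and p: "pathin X p"
  shows "w p = v p"
proof -
  have cont: "continuous_map (top_of_set {0..1}) X p" using p by (simp add: pathin_def)
  obtain \<delta> where \<delta>: "\<delta> > 0" "\<And>T. T \<subseteq> {0..1} \<Longrightarrow> T \<noteq> {} \<Longrightarrow> diameter T < \<delta> \<Longrightarrow> \<exists>U\<in>\<U>. p ` T \<subseteq> U"
    using Lebesgue_number_preimage[OF compact_Icc cont cover] by blast
  obtain n :: nat where n: "n > 0" "1 / real n < \<delta>"
    using \<delta>(1) real_arch_invD[of \<delta>] by (auto simp: inverse_eq_divide)
  define seg where "seg a b = p \<circ> (\<lambda>r. a + r * (b - a))" for a b :: real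
  have im: "(\<lambda>r. a + r * (b - a)) ` {0..1} \<subseteq> {a..b}" if "a \<le> b" for a b :: real
  proof clarsimp
    fix r :: real assume "0 \<le> r" "r \<le> 1"
    then have "r * (b - a) \<le> b - a" "0 \<le> r * (b - a)" using that mult_right_mono[of r 1 "b - a"] by auto
    then show "0 \<le> r * (b - a) \<and> a + r * (b - a) \<le> b" by simp
  qed
  have path: "pathin X (seg a b)" if "0 \<le> a" "a \<le> b" "b \<le> 1" for a b
    unfolding seg_def using im[OF that(2)] that
    by (intro pathin_through_interval[OF p] continuous_intros) auto
  have join: "path_homotopic X (seg 0 b) (path_join (seg 0 a) (seg a b))" if "0 \<le> a" "a \<le> b" "b \<le> 1" for a b
  proof -
    let ?u = "\<lambda>r. 0 + r * (a - 0)" and ?v = "\<lambda>r. a + r * (b - a)"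
    have "pathin (top_of_set {0..1}) (path_join ?u ?v)"
      using im[of 0 a] im[of a b] that
      by (intro pathin_join) (auto simp: pathin_canon_iff path_def intro!: continuous_intros)
    then have j: "continuous_on {0..1} (path_join ?u ?v)" "path_join ?u ?v ` {0..1} \<subseteq> {0..1}"
      by (auto simp: pathin_canon_iff path_def)
    have "path_homotopic X (p \<circ> (\<lambda>r. 0 + r * (b - 0))) (p \<circ> path_join ?u ?v)"
      using im[of 0 b] that by (intro path_homotopic_through_interval[OF p] j continuous_intros) auto
    then show ?thesis by (simp add: seg_def path_join_compose)
  qed
  have "w (seg 0 (real k / real n)) = v (seg 0 (real k / real n))" if "k \<le> n" for k
    using that
  proof (induction k)
    case 0
    have "seg 0 0 = (\<lambda>t. p 0)" by (auto simp: seg_def)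
    then show ?case
      using path_functor_const[OF w Q] path_functor_const[OF v Q] path_start_in_topspace[OF p] by simp
  next
    case (Suc k)
    let ?a = "real k / real n" and ?b = "real (Suc k) / real n"
    have ab: "0 \<le> ?a" "?a \<le> ?b" "?b \<le> 1" using Suc.prems n by (auto simp: field_simps)
    have "?b - ?a < \<delta>" using n by (simp flip: diff_divide_distrib)
    then have "diameter {?a..?b} < \<delta>" using ab by (simp add: diameter_closed_interval)
    moreover have "{?a..?b} \<subseteq> {0..1}" "{?a..?b} \<noteq> {}" using ab by auto
    ultimately obtain U where U: "U \<in> \<U>" "p ` {?a..?b} \<subseteq> U" using \<delta>(2) by blast
    have "seg ?a ?b ` {0..1} \<subseteq> U" using im[OF ab(2)] U(2) unfolding seg_def image_comp[symmetric] by blast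
    then have 1: "w (seg ?a ?b) = v (seg ?a ?b)" by (rule small[OF U(1) path[OF ab]])
    have a0: "0 \<le> ?a" "?a \<le> 1" using ab by auto
    have ends: "seg 0 ?a 1 = seg ?a ?b 0" by (simp add: seg_def)
    have *: "f (seg 0 ?b) = f (seg 0 ?a) \<otimes>\<^bsub>Q\<^esub> f (seg ?a ?b)" if f: "path_functor X Q f" for f
      using path_functorD(2)[OF f join[OF ab]]
        path_functorD(3)[OF f path[OF order_refl a0] path[OF ab] ends] by simp
    show ?case using *[OF w] *[OF v] 1 Suc by simp
  qed
  from this[of n] have "w (seg 0 1) = v (seg 0 1)" using n by simp
  moreover have "seg 0 1 = p" by (auto simp: seg_def)
  ultimately show ?thesis by simp
qed

section \<open>Fundamental groups of compact manifolds are finitely presented\<close>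

text \<open>A change of frame; \<open>d\<close> may be an arbitrary function of points, since it is
  seen only at the ends of paths.\<close>

lemma path_functor_conjugate:
  fixes Q (structure)
  assumes w: "path_functor X Q w" and Q: "group Q" and d: "\<And>x. x \<in> topspace X \<Longrightarrow> d x \<in> carrier Q"
  shows "path_functor X Q (\<lambda>p. d (p 0) \<otimes> w p \<otimes> inv d (p 1))"
  unfolding path_functor_def
proof (intro conjI allI impI)
  interpret group Q by (rule Q)
  have c: "d (p 0) \<in> carrier Q" "d (p 1) \<in> carrier Q" "w p \<in> carrier Q" if "pathin X p" for p
    using d path_start_in_topspace[OF that] path_finish_in_topspace[OF that] path_functorD(1)[OF w that] by auto
  show "d (p 0) \<otimes> w p \<otimes> inv d (p 1) \<in> carrier Q" if "pathin X p" for p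
    using c[OF that] by simp
  show "d (p 0) \<otimes> w p \<otimes> inv d (p 1) = d (q 0) \<otimes> w q \<otimes> inv d (q 1)" if "path_homotopic X p q" for p q
    using path_functorD(2)[OF w that] path_homotopic_ends[OF that] by simp
  fix p q assume p: "pathin X p" and q: "pathin X q" and pq: "p 1 = q 0"
  show "d (path_join p q 0) \<otimes> w (path_join p q) \<otimes> inv d (path_join p q 1) =
      d (p 0) \<otimes> w p \<otimes> inv d (p 1) \<otimes> (d (q 0) \<otimes> w q \<otimes> inv d (q 1))"
    using c[OF p] c[OF q] path_functorD(3)[OF w p q pq] pq
    by (simp add: m_assoc) (simp add: inv_solve_left' flip: m_assoc)
qed

text \<open>Generators are ordered pairs of cover members, relators come from triple overlaps.
  Holonomy maps the fundamental group into this group, and joining base points of the members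
  through their overlaps maps back. The presented group is larger in general: generators of disjoint
  pairs are unconstrained and no spanning tree is collapsed. Hence only a retract results.\<close>

lemma finitely_presented_fundamental_group:
  assumes X: "compact_space X" "Hausdorff_space X" "locally_simple X" "path_connected_space X" and x0: "x0 \<in> topspace X"
  shows "finitely_presented (fundamental_group X x0)"
proof -
  let ?\<pi> = "fundamental_group X x0" and ?\<omega> = "path_class X x0"
  note \<pi> = group_fundamental_group[OF x0] and \<omega> = path_functor_path_class[OF X(4) x0]
  interpret \<pi>: group ?\<pi> by (rule \<pi>)
  obtain \<W> where \<W>: "finite \<W>" "\<Union>\<W> = topspace X" "\<And>W. W \<in> \<W> \<Longrightarrow> openin X W \<and> W \<noteq> {} \<and> path_connectedin X W"
    "\<And>z. z \<in> topspace X \<Longrightarrow> paths_homotopic_in X (\<Union>{W\<in>\<W>. z \<in> W})"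
    using good_cover_exists[OF X(1-3)] by blast
  define N where "N = card \<W>"
  obtain U where "bij_betw U {0..<N} \<W>" using ex_bij_betw_nat_finite[OF \<W>(1)] N_def by blast
  then have UW: "U ` {..<N} = \<W>" by (simp add: bij_betw_def lessThan_atLeast0)
  have U: "openin X (U i)" "U i \<noteq> {}" "path_connectedin X (U i)" "U i \<in> \<W>" if "i < N" for i
    using \<W>(3)[of "U i"] UW that by auto
  have Utop: "z \<in> topspace X" if "i < N" "z \<in> U i" for i z using U(1)[OF that(1)] that(2) openin_subset by blast
  have homotopic: "path_homotopic X p q"
    if "pathin X p" "pathin X q" "p 0 = q 0" "p 1 = q 1" "i < N" "j < N" "z \<in> U i" "z \<in> U j"
      "p ` {0..1} \<subseteq> U i \<union> U j" "q ` {0..1} \<subseteq> U i \<union> U j" for p q i j z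
  proof -
    have "U i \<union> U j \<subseteq> \<Union>{W\<in>\<W>. z \<in> W}" using U(4) that by blast
    then have "paths_homotopic_in X (U i \<union> U j)"
      using paths_homotopic_in_mono[OF \<W>(4)[OF Utop[OF that(5,7)]]] by blast
    then show ?thesis using that unfolding paths_homotopic_in_def by blast
  qed

  \<comment> \<open>Codes an ordered pair of cover members as a generator index below
    \<open>N * N\<close>, decoded by \<open>div\<close> and \<open>mod\<close>.\<close>
  define e where "e i j = i * N + j" for i j
  have e: "e i j < N * N" "e i j div N = i" "e i j mod N = j" if "i < N" "j < N" for i j
  proof -
    have "Suc i * N \<le> N * N" using that by (intro mult_le_mono1) simp
    then show "e i j < N * N" using that by (simp add: e_def)
  qed (use that in \<open>simp_all add: e_def\<close>)
  define T where "T = {(i, j, k). i < N \<and> j < N \<and> k < N \<and> U i \<inter> U j \<inter> U k \<noteq> {}}"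
  define R where "R = (\<lambda>(i, j, k). [(True, e i j), (True, e j k), (False, e i k)]) ` T"
  have "finite T" by (rule finite_subset[of _ "{..<N} \<times> {..<N} \<times> {..<N}"]) (auto simp: T_def)
  then have R: "finite R" "R \<subseteq> gen_words (N * N)" using e by (auto simp: R_def T_def)
  let ?P = "presented_group (N * N) R"
  note P = group_presented_group[of "N * N" R]
  interpret P: group ?P by (rule P)
  define g where "g i j = presented_gen (N * N) R (e i j)" for i j
  have gc: "g i j \<in> carrier ?P" if "i < N" "j < N" for i j
    unfolding g_def by (rule presented_gen_carrier[OF e(1)[OF that]])
  have g: "g i j \<otimes>\<^bsub>?P\<^esub> g j k = g i k" if ijk: "i < N" "j < N" "k < N" "z \<in> U i" "z \<in> U j" "z \<in> U k" for i j k z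
  proof -
    have "(i, j, k) \<in> T" using that by (auto simp: T_def)
    then have "presentation_eq R ([] @ [(True, e i j), (True, e j k), (False, e i k)] @ [(True, e i k)]) ([] @ [(True, e i k)])"
      by (intro presentation_eq.relator) (force simp: R_def)
    moreover have "presentation_eq R ([(True, e i j), (True, e j k)] @ [(False, e i k), (\<not> False, e i k)] @ []) ([(True, e i j), (True, e j k)] @ [])"
      by (rule presentation_eq.cancel)
    ultimately have "presentation_eq R [(True, e i j), (True, e j k)] [(True, e i k)]"
      by (auto intro: presentation_eq.sym presentation_eq.trans)
    then show ?thesis
      using e ijk by (simp add: g_def presented_gen_def mult_presented_group presentation_class_eq_iff)
  qed
  have gii: "g i i = \<one>\<^bsub>?P\<^esub>" if i: "i < N" for i
  proof -
    obtain z where "z \<in> U i" using U(2)[OF i] by blast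
    then have "g i i \<otimes>\<^bsub>?P\<^esub> g i i = g i i" using g[of i i i z] i by blast
    then show ?thesis using gc[OF i i] P.l_cancel_one by blast
  qed

  \<comment> \<open>Each point is framed by one chosen member \<open>\<iota> x\<close>;
    \<open>\<tau>\<close> passes from the frame at \<open>x\<close> to that at \<open>y\<close>
    through a member containing both, and the triple relations make the choice of that member
    immaterial.\<close>
  define \<iota> where "\<iota> x = (SOME i. i < N \<and> x \<in> U i)" for x
  define \<kappa> where "\<kappa> x y = (SOME k. k < N \<and> x \<in> U k \<and> y \<in> U k)" for x y
  define \<tau> where "\<tau> x y = g (\<iota> x) (\<kappa> x y) \<otimes>\<^bsub>?P\<^esub> g (\<kappa> x y) (\<iota> y)" for x y
  have \<iota>: "\<iota> x < N" "x \<in> U (\<iota> x)" if "x \<in> topspace X" for x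
  proof -
    have "\<exists>i. i < N \<and> x \<in> U i" using \<W>(2) UW that by blast
    from someI_ex[OF this] show "\<iota> x < N" "x \<in> U (\<iota> x)" by (simp_all add: \<iota>_def)
  qed
  have \<tau>: "\<tau> x y = g (\<iota> x) k \<otimes>\<^bsub>?P\<^esub> g k (\<iota> y)" if k: "k < N" "x \<in> U k" "y \<in> U k" for x y k
  proof -
    let ?k = "\<kappa> x y"
    have "\<exists>k. k < N \<and> x \<in> U k \<and> y \<in> U k" using that by blast
    from someI_ex[OF this] have k': "?k < N" "x \<in> U ?k" "y \<in> U ?k" by (simp_all add: \<kappa>_def)
    note x = \<iota>[OF Utop[OF k(1,2)]] and y = \<iota>[OF Utop[OF k(1,3)]]
    note c = gc[OF x(1) k(1)] gc[OF k(1) k'(1)] gc[OF k'(1) k(1)] gc[OF k(1) y(1)]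
    have "\<tau> x y = (g (\<iota> x) k \<otimes>\<^bsub>?P\<^esub> g k ?k) \<otimes>\<^bsub>?P\<^esub> (g ?k k \<otimes>\<^bsub>?P\<^esub> g k (\<iota> y))"
      using g[OF x(1) k(1) k'(1) x(2) k(2) k'(2)] g[OF k'(1) k(1) y(1) k'(3) k(3) y(2)] by (simp add: \<tau>_def)
    also have "\<dots> = g (\<iota> x) k \<otimes>\<^bsub>?P\<^esub> (g k ?k \<otimes>\<^bsub>?P\<^esub> g ?k k) \<otimes>\<^bsub>?P\<^esub> g k (\<iota> y)"
      using c by (simp add: P.m_assoc)
    also have "g k ?k \<otimes>\<^bsub>?P\<^esub> g ?k k = \<one>\<^bsub>?P\<^esub>"
      using g[OF k(1) k'(1) k(1) k(2) k'(2) k(2)] gii[OF k(1)] by simp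
    finally show ?thesis using c by simp
  qed
  have "local_system X \<W> ?P \<tau>"
  proof
    fix S x y z assume "S \<in> \<W>" and S: "x \<in> S" "y \<in> S"
    then obtain k where k: "k < N" "S = U k" using UW by auto
    note x = \<iota>[OF Utop[OF k(1), of x]] and y = \<iota>[OF Utop[OF k(1), of y]]
    show "\<tau> x y \<in> carrier ?P" using S k x y gc by (simp add: \<tau>[of k])
    assume z: "z \<in> S"
    note z' = \<iota>[OF Utop[OF k(1), of z]]
    have c: "g (\<iota> x) k \<in> carrier ?P" "g k (\<iota> y) \<in> carrier ?P" "g (\<iota> y) k \<in> carrier ?P" "g k (\<iota> z) \<in> carrier ?P"
      using S z k x y z' gc by auto
    have "g k (\<iota> y) \<otimes>\<^bsub>?P\<^esub> g (\<iota> y) k = \<one>\<^bsub>?P\<^esub>"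
      using g[of k "\<iota> y" k y] gii[of k] S k y by simp
    then have "g k (\<iota> y) \<otimes>\<^bsub>?P\<^esub> (g (\<iota> y) k \<otimes>\<^bsub>?P\<^esub> g k (\<iota> z)) = g k (\<iota> z)"
      using c by (simp flip: P.m_assoc)
    then show "\<tau> x y \<otimes>\<^bsub>?P\<^esub> \<tau> y z = \<tau> x z"
      using S z k c by (simp add: \<tau>[of k] P.m_assoc)
  qed (use \<W> P in auto)
  then interpret L: local_system X \<W> ?P \<tau> .

  define b where "b i = (SOME z. z \<in> U i)" for i
  have b: "b i \<in> U i" if "i < N" for i
    using U(2)[OF that] by (auto simp: b_def intro: someI_ex)
  define q where "q i z = (SOME p. pathin X p \<and> p 0 = b i \<and> p 1 = z \<and> p ` {0..1} \<subseteq> U i)" for i z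
  have q: "pathin X (q i z)" "q i z 0 = b i" "q i z 1 = z" "q i z ` {0..1} \<subseteq> U i" if "i < N" "z \<in> U i" for i z
  proof -
    have "\<exists>p. pathin X p \<and> p 0 = b i \<and> p 1 = z \<and> p ` {0..1} \<subseteq> U i"
      using U(3)[OF that(1)] b[OF that(1)] that(2) unfolding path_connectedin by blast
    from someI_ex[OF this]
    show "pathin X (q i z)" "q i z 0 = b i" "q i z 1 = z" "q i z ` {0..1} \<subseteq> U i" by (auto simp: q_def)
  qed
  define c where "c i z = ?\<omega> (q i z)" for i z
  have cc: "c i z \<in> carrier ?\<pi>" if "i < N" "z \<in> U i" for i z
    unfolding c_def by (rule path_functorD(1)[OF \<omega> q(1)[OF that]])
  have join_image: "path_join p p' ` {0..1} \<subseteq> A \<union> B" if "p ` {0..1} \<subseteq> A" "p' ` {0..1} \<subseteq> B" for p p' :: "real \<Rightarrow> 'a" and A B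
    using that by (auto simp: path_join_def image_subset_iff)
  have c_step: "c i (p 1) = c i (p 0) \<otimes>\<^bsub>?\<pi>\<^esub> ?\<omega> p" if i: "i < N" and p: "pathin X p" "p ` {0..1} \<subseteq> U i" for i p
  proof -
    have ends: "p 0 \<in> U i" "p 1 \<in> U i" using p(2) by auto
    note q0 = q[OF i ends(1)] and q1 = q[OF i ends(2)]
    have "path_homotopic X (q i (p 1)) (path_join (q i (p 0)) p)"
      by (rule homotopic[OF q1(1) pathin_join[OF q0(1) p(1) q0(3)] _ _ i i ends(1) ends(1)])
         (use q0 q1 join_image[OF q0(4) p(2)] in auto)
    then show ?thesis
      unfolding c_def using path_functorD(2)[OF \<omega>] path_functorD(3)[OF \<omega> q0(1) p(1) q0(3)] by simp
  qed
  \<comment> \<open>Joins \<open>b i\<close> to \<open>b j\<close> through a point of the overlap.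
    The overlap may be disconnected: independence of the point holds because both routes stay in
    \<open>U i \<union> U j\<close>, inside one star of the cover.\<close>
  define \<rho>0 where "\<rho>0 i j = (let z = (SOME z. z \<in> U i \<inter> U j) in c i z \<otimes>\<^bsub>?\<pi>\<^esub> inv\<^bsub>?\<pi>\<^esub> c j z)" for i j
  have \<rho>0: "\<rho>0 i j = c i z \<otimes>\<^bsub>?\<pi>\<^esub> inv\<^bsub>?\<pi>\<^esub> c j z" if ij: "i < N" "j < N" and z: "z \<in> U i" "z \<in> U j" for i j z
  proof -
    let ?y = "SOME z. z \<in> U i \<inter> U j"
    have "?y \<in> U i \<inter> U j" using z by (intro someI[of "\<lambda>z. z \<in> U i \<inter> U j" z]) blast
    then have y: "?y \<in> U i" "?y \<in> U j" by auto
    have loop: "pathin X (path_join (q i y) (path_reverse (q j y)))"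
      "path_join (q i y) (path_reverse (q j y)) ` {0..1} \<subseteq> U i \<union> U j"
      "?\<omega> (path_join (q i y) (path_reverse (q j y))) = c i y \<otimes>\<^bsub>?\<pi>\<^esub> inv\<^bsub>?\<pi>\<^esub> c j y"
      if y: "y \<in> U i" "y \<in> U j" for y
    proof -
      note qi = q[OF ij(1) y(1)] and qj = q[OF ij(2) y(2)]
      have r: "pathin X (path_reverse (q j y))" "path_reverse (q j y) ` {0..1} \<subseteq> U j"
        using pathin_reverse[OF qj(1)] qj(4) by (simp, auto simp: path_reverse_def image_subset_iff)
      show "pathin X (path_join (q i y) (path_reverse (q j y)))" using qi qj r by (intro pathin_join) auto
      show "path_join (q i y) (path_reverse (q j y)) ` {0..1} \<subseteq> U i \<union> U j" by (rule join_image[OF qi(4) r(2)])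
      show "?\<omega> (path_join (q i y) (path_reverse (q j y))) = c i y \<otimes>\<^bsub>?\<pi>\<^esub> inv\<^bsub>?\<pi>\<^esub> c j y"
        using path_functorD(3)[OF \<omega> qi(1) r(1)] path_functor_reverse[OF \<omega> \<pi> qj(1)] qi qj by (simp add: c_def)
    qed
    have "path_homotopic X (path_join (q i z) (path_reverse (q j z))) (path_join (q i ?y) (path_reverse (q j ?y)))"
      by (rule homotopic[OF loop(1)[OF z] loop(1)[OF y] _ _ ij z loop(2)[OF z] loop(2)[OF y]])
         (use q ij y z in auto)
    from path_functorD(2)[OF \<omega> this] show ?thesis
      unfolding loop(3)[OF z] loop(3)[OF y] \<rho>0_def Let_def by simp
  qed
  have \<rho>0c: "\<rho>0 i j \<in> carrier ?\<pi>" if "i < N" "j < N" "z \<in> U i" "z \<in> U j" for i j z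
    using \<rho>0[OF that] cc that by simp
  \<comment> \<open>The index is decoded into a pair; a disjoint pair offers no route between base
    points and is sent to the identity.\<close>
  define \<phi> where "\<phi> m = (if U (m div N) \<inter> U (m mod N) = {} then \<one>\<^bsub>?\<pi>\<^esub> else \<rho>0 (m div N) (m mod N))" for m
  have \<phi>: "\<phi> m \<in> carrier ?\<pi>" if "m < N * N" for m
  proof -
    have "0 < N" using that by (cases N) auto
    then have "m div N < N" "m mod N < N" using that by (simp_all add: less_mult_imp_div_less)
    then show ?thesis using \<rho>0c by (auto simp: \<phi>_def)
  qed
  have \<phi>e: "\<phi> (e i j) = \<rho>0 i j" if "i < N" "j < N" "z \<in> U i" "z \<in> U j" for i j z
    using e[OF that(1,2)] that by (auto simp: \<phi>_def)
  have "word_eval ?\<pi> \<phi> s = \<one>\<^bsub>?\<pi>\<^esub>" if "s \<in> R" for s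
  proof -
    from that obtain i j k where s: "s = [(True, e i j), (True, e j k), (False, e i k)]" and "(i, j, k) \<in> T"
      by (auto simp: R_def)
    then obtain z where ijk: "i < N" "j < N" "k < N" and z: "z \<in> U i" "z \<in> U j" "z \<in> U k" by (auto simp: T_def)
    have cs: "c i z \<in> carrier ?\<pi>" "c j z \<in> carrier ?\<pi>" "c k z \<in> carrier ?\<pi>" using cc ijk z by auto
    have "\<rho>0 i j \<otimes>\<^bsub>?\<pi>\<^esub> \<rho>0 j k = \<rho>0 i k"
      unfolding \<rho>0[OF ijk(1,2) z(1,2)] \<rho>0[OF ijk(2,3) z(2,3)] \<rho>0[OF ijk(1,3) z(1,3)]
      using cs by (simp add: \<pi>.m_assoc) (simp add: \<pi>.inv_solve_left' flip: \<pi>.m_assoc)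
    then have "\<rho>0 i j \<otimes>\<^bsub>?\<pi>\<^esub> (\<rho>0 j k \<otimes>\<^bsub>?\<pi>\<^esub> inv\<^bsub>?\<pi>\<^esub> \<rho>0 i k) = \<one>\<^bsub>?\<pi>\<^esub>"
      using \<rho>0c[OF ijk(1,2) z(1,2)] \<rho>0c[OF ijk(2,3) z(2,3)] \<rho>0c[OF ijk(1,3) z(1,3)] by (simp flip: \<pi>.m_assoc)
    then show ?thesis
      using \<phi>e[OF ijk(1,2) z(1,2)] \<phi>e[OF ijk(2,3) z(2,3)] \<phi>e[OF ijk(1,3) z(1,3)] \<rho>0c[OF ijk(1,3) z(1,3)]
      by (simp add: s)
  qed
  from presented_group_hom_exists[where \<phi> = \<phi>, OF \<pi> \<phi> R(2) this]
  obtain \<rho> where \<rho>: "\<rho> \<in> hom ?P ?\<pi>"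
    "\<And>u. u \<in> gen_words (N * N) \<Longrightarrow> \<rho> (presentation_class (N * N) R u) = word_eval ?\<pi> \<phi> u"
    by blast
  have \<rho>g: "\<rho> (g i j) = \<rho>0 i j" if "i < N" "j < N" "z \<in> U i" "z \<in> U j" for i j z
    using \<rho>(2)[of "[(True, e i j)]"] e[OF that(1,2)] \<phi>e[OF that] \<rho>0c[OF that] by (simp add: g_def presented_gen_def)

  define A where "A x = c (\<iota> x) x" for x
  have A: "A x \<in> carrier ?\<pi>" if "x \<in> topspace X" for x
    using cc \<iota>[OF that] by (simp add: A_def)
  \<comment> \<open>The functor \<open>?\<omega>\<close> in the frames \<open>A x\<close>, classes
    of paths to \<open>x\<close> from the base point of its chosen member. Holonomy followed by
    \<open>\<rho>\<close> gives this conjugate and not \<open>?\<omega>\<close> itself.\<close>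
  define W where "W p = A (p 0) \<otimes>\<^bsub>?\<pi>\<^esub> ?\<omega> p \<otimes>\<^bsub>?\<pi>\<^esub> inv\<^bsub>?\<pi>\<^esub> A (p 1)" for p
  have W: "path_functor X ?\<pi> W"
    using path_functor_conjugate[where d = A, OF \<omega> \<pi> A] by (simp add: W_def[abs_def])
  have \<rho>hol: "\<rho> (L.holonomy p) = W p" if "pathin X p" for p
  proof (rule path_functor_eqI[OF path_functor_hom[OF L.path_functor_holonomy \<rho>(1)] W \<pi> L.cover _ that])
    fix S p assume S: "S \<in> \<W>" and p: "pathin X p" "p ` {0..1} \<subseteq> S"
    then obtain k where k: "k < N" "S = U k" using UW by auto
    let ?x = "p 0" and ?y = "p 1"
    have xy: "?x \<in> U k" "?y \<in> U k" using p k by auto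
    note x = \<iota>[OF Utop[OF k(1) xy(1)]] and y = \<iota>[OF Utop[OF k(1) xy(2)]]
    note cs = cc[OF x] cc[OF y] cc[OF k(1) xy(1)] path_functorD(1)[OF \<omega> p(1)]
    have "\<rho> (L.holonomy p) = \<rho> (g (\<iota> ?x) k \<otimes>\<^bsub>?P\<^esub> g k (\<iota> ?y))"
      using L.holonomy_small[OF p(1) S p(2)] \<tau>[OF k(1) xy] by simp
    also have "\<dots> = \<rho>0 (\<iota> ?x) k \<otimes>\<^bsub>?\<pi>\<^esub> \<rho>0 k (\<iota> ?y)"
      using hom_mult[OF \<rho>(1) gc[OF x(1) k(1)] gc[OF k(1) y(1)]] \<rho>g[OF x(1) k(1) x(2) xy(1)] \<rho>g[OF k(1) y(1) xy(2) y(2)] by simp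
    also have "\<dots> = c (\<iota> ?x) ?x \<otimes>\<^bsub>?\<pi>\<^esub> inv\<^bsub>?\<pi>\<^esub> c k ?x \<otimes>\<^bsub>?\<pi>\<^esub> ((c k ?x \<otimes>\<^bsub>?\<pi>\<^esub> ?\<omega> p) \<otimes>\<^bsub>?\<pi>\<^esub> inv\<^bsub>?\<pi>\<^esub> c (\<iota> ?y) ?y)"
      using \<rho>0[OF x(1) k(1) x(2) xy(1)] \<rho>0[OF k(1) y(1) xy(2) y(2)] c_step[OF k(1) p(1)] p(2) k(2) by simp
    also have "\<dots> = W p"
      using cs by (simp add: W_def A_def \<pi>.m_assoc) (simp add: \<pi>.inv_solve_left' flip: \<pi>.m_assoc)
    finally show "\<rho> (L.holonomy p) = W p" .
  qed

  \<comment> \<open>On loops at \<open>x0\<close> this is \<open>path_class\<close> followed by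
    conjugation with \<open>A x0\<close>, an automorphism that need not be the identity; its inverse
    corrects \<open>\<rho>\<close> to a retraction.\<close>
  let ?\<theta> = "functor_hom W"
  have \<theta>: "?\<theta> \<in> hom ?\<pi> ?\<pi>" by (rule functor_hom_hom[OF W])
  have \<theta>val: "?\<theta> (loop_class X x0 p) = A x0 \<otimes>\<^bsub>?\<pi>\<^esub> ?\<omega> p \<otimes>\<^bsub>?\<pi>\<^esub> inv\<^bsub>?\<pi>\<^esub> A x0" if "pathin X p" "p 0 = x0" "p 1 = x0" for p
    using functor_hom_loop_class[OF W that] that by (simp add: W_def)
  have "inj_on ?\<theta> (carrier ?\<pi>)"
  proof (rule inj_onI)
    fix a b assume "a \<in> carrier ?\<pi>" "b \<in> carrier ?\<pi>" and eq: "?\<theta> a = ?\<theta> b"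
    then obtain p p' where p: "pathin X p" "p 0 = x0" "p 1 = x0" "a = loop_class X x0 p"
      and p': "pathin X p'" "p' 0 = x0" "p' 1 = x0" "b = loop_class X x0 p'"
      by (metis fundamental_groupE)
    have "?\<omega> p = ?\<omega> p'"
      using eq \<theta>val[OF p(1-3)] \<theta>val[OF p'(1-3)] p(4) p'(4) A[OF x0] path_functorD(1)[OF \<omega>] p(1) p'(1) by simp
    then have "path_homotopic X p p'"
      using p p' by (intro path_class_faithful[OF X(4) x0]) auto
    from loop_class_cong[OF this p(2,3)] show "a = b" using p(4) p'(4) by simp
  qed
  moreover have "carrier ?\<pi> \<subseteq> ?\<theta> ` carrier ?\<pi>"
  proof
    fix x assume x: "x \<in> carrier ?\<pi>"
    then have "inv\<^bsub>?\<pi>\<^esub> A x0 \<otimes>\<^bsub>?\<pi>\<^esub> x \<otimes>\<^bsub>?\<pi>\<^esub> A x0 \<in> carrier ?\<pi>" using A[OF x0] by simp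
    then obtain p where p: "pathin X p" "p 0 = x0" "p 1 = x0" "?\<omega> p = inv\<^bsub>?\<pi>\<^esub> A x0 \<otimes>\<^bsub>?\<pi>\<^esub> x \<otimes>\<^bsub>?\<pi>\<^esub> A x0"
      using path_class_full[OF X(4) x0] by blast
    have "?\<theta> (loop_class X x0 p) = x"
      unfolding \<theta>val[OF p(1-3)] p(4) using x A[OF x0] by (simp add: \<pi>.m_assoc) (simp flip: \<pi>.m_assoc)
    then show "x \<in> ?\<theta> ` carrier ?\<pi>" using p(1-3) by (metis imageI loop_class_in_carrier)
  qed
  ultimately have "?\<theta> \<in> iso ?\<pi> ?\<pi>"
    using \<theta> by (auto simp: iso_iff hom_def)
  then obtain \<theta>' where \<theta>': "group_isomorphisms ?\<pi> ?\<pi> ?\<theta> \<theta>'"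
    using \<pi>.iso_iff_group_isomorphisms by blast
  show ?thesis
  proof (rule finitely_presented_retract[OF \<pi> R functor_hom_hom[OF L.path_functor_holonomy]])
    show "\<theta>' \<circ> \<rho> \<in> hom ?P ?\<pi>"
      using \<theta>' \<rho>(1) by (auto simp: group_isomorphisms_def intro: Group.hom_compose)
    fix x assume x: "x \<in> carrier ?\<pi>"
    then obtain p where p: "pathin X p" "p 0 = x0" "p 1 = x0" "x = loop_class X x0 p"
      by (rule fundamental_groupE)
    have "\<rho> (functor_hom L.holonomy x) = ?\<theta> x"
      unfolding p(4) functor_hom_loop_class[OF L.path_functor_holonomy p(1-3)] functor_hom_loop_class[OF W p(1-3)]
      by (rule \<rho>hol[OF p(1)])
    then show "(\<theta>' \<circ> \<rho>) (functor_hom L.holonomy x) = x"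
      using \<theta>' x by (simp add: group_isomorphisms_def)
  qed
qed

section \<open>Lower central quotients\<close>

text \<open>The first ordinal needs no case of its own: \<open>inter\<close> with
  \<open>J = {}\<close> yields \<open>carrier G\<close>.\<close>

lemma lower_central_induct:
  assumes r: "Well_order r"
    and step: "\<And>j k. immediate_pred r j k \<Longrightarrow> P (lower_central G r j) \<Longrightarrow>
      P (commutator_subgroup G (carrier G) (lower_central G r j))"
    and inter: "\<And>J. (\<And>j. j \<in> J \<Longrightarrow> P (lower_central G r j)) \<Longrightarrow> P (carrier G \<inter> (\<Inter>j\<in>J. lower_central G r j))"
  shows "P (lower_central G r k)"
proof -
  have "wf (r - Id)" using r by (simp add: well_order_on_def)
  then show ?thesis
  proof (induction k rule: wf_induct_rule)
    case (less k)
    have IH: "P (lower_central G r j)" if "j \<in> underS r k" for j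
      using less that by (auto simp: underS_def)
    show ?case
    proof (cases "\<exists>j. immediate_pred r j k")
      case True
      then obtain j where j: "immediate_pred r j k" by blast
      then have "P (lower_central G r j)" using IH by (simp add: immediate_pred_def)
      then show ?thesis unfolding lower_central_successor[OF r j] by (rule step[OF j])
    next
      case False
      then show ?thesis using inter[of "underS r k"] IH lower_central_rec[OF r, of G k] by simp
    qed
  qed
qed

text \<open>Conjugation is an automorphism that preserves \<open>N\<close>, so it sends generating
  commutators to generating commutators.\<close>

lemma normal_commutator_subgroup:
  fixes G (structure)
  assumes G: "group G" and N: "N \<lhd> G"
  shows "commutator_subgroup G (carrier G) N \<lhd> G"
proof -
  interpret group G by (rule G)
  have sub: "N \<subseteq> carrier G" using N by (simp add: normal_imp_subgroup subgroup.subset)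
  show ?thesis
    unfolding commutator_subgroup_def
  proof (rule normal_generateI)
    show "{a \<otimes> b \<otimes> inv a \<otimes> inv b |a b. a \<in> carrier G \<and> b \<in> N} \<subseteq> carrier G"
      using sub by auto
    fix h g assume "h \<in> {a \<otimes> b \<otimes> inv a \<otimes> inv b |a b. a \<in> carrier G \<and> b \<in> N}" and g: "g \<in> carrier G"
    then obtain a b where ab: "a \<in> carrier G" "b \<in> N" "h = a \<otimes> b \<otimes> inv a \<otimes> inv b" by blast
    have b: "b \<in> carrier G" using ab sub by blast
    have "g \<otimes> h \<otimes> inv g = (g \<otimes> a \<otimes> inv g) \<otimes> (g \<otimes> b \<otimes> inv g) \<otimes> inv (g \<otimes> a \<otimes> inv g) \<otimes> inv (g \<otimes> b \<otimes> inv g)"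
      using ab(1) b g unfolding ab(3) by (simp add: m_assoc inv_mult_group) (simp add: inv_solve_left' flip: m_assoc)
    moreover have "g \<otimes> a \<otimes> inv g \<in> carrier G" "g \<otimes> b \<otimes> inv g \<in> N"
      using ab g N by (auto simp: normal_inv_iff)
    ultimately show "g \<otimes> h \<otimes> inv g \<in> {a \<otimes> b \<otimes> inv a \<otimes> inv b |a b. a \<in> carrier G \<and> b \<in> N}" by blast
  qed
qed

lemma normal_lower_central:
  fixes G (structure)
  assumes G: "group G" and r: "Well_order r"
  shows "lower_central G r k \<lhd> G"
proof (rule lower_central_induct[OF r])
  interpret group G by (rule G)
  fix J assume J: "\<And>j. j \<in> J \<Longrightarrow> lower_central G r j \<lhd> G"
  then have sub: "subgroup (lower_central G r j) G" if "j \<in> J" for j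
    using that by (simp add: normal_imp_subgroup)
  have "subgroup (carrier G \<inter> (\<Inter>j\<in>J. lower_central G r j)) G"
  proof (rule subgroupI)
    show "carrier G \<inter> (\<Inter>j\<in>J. lower_central G r j) \<noteq> {}"
      using subgroup.one_closed[OF sub] by blast
  qed (use subgroup.m_inv_closed[OF sub] subgroup.m_closed[OF sub] in auto)
  then show "carrier G \<inter> (\<Inter>j\<in>J. lower_central G r j) \<lhd> G"
    using J by (auto simp: normal_inv_iff)
qed (rule normal_commutator_subgroup[OF G])

lemma commutator_subgroup_image:
  assumes "group_hom G H h" "h ` carrier G = carrier H" "N \<subseteq> carrier G"
  shows "h ` commutator_subgroup G (carrier G) N = commutator_subgroup H (carrier H) (h ` N)"
proof -
  interpret group_hom G H h by fact
  let ?S = "{a \<otimes>\<^bsub>G\<^esub> b \<otimes>\<^bsub>G\<^esub> inv\<^bsub>G\<^esub> a \<otimes>\<^bsub>G\<^esub> inv\<^bsub>G\<^esub> b | a b. a \<in> carrier G \<and> b \<in> N}"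
  have h: "h (a \<otimes>\<^bsub>G\<^esub> b \<otimes>\<^bsub>G\<^esub> inv\<^bsub>G\<^esub> a \<otimes>\<^bsub>G\<^esub> inv\<^bsub>G\<^esub> b) = h a \<otimes>\<^bsub>H\<^esub> h b \<otimes>\<^bsub>H\<^esub> inv\<^bsub>H\<^esub> h a \<otimes>\<^bsub>H\<^esub> inv\<^bsub>H\<^esub> h b"
    if "a \<in> carrier G" "b \<in> N" for a b
  proof -
    have "b \<in> carrier G" using that(2) assms(3) by blast
    then show ?thesis using that(1) by simp
  qed
  have "h ` ?S = {a \<otimes>\<^bsub>H\<^esub> b \<otimes>\<^bsub>H\<^esub> inv\<^bsub>H\<^esub> a \<otimes>\<^bsub>H\<^esub> inv\<^bsub>H\<^esub> b | a b. a \<in> carrier H \<and> b \<in> h ` N}" (is "_ = ?T")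
  proof (intro equalityI subsetI)
    fix x assume "x \<in> h ` ?S"
    then obtain a b where "a \<in> carrier G" "b \<in> N" "x = h a \<otimes>\<^bsub>H\<^esub> h b \<otimes>\<^bsub>H\<^esub> inv\<^bsub>H\<^esub> h a \<otimes>\<^bsub>H\<^esub> inv\<^bsub>H\<^esub> h b"
      using h by blast
    then show "x \<in> ?T" using assms(2) by blast
  next
    fix x assume "x \<in> ?T"
    then obtain a b where ab: "a \<in> carrier H" "b \<in> h ` N" "x = a \<otimes>\<^bsub>H\<^esub> b \<otimes>\<^bsub>H\<^esub> inv\<^bsub>H\<^esub> a \<otimes>\<^bsub>H\<^esub> inv\<^bsub>H\<^esub> b" by blast
    then obtain a' b' where "a' \<in> carrier G" "a = h a'" "b' \<in> N" "b = h b'" using assms(2) by blast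
    then show "x \<in> h ` ?S" using h[of a' b'] ab(3) by (intro image_eqI[of _ _ "a' \<otimes>\<^bsub>G\<^esub> b' \<otimes>\<^bsub>G\<^esub> inv\<^bsub>G\<^esub> a' \<otimes>\<^bsub>G\<^esub> inv\<^bsub>G\<^esub> b'"]) auto
  qed
  moreover have "?S \<subseteq> carrier G" using assms(3) by auto
  ultimately show ?thesis
    unfolding commutator_subgroup_def using generate_img[of ?S] by simp
qed

text \<open>Surjectivity suffices at successors. At limit stages the image has to commute with an
  intersection, and this is where injectivity enters.\<close>

lemma lower_central_image:
  assumes G: "group G" and H: "group H" and h: "h \<in> iso G H" and r: "Well_order r"
  shows "h ` lower_central G r k = lower_central H r k"
proof -
  have hom: "group_hom G H h" using G H h by (simp add: group_hom_def group_hom_axioms_def iso_def)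
  have surj: "h ` carrier G = carrier H" and inj: "inj_on h (carrier G)" using h by (auto simp: iso_def bij_betw_def)
  have sub: "lower_central G r j \<subseteq> carrier G" for j
    using normal_lower_central[OF G r] by (simp add: normal_imp_subgroup subgroup.subset)
  have "wf (r - Id)" using r by (simp add: well_order_on_def)
  then show ?thesis
  proof (induction k rule: wf_induct_rule)
    case (less k)
    have IH: "h ` lower_central G r j = lower_central H r j" if "j \<in> underS r k" for j
      using less that by (auto simp: underS_def)
    show ?case
    proof (cases "\<exists>j. immediate_pred r j k")
      case True
      then obtain j where j: "immediate_pred r j k" by blast
      then have "h ` lower_central G r j = lower_central H r j" using IH by (simp add: immediate_pred_def)
      then show ?thesis
        using commutator_subgroup_image[OF hom surj sub] lower_central_successor[OF r j, of G] lower_central_successor[OF r j, of H]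
        by simp
    next
      case False
      have "h ` (carrier G \<inter> (\<Inter>j\<in>underS r k. lower_central G r j)) = carrier H \<inter> (\<Inter>j\<in>underS r k. h ` lower_central G r j)"
      \<comment> \<open>The first ordinal is treated apart because \<open>image_INT\<close> needs a
        member of the index set.\<close>
      proof (cases "underS r k = {}")
        case False
        then obtain j0 where j0: "j0 \<in> underS r k" by blast
        have "h ` (\<Inter>j\<in>underS r k. lower_central G r j) = (\<Inter>j\<in>underS r k. h ` lower_central G r j)"
          by (rule image_INT[OF inj _ j0]) (simp add: sub)
        moreover have "(\<Inter>j\<in>underS r k. lower_central G r j) \<subseteq> carrier G" using False sub by blast
        moreover have "(\<Inter>j\<in>underS r k. h ` lower_central G r j) \<subseteq> carrier H"
          unfolding surj[symmetric] by (rule INF_lower2[OF j0 image_mono[OF sub]])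
        ultimately show ?thesis by (simp add: Int_absorb1)
      qed (simp add: surj)
      then show ?thesis
        using False IH lower_central_rec[OF r, of G k] lower_central_rec[OF r, of H k] by simp
    qed
  qed
qed

lemma quotient_isomorphism:
  assumes G: "group G" and h: "h \<in> iso G H" and K: "K \<subseteq> carrier G"
  shows "image h \<in> iso (G Mod K) (H Mod (h ` K))"
proof -
  have hom: "h \<in> hom G H" and surj: "h ` carrier G = carrier H" and inj: "inj_on h (carrier G)"
    using h by (auto simp: iso_def bij_betw_def)
  have mult: "h (x \<otimes>\<^bsub>G\<^esub> y) = h x \<otimes>\<^bsub>H\<^esub> h y" if "x \<in> carrier G" "y \<in> carrier G" for x y
    using hom_mult[OF hom that] .
  have coset: "h ` (K #>\<^bsub>G\<^esub> x) = h ` K #>\<^bsub>H\<^esub> h x" if "x \<in> carrier G" for x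
  proof -
    have "h ` (K #>\<^bsub>G\<^esub> x) = (\<lambda>k. h (k \<otimes>\<^bsub>G\<^esub> x)) ` K" by (auto simp: r_coset_def)
    also have "\<dots> = (\<lambda>k. h k \<otimes>\<^bsub>H\<^esub> h x) ` K"
      using K that by (intro image_cong[OF HOL.refl] mult) auto
    also have "\<dots> = h ` K #>\<^bsub>H\<^esub> h x" by (auto simp: r_coset_def)
    finally show ?thesis .
  qed
  have sub: "X \<subseteq> carrier G" if "X \<in> carrier (G Mod K)" for X
    using that K group.is_monoid[OF G] by (auto simp: FactGroup_def RCOSETS_def r_coset_def intro: monoid.m_closed)
  have "inj_on (image h) (carrier (G Mod K))"
    by (rule inj_onI) (use inj_on_image_eq_iff[OF inj] sub in blast)
  moreover have "image h ` carrier (G Mod K) = carrier (H Mod (h ` K))"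
  proof -
    have "image h ` carrier (G Mod K) = (\<lambda>x. h ` (K #>\<^bsub>G\<^esub> x)) ` carrier G"
      by (auto simp: FactGroup_def RCOSETS_def)
    also have "\<dots> = (\<lambda>x. h ` K #>\<^bsub>H\<^esub> h x) ` carrier G"
      by (rule image_cong[OF HOL.refl coset])
    also have "\<dots> = carrier (H Mod (h ` K))"
      by (auto simp: FactGroup_def RCOSETS_def simp flip: surj)
    finally show ?thesis .
  qed
  moreover have "h ` (X <#>\<^bsub>G\<^esub> Y) = h ` X <#>\<^bsub>H\<^esub> h ` Y" if "X \<subseteq> carrier G" "Y \<subseteq> carrier G" for X Y
  proof -
    have "h ` (X <#>\<^bsub>G\<^esub> Y) = (\<Union>x\<in>X. \<Union>y\<in>Y. {h (x \<otimes>\<^bsub>G\<^esub> y)})" by (auto simp: set_mult_def)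
    also have "\<dots> = (\<Union>x\<in>X. \<Union>y\<in>Y. {h x \<otimes>\<^bsub>H\<^esub> h y})"
      using that mult by (intro SUP_cong HOL.refl) (simp add: subset_iff)
    also have "\<dots> = h ` X <#>\<^bsub>H\<^esub> h ` Y" by (auto simp: set_mult_def)
    finally show ?thesis .
  qed
  ultimately show ?thesis
    using sub by (auto simp: iso_iff hom_def FactGroup_def)
qed

section \<open>The invariant\<close>

lemma closed_3_manifold_properties:
  assumes "closed_3_manifold M cM" "m0 \<in> topspace M"
  shows "path_connected_space M" "finitely_presented (fundamental_group M m0)"
    "\<exists>c. singular_relcycle 3 M {} c \<and> cM = homologous_rel_set 3 M {} c"
proof -
  have M: "manifold_with_boundary 3 M" "compact_space M" "connected_space M" "Hausdorff_space M"
    and c: "fundamental_class 3 M cM" "manifold_boundary 3 M = {}"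
    using assms(1) by (auto simp: closed_3_manifold_def compact_oriented_manifold_def manifold_with_boundary_def)
  note simple = manifold_locally_simple[OF M(1)]
  show path: "path_connected_space M" by (rule connected_locally_simple_imp_path_connected[OF M(3) simple])
  show "finitely_presented (fundamental_group M m0)"
    by (rule finitely_presented_fundamental_group[OF M(2,4) simple path assms(2)])
  show "\<exists>c. singular_relcycle 3 M {} c \<and> cM = homologous_rel_set 3 M {} c"
    using c carrier_relative_homology_group[of 3 M "{}"] by (auto simp: fundamental_class_def)
qed

lemma homology_cobordism_classes_eq:
  assumes "homology_cobordism W cW M cM i N cN j"
  shows "hom_induced 3 M {} W {} i cM = hom_induced 3 N {} W {} j cN"
proof -
  let ?B = "manifold_boundary 4 W"
  let ?dW = "subtopology W ?B"
  have bd: "bounds_difference W cW M cM i N cN j" and "fundamental_class 4 W cW"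
    using assms by (auto simp: homology_cobordism_def compact_oriented_manifold_def)
  then have cW: "cW \<in> carrier (relative_homology_group 4 W ?B)" by (simp add: fundamental_class_def)
  have i: "continuous_map M W i" "i ` topspace M \<subseteq> ?B" and j: "continuous_map N W j" "j ` topspace N \<subseteq> ?B"
    and eq: "hom_boundary 4 W ?B cW = hom_induced 3 M {} ?dW {} i cM
        \<otimes>\<^bsub>homology_group 3 ?dW\<^esub> inv\<^bsub>homology_group 3 ?dW\<^esub> hom_induced 3 N {} ?dW {} j cN"
    using bd by (auto simp: bounds_difference_def Let_def embedding_map_def continuous_map_in_subtopology
        dest!: homeomorphic_imp_continuous_map)
  have i': "continuous_map M ?dW i" and j': "continuous_map N ?dW j"
    using i j by (auto simp: continuous_map_in_subtopology)
  let ?e = "hom_induced 3 ?dW {} W {} id"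
  have e: "?e \<in> hom (homology_group 3 ?dW) (homology_group 3 W)" by (rule hom_induced_empty_hom)
  interpret gh: group_hom "homology_group 3 ?dW" "homology_group 3 W" ?e
    using e by (simp add: group_hom_def group_hom_axioms_def)
  have "kernel (homology_group 3 ?dW) (homology_group 3 W) ?e = hom_boundary 4 W ?B ` carrier (relative_homology_group 4 W ?B)"
    using homology_exactness_axiom_2[of 4 W ?B] by simp
  then have "?e (hom_boundary 4 W ?B cW) = \<one>\<^bsub>homology_group 3 W\<^esub>"
    using cW by (auto simp: kernel_def)
  moreover have c: "hom_induced 3 M {} ?dW {} i cM \<in> carrier (homology_group 3 ?dW)"
    "hom_induced 3 N {} ?dW {} j cN \<in> carrier (homology_group 3 ?dW)"
    using hom_induced_carrier by blast+
  ultimately have "?e (hom_induced 3 M {} ?dW {} i cM) \<otimes>\<^bsub>homology_group 3 W\<^esub> inv\<^bsub>homology_group 3 W\<^esub> ?e (hom_induced 3 N {} ?dW {} j cN)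
      = \<one>\<^bsub>homology_group 3 W\<^esub>"
    by (simp add: eq)
  then have "?e (hom_induced 3 M {} ?dW {} i cM) = ?e (hom_induced 3 N {} ?dW {} j cN)"
    using gh.H.inv_equality[OF _ gh.H.inv_closed[OF gh.hom_closed[OF c(2)]] gh.hom_closed[OF c(1)]] gh.hom_closed[OF c(2)]
    by simp
  moreover have id: "continuous_map ?dW W id" by simp
  ultimately show ?thesis
    using hom_induced_compose_empty[OF i' id, of 3] hom_induced_compose_empty[OF j' id, of 3] by (simp add: fun_eq_iff)
qed

text \<open>Composition with \<open>a\<close> or its inverse reindexes the automorphisms that sweep
  out the orbit.\<close>

lemma aut_orbit_iso:
  assumes Q: "group Q" and a: "a \<in> iso Q Q" and x: "x \<in> carrier (group_homology 3 Q)"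
  shows "aut_orbit Q (group_homology_map 3 Q a x) = aut_orbit Q x"
proof -
  have orbit: "aut_orbit Q y = {group_homology_map 3 Q b y | b. b \<in> iso Q Q}" if y: "y \<in> carrier (group_homology 3 Q)" for y
  proof (intro equalityI subsetI)
    fix z assume "z \<in> aut_orbit Q y"
    then obtain b where "b \<in> auto Q" "z = group_homology_map 3 Q b y"
      by (auto simp: aut_orbit_def orbit_def AutoGroup_def)
    then show "z \<in> {group_homology_map 3 Q b y | b. b \<in> iso Q Q}"
      by (auto simp: auto_def Bij_def iso_def)
  next
    fix z assume "z \<in> {group_homology_map 3 Q b y | b. b \<in> iso Q Q}"
    then obtain b where b: "b \<in> iso Q Q" "z = group_homology_map 3 Q b y" by blast
    \<comment> \<open>\<open>AutoGroup\<close> consists of extensional bijections, so an isomorphism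
      acts through its restriction to the carrier, with the same effect on homology classes.\<close>
    let ?b = "restrict b (carrier Q)"
    have b': "?b \<in> iso Q Q" by (rule group.iso_eq[OF Q b(1)]) simp
    then have "?b \<in> auto Q" by (auto simp: auto_def Bij_def iso_def)
    moreover have "z = group_homology_map 3 Q ?b y"
      unfolding b(2) using b(1) b' y by (intro group_homology_map_cong) (auto simp: iso_def)
    ultimately show "z \<in> aut_orbit Q y"
      by (auto simp: aut_orbit_def orbit_def AutoGroup_def)
  qed
  obtain a' where a': "group_isomorphisms Q Q a a'" using a group.iso_iff_group_isomorphisms[OF Q] by blast
  have ah: "a \<in> hom Q Q" "a' \<in> hom Q Q" "a' \<in> iso Q Q"
    using a' group_isomorphisms_imp_iso[OF group_isomorphisms_sym[OF a']] by (auto simp: group_isomorphisms_def)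
  have ax: "group_homology_map 3 Q a x \<in> carrier (group_homology 3 Q)"
    using group_homology_map_hom[OF ah(1), of 3] x by (auto simp: hom_def)
  have 1: "group_homology_map 3 Q b (group_homology_map 3 Q a x) = group_homology_map 3 Q (b \<circ> a) x" if "b \<in> iso Q Q" for b
    using that by (intro group_homology_map_compose[OF ah(1) _ x]) (simp add: iso_def)
  have 2: "group_homology_map 3 Q b x = group_homology_map 3 Q (b \<circ> a') (group_homology_map 3 Q a x)" if b: "b \<in> iso Q Q" for b
  proof -
    have bh: "b \<in> hom Q Q" using b by (simp add: iso_def)
    have h: "b \<circ> a' \<in> hom Q Q" "(b \<circ> a') \<circ> a \<in> hom Q Q"
      using Group.hom_compose ah bh by blast+
    show ?thesis
      unfolding group_homology_map_compose[OF ah(1) h(1) x]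
      using a' by (intro group_homology_map_cong[OF bh h(2) _ x]) (simp add: group_isomorphisms_def)
  qed
  show ?thesis
    unfolding orbit[OF x] orbit[OF ax]
  proof (intro equalityI subsetI)
    fix z assume "z \<in> {group_homology_map 3 Q b (group_homology_map 3 Q a x) | b. b \<in> iso Q Q}"
    then obtain b where b: "b \<in> iso Q Q" "z = group_homology_map 3 Q b (group_homology_map 3 Q a x)" by blast
    then show "z \<in> {group_homology_map 3 Q b x | b. b \<in> iso Q Q}"
      using 1 iso_set_trans[OF a b(1)] by blast
  next
    fix z assume "z \<in> {group_homology_map 3 Q b x | b. b \<in> iso Q Q}"
    then obtain b where b: "b \<in> iso Q Q" "z = group_homology_map 3 Q b x" by blast
    then show "z \<in> {group_homology_map 3 Q b (group_homology_map 3 Q a x) | b. b \<in> iso Q Q}"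
      using 2 iso_set_trans[OF ah(3) b(1)] by blast
  qed
qed

lemma classifying_homology_map_carrier:
  assumes "path_connected_space X" "x0 \<in> topspace X" "singular_relcycle n X {} c"
  shows "classifying_homology_map n X x0 (homologous_rel_set n X {} c) \<in> carrier (group_homology n (fundamental_group X x0))"
  unfolding classifying_homology_map_eq[OF assms] carrier_group_homology
  by (rule imageI[OF edge_chain_cycle[OF path_functor_path_class[OF assms(1,2)] assms(3)]])

text \<open>\<open>w0\<close> may be any point of \<open>W\<close>, not just the image of
  \<open>m0\<close>: the base paths in \<open>path_class W w0\<close> absorb the difference.\<close>

lemma classifying_homology_map_natural:
  assumes M: "path_connected_space M" "m0 \<in> topspace M" and W: "path_connected_space W" "w0 \<in> topspace W"
    and i: "continuous_map M W i" and c: "singular_relcycle n M {} c"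
  shows "group_homology_map n (fundamental_group W w0) (functor_hom (\<lambda>p. path_class W w0 (i \<circ> p)))
      (classifying_homology_map n M m0 (homologous_rel_set n M {} c)) =
    classifying_homology_map n W w0 (hom_induced (int n) M {} W {} i (homologous_rel_set n M {} c))"
proof -
  note w = path_functor_path_class[OF W]
  have ic: "singular_relcycle n W {} (chain_map n i c)" using singular_relcycle_chain_map[OF c i] by simp
  have "hom_induced (int n) M {} W {} i (homologous_rel_set n M {} c) = homologous_rel_set n W {} (chain_map n i c)"
    using hom_induced_chain_map[OF i _ c] by simp
  moreover have "edge_chain (\<lambda>p. path_class W w0 (i \<circ> p)) n c = edge_chain (path_class W w0) n (chain_map n i c)"
    using edge_chain_map[OF w i, of n c] c by (simp add: singular_cycle)
  ultimately show ?thesis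
    using group_homology_map_functor_hom[OF M path_functor_map[OF w i] group_fundamental_group[OF W(2)] c]
      classifying_homology_map_eq[OF W ic] by simp
qed

theorem theoremA:
  fixes Y :: "'y topology" and y0 :: 'y and cY :: "'y chain set"
    and M :: "'m topology" and m0 :: 'm and cM :: "'m chain set"
    and N :: "'n topology" and n0 :: 'n and cN :: "'n chain set"
    and W :: "'w topology" and cW :: "'w chain set" and i :: "'m \<Rightarrow> 'w" and j :: "'n \<Rightarrow> 'w"
    and \<Gamma>h :: "'g monoid" and \<gamma> :: "(real \<Rightarrow> 'y) set \<Rightarrow> 'g"
    and \<pi>h :: "'a monoid" and p :: "(real \<Rightarrow> 'm) set \<Rightarrow> 'a"
    and Gh :: "'b monoid" and q :: "(real \<Rightarrow> 'n) set \<Rightarrow> 'b"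
    and r :: "'k rel" and \<kappa> :: 'k
  assumes Y: "closed_3_manifold Y cY" "y0 \<in> topspace Y"
    and M: "closed_3_manifold M cM" "m0 \<in> topspace M"
    and N: "closed_3_manifold N cN" "n0 \<in> topspace N"
    and cobordant: "homology_cobordism W cW M cM i N cN j"
    and \<Gamma>h: "homology_localization (fundamental_group Y y0) \<Gamma>h \<gamma>"
    and \<pi>h: "homology_localization (fundamental_group M m0) \<pi>h p"
    and Gh: "homology_localization (fundamental_group N n0) Gh q"
    and ordinal: "Well_order r" "\<kappa> \<in> Field r"
  shows
    "((\<exists>\<phi>. \<phi> \<in> iso (lower_central_quotient Gh r \<kappa>) (lower_central_quotient \<pi>h r \<kappa>)) \<and>
      (theta_defined r \<kappa> Gh \<Gamma>h \<longleftrightarrow> theta_defined r \<kappa> \<pi>h \<Gamma>h)) \<and>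
     (\<exists>\<phi>. \<phi> \<in> iso (lower_central_quotient Gh r \<kappa>) (lower_central_quotient \<pi>h r \<kappa>) \<and>
        (\<forall>f. f \<in> iso (lower_central_quotient \<pi>h r \<kappa>) (lower_central_quotient \<Gamma>h r \<kappa>) \<longrightarrow>
           theta r \<kappa> M m0 cM \<pi>h p \<Gamma>h f = theta r \<kappa> N n0 cN Gh q \<Gamma>h (f \<circ> \<phi>))) \<and>
     (\<forall>f g. f \<in> iso (lower_central_quotient \<pi>h r \<kappa>) (lower_central_quotient \<Gamma>h r \<kappa>) \<longrightarrow>
        g \<in> iso (lower_central_quotient Gh r \<kappa>) (lower_central_quotient \<Gamma>h r \<kappa>) \<longrightarrow>
           aut_orbit (lower_central_quotient \<Gamma>h r \<kappa>) (theta r \<kappa> M m0 cM \<pi>h p \<Gamma>h f) =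
           aut_orbit (lower_central_quotient \<Gamma>h r \<kappa>) (theta r \<kappa> N n0 cN Gh q \<Gamma>h g))"
proof -
  note pM = closed_3_manifold_properties[OF M] and pN = closed_3_manifold_properties[OF N]
  note isoM = cobordant[unfolded homology_cobordism_def, THEN conjunct2, THEN conjunct2, THEN conjunct1, rule_format]
    and isoN = cobordant[unfolded homology_cobordism_def, THEN conjunct2, THEN conjunct2, THEN conjunct2, rule_format]
  have emb: "embedding_map M W i" "embedding_map N W j" and W: "manifold_with_boundary 4 W" "compact_space W"
    using cobordant by (auto simp: homology_cobordism_def bounds_difference_def Let_def compact_oriented_manifold_def)
  have i: "continuous_map M W i" and j: "continuous_map N W j"
    using emb by (auto simp: embedding_map_def continuous_map_in_subtopology dest!: homeomorphic_imp_continuous_map)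
  \<comment> \<open>One base point of \<open>W\<close> for both sides; it lies on the image of
    \<open>M\<close>, and for \<open>N\<close> the base paths in \<open>path_class W w0\<close> make
    the connection.\<close>
  define w0 where "w0 = i m0"
  have w0: "w0 \<in> topspace W" using i M(2) by (auto simp: w0_def continuous_map_def)
  \<comment> \<open>Path connectedness of \<open>W\<close> is read off from H_0.\<close>
  have "homology_group 0 M \<cong> homology_group 0 W" using isoM[of 0] by (rule is_isoI)
  then have pathW: "path_connected_space W"
    using isomorphic_homology_imp_path_connectedness pM(1) by blast
  have "Hausdorff_space W" using W(1) by (simp add: manifold_with_boundary_def)
  then have fpW: "finitely_presented (fundamental_group W w0)"
    by (intro finitely_presented_fundamental_group W manifold_locally_simple[OF W(1)] pathW w0)
  let ?\<alpha> = "functor_hom (\<lambda>p. path_class W w0 (i \<circ> p))" and ?\<beta> = "functor_hom (\<lambda>p. path_class W w0 (j \<circ> p))"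
  have \<alpha>: "two_connected (fundamental_group M m0) (fundamental_group W w0) ?\<alpha>"
    by (rule two_connected_functor_hom[OF pM(1) M(2) pathW w0 i isoM]) (use isoM[of 2] in \<open>simp add: iso_iff_mon_epi\<close>)
  have \<beta>: "two_connected (fundamental_group N n0) (fundamental_group W w0) ?\<beta>"
    by (rule two_connected_functor_hom[OF pN(1) N(2) pathW w0 j isoN]) (use isoN[of 2] in \<open>simp add: iso_iff_mon_epi\<close>)
  obtain g \<Phi> where g: "g \<in> hom (fundamental_group W w0) \<pi>h" and \<Phi>: "\<Phi> \<in> iso Gh \<pi>h"
    and g\<alpha>: "\<forall>a\<in>carrier (fundamental_group M m0). g (?\<alpha> a) = p a"
    and \<Phi>q: "\<forall>c\<in>carrier (fundamental_group N n0). \<Phi> (q c) = g (?\<beta> c)"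
    using localizations_isomorphic[OF pM(2) fpW pN(2) \<alpha> \<beta> \<pi>h Gh] by blast
  have ph: "p \<in> hom (fundamental_group M m0) \<pi>h" and qh: "q \<in> hom (fundamental_group N n0) Gh"
    and groups: "group \<pi>h" "group Gh" "group \<Gamma>h"
    using \<pi>h Gh \<Gamma>h by (auto simp: homology_localization_def local_group_group)
  have \<alpha>h: "?\<alpha> \<in> hom (fundamental_group M m0) (fundamental_group W w0)"
    and \<beta>h: "?\<beta> \<in> hom (fundamental_group N n0) (fundamental_group W w0)" and \<Phi>h: "\<Phi> \<in> hom Gh \<pi>h"
    using \<alpha> \<beta> \<Phi> by (auto simp: two_connected_def iso_def)
  let ?QM = "lower_central_quotient \<pi>h r \<kappa>" and ?QN = "lower_central_quotient Gh r \<kappa>" and ?Q = "lower_central_quotient \<Gamma>h r \<kappa>"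
  note nM = normal_lower_central[OF groups(1) ordinal(1), of \<kappa>] and nN = normal_lower_central[OF groups(2) ordinal(1), of \<kappa>]
    and nQ = normal_lower_central[OF groups(3) ordinal(1), of \<kappa>]
  note gQM = normal.factorgroup_is_group[OF nM] and gQN = normal.factorgroup_is_group[OF nN] and gQ = normal.factorgroup_is_group[OF nQ]
  let ?prM = "\<lambda>x. lower_central \<pi>h r \<kappa> #>\<^bsub>\<pi>h\<^esub> x" and ?prN = "\<lambda>x. lower_central Gh r \<kappa> #>\<^bsub>Gh\<^esub> x"
  note prM = normal.r_coset_hom_Mod[OF nM] and prN = normal.r_coset_hom_Mod[OF nN]
  \<comment> \<open>Cosets are sets, so the induced map of quotients is the direct image. It is
    built from \<open>\<Phi>\<close> alone, before any \<open>f\<close> is chosen, as part (2)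
    requires.\<close>
  define \<phi> where "\<phi> = image \<Phi>"
  have subN: "lower_central Gh r \<kappa> \<subseteq> carrier Gh" using nN by (simp add: normal_imp_subgroup subgroup.subset)
  have \<phi>: "\<phi> \<in> iso ?QN ?QM"
    using quotient_isomorphism[OF groups(2) \<Phi> subN] lower_central_image[OF groups(2,1) \<Phi> ordinal(1), of \<kappa>]
    by (simp add: \<phi>_def)
  have \<phi>pr: "\<phi> (?prN y) = ?prM (\<Phi> y)" if y: "y \<in> carrier Gh" for y
  proof -
    have "\<Phi> ` (lower_central Gh r \<kappa> #>\<^bsub>Gh\<^esub> y) = (\<lambda>k. \<Phi> (k \<otimes>\<^bsub>Gh\<^esub> y)) ` lower_central Gh r \<kappa>"
      by (auto simp: r_coset_def)
    also have "\<dots> = (\<lambda>k. \<Phi> k \<otimes>\<^bsub>\<pi>h\<^esub> \<Phi> y) ` lower_central Gh r \<kappa>"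
      using subN y by (intro image_cong[OF HOL.refl] hom_mult[OF \<Phi>h]) auto
    also have "\<dots> = \<Phi> ` lower_central Gh r \<kappa> #>\<^bsub>\<pi>h\<^esub> \<Phi> y" by (auto simp: r_coset_def)
    finally show ?thesis
      using lower_central_image[OF groups(2,1) \<Phi> ordinal(1), of \<kappa>] by (simp add: \<phi>_def)
  qed
  have \<phi>h: "\<phi> \<in> hom ?QN ?QM" using \<phi> by (simp add: iso_def)

  let ?zM = "classifying_homology_map 3 M m0 cM" and ?zN = "classifying_homology_map 3 N n0 cN"
  obtain c where c: "singular_relcycle 3 M {} c" "cM = homologous_rel_set 3 M {} c" using pM(3) by blast
  obtain d where d: "singular_relcycle 3 N {} d" "cN = homologous_rel_set 3 N {} d" using pN(3) by blast
  have zM: "?zM \<in> carrier (group_homology 3 (fundamental_group M m0))"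
    and zN: "?zN \<in> carrier (group_homology 3 (fundamental_group N n0))"
    unfolding c(2) d(2) by (intro classifying_homology_map_carrier pM pN M N c d)+
  define y where "y = group_homology_map 3 Gh q ?zN"
  have y: "y \<in> carrier (group_homology 3 Gh)"
    using group_homology_map_hom[OF qh, of 3] zN by (auto simp: y_def hom_def)
  \<comment> \<open>Both classes factor through the group of \<open>W\<close>, where they are images
    of the same class in H_3(W), and \<open>g\<close> carries them on to
    \<open>\<pi>h\<close>.\<close>
  have "group_homology_map 3 \<pi>h p ?zM = group_homology_map 3 \<pi>h (g \<circ> ?\<alpha>) ?zM"
    using g\<alpha> by (intro group_homology_map_cong[OF ph Group.hom_compose[OF \<alpha>h g] _ zM]) simp
  also have "\<dots> = group_homology_map 3 \<pi>h g (group_homology_map 3 (fundamental_group W w0) ?\<alpha> ?zM)"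
    by (rule group_homology_map_compose[OF \<alpha>h g zM, symmetric])
  also have "group_homology_map 3 (fundamental_group W w0) ?\<alpha> ?zM =
      classifying_homology_map 3 W w0 (hom_induced 3 M {} W {} i cM)"
    using classifying_homology_map_natural[OF pM(1) M(2) pathW w0 i c(1)] by (simp add: c(2))
  also have "\<dots> = classifying_homology_map 3 W w0 (hom_induced 3 N {} W {} j cN)"
    using homology_cobordism_classes_eq[OF cobordant] by simp
  also have "\<dots> = group_homology_map 3 (fundamental_group W w0) ?\<beta> ?zN"
    using classifying_homology_map_natural[OF pN(1) N(2) pathW w0 j d(1)] by (simp add: d(2))
  also have "group_homology_map 3 \<pi>h g \<dots> = group_homology_map 3 \<pi>h (g \<circ> ?\<beta>) ?zN"
    by (rule group_homology_map_compose[OF \<beta>h g zN])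
  also have "\<dots> = group_homology_map 3 \<pi>h (\<Phi> \<circ> q) ?zN"
    using \<Phi>q by (intro group_homology_map_cong[OF Group.hom_compose[OF \<beta>h g] Group.hom_compose[OF qh \<Phi>h] _ zN]) simp
  also have "\<dots> = group_homology_map 3 \<pi>h \<Phi> y"
    unfolding y_def by (rule group_homology_map_compose[OF qh \<Phi>h zN, symmetric])
  finally have key: "group_homology_map 3 \<pi>h p ?zM = group_homology_map 3 \<pi>h \<Phi> y" .

  define z where "z = group_homology_map 3 ?QN ?prN y"
  have z: "z \<in> carrier (group_homology 3 ?QN)"
    using group_homology_map_hom[OF prN, of 3] y by (auto simp: z_def hom_def)
  have "group_homology_map 3 ?QM ?prM (group_homology_map 3 \<pi>h \<Phi> y) = group_homology_map 3 ?QM (?prM \<circ> \<Phi>) y"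
    by (rule group_homology_map_compose[OF \<Phi>h prM y])
  also have "\<dots> = group_homology_map 3 ?QM (\<phi> \<circ> ?prN) y"
    using \<phi>pr by (intro group_homology_map_cong[OF Group.hom_compose[OF \<Phi>h prM] Group.hom_compose[OF prN \<phi>h] _ y]) simp
  also have "\<dots> = group_homology_map 3 ?QM \<phi> z"
    unfolding z_def by (rule group_homology_map_compose[OF prN \<phi>h y, symmetric])
  finally have key': "group_homology_map 3 ?QM ?prM (group_homology_map 3 \<pi>h p ?zM) = group_homology_map 3 ?QM \<phi> z"
    unfolding key .
  have thetaN: "theta r \<kappa> N n0 cN Gh q \<Gamma>h h = group_homology_map 3 ?Q h z" for h
    by (simp add: theta_def z_def y_def)
  have thetaM: "theta r \<kappa> M m0 cM \<pi>h p \<Gamma>h f = group_homology_map 3 ?Q (f \<circ> \<phi>) z" if f: "f \<in> iso ?QM ?Q" for f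
    unfolding theta_def key' using f by (intro group_homology_map_compose[OF \<phi>h _ z]) (simp add: iso_def)

  have 1: "theta_defined r \<kappa> Gh \<Gamma>h \<longleftrightarrow> theta_defined r \<kappa> \<pi>h \<Gamma>h"
    unfolding theta_defined_def
    using iso_set_trans[OF \<phi>] iso_set_trans[OF group.iso_set_sym[OF gQN \<phi>]] by blast
  have 3: "aut_orbit ?Q (theta r \<kappa> M m0 cM \<pi>h p \<Gamma>h f) = aut_orbit ?Q (theta r \<kappa> N n0 cN Gh q \<Gamma>h h)"
    if f: "f \<in> iso ?QM ?Q" and h: "h \<in> iso ?QN ?Q" for f h
  proof -
    have f\<phi>: "f \<circ> \<phi> \<in> iso ?QN ?Q" by (rule iso_set_trans[OF \<phi> f])
    \<comment> \<open>The automorphism relating the two invariants is \<open>h\<close> after the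
      inverse of \<open>f \<circ> \<phi>\<close>: arbitrary identifications are compared through the
      one that comes from the cobordism.\<close>
    obtain k where k: "group_isomorphisms ?QN ?Q (f \<circ> \<phi>) k"
      using f\<phi> group.iso_iff_group_isomorphisms[OF gQN] by blast
    have kiso: "k \<in> iso ?Q ?QN" by (rule group_isomorphisms_imp_iso[OF group_isomorphisms_sym[OF k]])
    have a: "h \<circ> k \<in> iso ?Q ?Q" by (rule iso_set_trans[OF kiso h])
    have homs: "f \<circ> \<phi> \<in> hom ?QN ?Q" "h \<circ> k \<in> hom ?Q ?Q" "h \<in> hom ?QN ?Q"
      using f\<phi> a h by (simp_all add: iso_def)
    have fz: "group_homology_map 3 ?Q (f \<circ> \<phi>) z \<in> carrier (group_homology 3 ?Q)"
      using group_homology_map_hom[OF homs(1), of 3] z by (auto simp: hom_def)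
    have "group_homology_map 3 ?Q (h \<circ> k) (group_homology_map 3 ?Q (f \<circ> \<phi>) z) = group_homology_map 3 ?Q ((h \<circ> k) \<circ> (f \<circ> \<phi>)) z"
      by (rule group_homology_map_compose[OF homs(1,2) z])
    also have "\<dots> = group_homology_map 3 ?Q h z"
      using k by (intro group_homology_map_cong[OF Group.hom_compose[OF homs(1,2)] homs(3) _ z])
        (simp add: group_isomorphisms_def)
    finally show ?thesis
      using aut_orbit_iso[OF gQ a fz] by (simp add: thetaM[OF f] thetaN)
  qed
  show ?thesis
    using \<phi> 1 3 thetaM thetaN by blast
qed

end
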